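(* Let $R$ be an integral domain of characteristic zero and let $G$ be an $m$-dimensional formal group law over $R$ with Lie algebra $\mathfrak{g}$. Let $\tilde{\mathcal{O}}(G)$ be the modified ring of functions of $G$ and let $\mathcal{U}^\star=\mathrm{Hom}_R(\mathcal{U}(\mathfrak{g}),R)$. Then the map $\tilde\beta^\star:\tilde{\mathcal{O}}(G)\to\mathcal{U}^\star$ is an isomorphism of complete Hopf algebras.
   Context: An $m$-dimensional formal group law over $R$ is an $m$-tuple $G=(G^{(1)},\dots,G^{(m)})$ of power series in $R[[\mathbf{X},\mathbf{Y}]]$ with $G^{(j)}(\mathbf{X},\mathbf{Y})=X_j+Y_j+\sum_{l,k}\gamma^j_{lk}X_lY_k+(\text{total degree}\ge3)$ and $G(G(\mathbf{X},\mathbf{Y}),\mathbf{Z})=G(\mathbf{X},G(\mathbf{Y},\mathbf{Z}))$. There is then an $m$-tuple of power series $s(\mathbf X)$ with $G(\mathbf{X},s(\mathbf{X}))=0$. The Lie algebra $\mathfrak{g}$ is the free $R$-module on $e_1,\dots,e_m$ with $[e_l,e_k]=\sum_j(\gamma^j_{lk}-\gamma^j_{kl})e_j$; $\mathcal{U}(\mathfrak{g})$ is its universal enveloping algebra, with its usual Hopf algebra structure (elements of $\mathfrak{g}$ primitive, antipode $L\mapsto-L$). A complete Hopf algebra over $R$ is defined like a Hopf algebra, but with $R$-modules complete for a descending filtration, continuous maps, and completed tensor products $\hat\otimes$. $\tilde{\mathcal{O}}(G)=\{\sum b_{\underline j}\underline t^{\underline j}\in Q(R)[[\underline t]]:\underline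 j!\,b_{\underline j}\in R\}$, where $Q(R)$ is the quotient field, $\underline t=(t^{(1)},\dots,t^{(m)})$, $\underline j!=j_1!\cdots j_m!$, filtered by $F^i=\{f:\text{all monomials of }f\text{ have total degree}\ge i\}$. Its complete Hopf algebra structure: multiplication and unit of power series; comultiplication $\mu(f)(\underline t_1,\underline t_2)=f(G(\underline t_1,\underline t_2))$; counit $f\mapsto f(0)$; antipode $f\mapsto f(s(\underline t))$. $\mathcal{U}^\star$ is a complete Hopf algebra with structure maps dual to those of $\mathcal{U}(\mathfrak{g})$: product $(\psi\bullet\varphi)(x)=(\psi\otimes\varphi)(\mu(x))$, unit $\varepsilon$, coproduct $\mu(\varphi)(x\otimes y)=\varphi(xy)$ (identifying $\mathcal{U}^\star\hat\otimes\,\mathcal{U}^\star$ with $(\mathcal{U}(\mathfrak{g})\otimes\mathcal{U}(\mathfrak{g}))^\star$), counit $\varphi\mapsto\varphi(1)$, antipode $\varphi\mapsto\varphi\circ s$. Its filtration $\mathcal{F}^i\mathcal{U}^\star$ consists of the functionals vanishing on all PBW monomials $e_1^{j_1}\cdots e_m^{j_m}$ with $j_1+\dots+j_m<i$. The map $\tilde\beta^\star$ is induced by the pairing $\mathfrak{g}\otimes\tilde{\mathcal{O}}(G)\to R$, $e_j\otimes f\mapsto\frac{\partial f}{\partial t^{(j)}}(0)$; explicitly, $\tilde\beta^\star(f)(1)=f(0)$ and $\tilde\beta^\star(f)(e_{i_1}\cdots e_{i_k})=\frac{\partial^k}{\partial t_1^{(i_1)}\cdots\partial t_k^{(i_k)}}f(G(\underline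 t_1,\dots,\underline t_k))\big|_0$, where $G(\underline t_1,\dots,\underline t_k)$ is the iterated group law. *)

theory Defs
  imports
    Complex_Main
    "HOL-Library.Poly_Mapping"
    "HOL-Library.Function_Algebras"
    "HOL-Library.Product_Plus"
    "HOL-Computational_Algebra.Fraction_Field"
begin

section \<open>Power series in several variables\<close>

type_synonym 'v mono = "'v \<Rightarrow>\<^sub>0 nat"

definition mono_deg :: "'v mono \<Rightarrow> nat" where
  "mono_deg m = (\<Sum>v\<in>Poly_Mapping.keys m. Poly_Mapping.lookup m v)"

definition mono_fact :: "'v mono \<Rightarrow> nat" where
  "mono_fact m = (\<Prod>v\<in>Poly_Mapping.keys m. fact (Poly_Mapping.lookup m v))"

typedef ('v, 'a) mps = "UNIV :: ('v mono \<Rightarrow> 'a) set"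
  morphisms mcoeff Abs_mps by simp

lemma mcoeff_Abs [simp]: "mcoeff (Abs_mps f) = f"
  by (simp add: Abs_mps_inverse)

lemma mps_eqI: "(\<And>m. mcoeff f m = mcoeff g m) \<Longrightarrow> f = g"
  by (metis ext mcoeff_inject)

definition mono_splits :: "'v mono \<Rightarrow> ('v mono \<times> 'v mono) set" where
  "mono_splits m = {(a, b). a + b = m}"

lemma finite_mono_below:
  "finite {a :: 'v mono. \<forall>v. Poly_Mapping.lookup a v \<le> Poly_Mapping.lookup m v}" (is "finite ?A")
proof -
  let ?K = "Poly_Mapping.keys m"
  let ?N = "Max (insert 0 (Poly_Mapping.lookup m ` ?K))"
  let ?F = "{f. \<forall>v. (v \<in> ?K \<longrightarrow> f v \<in> {..?N}) \<and> (v \<notin> ?K \<longrightarrow> f v = (0::nat))}"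
  have "finite ?F"
    by (rule finite_set_of_finite_funs) auto
  moreover have "Poly_Mapping.lookup ` ?A \<subseteq> ?F"
  proof clarsimp
    fix a v assume le: "\<forall>v. Poly_Mapping.lookup a v \<le> Poly_Mapping.lookup m v"
    show "(v \<in> ?K \<longrightarrow> Poly_Mapping.lookup a v \<le> ?N) \<and> (v \<notin> ?K \<longrightarrow> Poly_Mapping.lookup a v = 0)"
      using le[rule_format, of v]
      by (auto simp: in_keys_iff intro!: order.trans[OF _ Max_ge])
  qed
  ultimately have "finite (Poly_Mapping.lookup ` ?A)" by (rule finite_subset[rotated])
  thus ?thesis
    by (rule finite_imageD) (auto intro: inj_onI poly_mapping_eqI)
qed

lemma finite_mono_splits [simp]: "finite (mono_splits m)"
proof -
  let ?A = "{a. \<forall>v. Poly_Mapping.lookup a v \<le> Poly_Mapping.lookup m v}"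
  have "mono_splits m \<subseteq> ?A \<times> ?A"
    by (auto simp: mono_splits_def lookup_add)
  thus ?thesis using finite_mono_below finite_subset by blast
qed

instantiation mps :: (type, comm_ring_1) comm_ring_1
begin

definition "0 = Abs_mps (\<lambda>_. 0)"
definition "1 = Abs_mps (\<lambda>m. if m = 0 then 1 else 0)"
definition "f + g = Abs_mps (\<lambda>m. mcoeff f m + mcoeff g m)"
definition "f - g = Abs_mps (\<lambda>m. mcoeff f m - mcoeff g m)"
definition "- f = Abs_mps (\<lambda>m. - mcoeff f m)"
definition "f * g = Abs_mps (\<lambda>m. \<Sum>(a, b)\<in>mono_splits m. mcoeff f a * mcoeff g b)"

instance
proof
  fix f g h :: "('a, 'b) mps"
  show "f * g * h = f * (g * h)"
  proof (rule mps_eqI)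
    fix m
    have "mcoeff (f * g * h) m =
      (\<Sum>(x, y)\<in>(SIGMA x:mono_splits m. mono_splits (fst x)).
         mcoeff f (fst y) * mcoeff g (snd y) * mcoeff h (snd x))"
      by (simp add: times_mps_def sum_distrib_right case_prod_unfold sum.Sigma)
    also have "\<dots> = (\<Sum>(x, y)\<in>(SIGMA x:mono_splits m. mono_splits (snd x)).
         mcoeff f (fst x) * (mcoeff g (fst y) * mcoeff h (snd y)))"
      by (rule sum.reindex_bij_witness
          [where i = "\<lambda>((a, bc), (b, c)). ((a + b, c), (a, b))"
             and j = "\<lambda>((ab, c), (a, b)). ((a, b + c), (b, c))"])
         (auto simp: mono_splits_def algebra_simps)
    also have "\<dots> = mcoeff (f * (g * h)) m"
      by (simp add: times_mps_def sum_distrib_left case_prod_unfold sum.Sigma)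
    finally show "mcoeff (f * g * h) m = mcoeff (f * (g * h)) m" .
  qed
  show "f * g = g * f"
    unfolding times_mps_def
    by (intro arg_cong[where f = Abs_mps] ext
        sum.reindex_bij_witness[where i = prod.swap and j = prod.swap])
       (auto simp: mono_splits_def algebra_simps)
  show "1 * f = f"
  proof (rule mps_eqI)
    fix m
    have "mcoeff (1 * f) m =
      (\<Sum>x\<in>mono_splits m. if x = (0, m) then mcoeff f m else 0)"
      unfolding times_mps_def one_mps_def mcoeff_Abs
      by (intro sum.cong) (auto simp: mono_splits_def split: if_splits)
    also have "\<dots> = mcoeff f m"
      by (subst sum.delta) (simp, simp add: mono_splits_def)
    finally show "mcoeff (1 * f) m = mcoeff f m" .
  qed
  show "(f + g) * h = f * h + g * h"
    by (rule mps_eqI)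
       (simp add: times_mps_def plus_mps_def sum.distrib case_prod_unfold algebra_simps)
  show "(0 :: ('a, 'b) mps) \<noteq> 1"
  proof
    assume "(0 :: ('a, 'b) mps) = 1"
    hence "mcoeff (0 :: ('a, 'b) mps) 0 = mcoeff (1 :: ('a, 'b) mps) 0" by simp
    thus False by (simp add: zero_mps_def one_mps_def)
  qed
qed (auto intro!: mps_eqI simp: plus_mps_def minus_mps_def uminus_mps_def zero_mps_def)

end

definition mps_const :: "'a::zero \<Rightarrow> ('v, 'a) mps" where
  "mps_const c = Abs_mps (\<lambda>m. if m = 0 then c else 0)"

definition mps_var :: "'v \<Rightarrow> ('v, 'a::zero_neq_one) mps" where
  "mps_var v = Abs_mps (\<lambda>m. if m = Poly_Mapping.single v 1 then 1 else 0)"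

definition mps_map :: "('a \<Rightarrow> 'b) \<Rightarrow> ('v, 'a) mps \<Rightarrow> ('v, 'b) mps" where
  "mps_map h f = Abs_mps (\<lambda>m. h (mcoeff f m))"

definition mps_deriv :: "'v \<Rightarrow> ('v, 'a::semiring_1) mps \<Rightarrow> ('v, 'a) mps" where
  "mps_deriv v f = Abs_mps (\<lambda>m. of_nat (Poly_Mapping.lookup m v + 1) *
     mcoeff f (m + Poly_Mapping.single v 1))"

text \<open>
  Substitution of \<open>\<sigma> v\<close> for the variable \<open>v\<close>. For finitely many variables and all \<open>\<sigma> v\<close> without
  constant term, only finitely many \<open>j\<close> contribute to each coefficient, so that the sum over all
  exponents, \<^const>\<open>Sum_any\<close>, is the intended one; it is used only in this situation.
\<close>
definition mps_subst :: "('v, 'a::comm_ring_1) mps \<Rightarrow> ('v \<Rightarrow> ('w, 'a) mps) \<Rightarrow> ('w, 'a) mps" where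
  "mps_subst f \<sigma> = Abs_mps (\<lambda>m. Sum_any (\<lambda>j. mcoeff f j *
     mcoeff (\<Prod>v\<in>Poly_Mapping.keys j. \<sigma> v ^ Poly_Mapping.lookup j v) m))"


section \<open>Formal group laws\<close>

text \<open>
  The coordinates are indexed by a finite type \<open>'n\<close>, so \<open>m = CARD('n)\<close>. In a formal group law the
  variables \<open>Inl j\<close> and \<open>Inr j\<close> are \<open>X\<^sub>j\<close> and \<open>Y\<^sub>j\<close>.
\<close>

type_synonym ('n, 'a) fgl = "'n \<Rightarrow> ('n + 'n, 'a) mps"

definition fgl_app ::
  "('n, 'a::comm_ring_1) fgl \<Rightarrow> ('n \<Rightarrow> ('w, 'a) mps) \<Rightarrow> ('n \<Rightarrow> ('w, 'a) mps) \<Rightarrow> 'n \<Rightarrow> ('w, 'a) mps"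
  where "fgl_app G A B = (\<lambda>j. mps_subst (G j) (case_sum A B))"

definition var_block :: "nat \<Rightarrow> 'n \<Rightarrow> (nat \<times> 'n, 'a::comm_ring_1) mps" where
  "var_block a = (\<lambda>j. mps_var (a, j))"

definition is_fgl :: "('n::finite, 'a::comm_ring_1) fgl \<Rightarrow> bool" where
  "is_fgl G \<longleftrightarrow>
     (\<exists>\<gamma>. \<forall>j m. mono_deg m < 3 \<longrightarrow>
        mcoeff (G j) m = mcoeff (mps_var (Inl j) + mps_var (Inr j) +
          (\<Sum>l\<in>UNIV. \<Sum>k\<in>UNIV. mps_const (\<gamma> j l k) * mps_var (Inl l) * mps_var (Inr k))) m) \<and>
     fgl_app G (fgl_app G (var_block 0) (var_block 1)) (var_block 2) =
     fgl_app G (var_block 0) (fgl_app G (var_block 1) (var_block 2))"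

definition fgl_gamma :: "('n, 'a) fgl \<Rightarrow> 'n \<Rightarrow> 'n \<Rightarrow> 'n \<Rightarrow> 'a" where
  "fgl_gamma G j l k =
     mcoeff (G j) (Poly_Mapping.single (Inl l) 1 + Poly_Mapping.single (Inr k) 1)"

definition fgl_inverse :: "('n, 'a::comm_ring_1) fgl \<Rightarrow> 'n \<Rightarrow> ('n, 'a) mps" where
  "fgl_inverse G = (THE s. (\<forall>j. mcoeff (s j) 0 = 0) \<and> fgl_app G mps_var s = (\<lambda>_. 0))"

text \<open>The iterated law \<open>G(\<^bold>t\<^sub>0, \<dots>, \<^bold>t\<^bsub>k-1\<^esub>)\<close>, with the empty product \<open>0\<close>; the variable \<open>(a, j)\<close> is the \<open>j\<close>-th entry of \<open>\<^bold>t\<^sub>a\<close>.\<close>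
fun fgl_iter :: "('n, 'a::comm_ring_1) fgl \<Rightarrow> nat \<Rightarrow> 'n \<Rightarrow> (nat \<times> 'n, 'a) mps" where
  "fgl_iter G 0 = (\<lambda>_. 0)"
| "fgl_iter G (Suc 0) = var_block 0"
| "fgl_iter G (Suc (Suc k)) = fgl_app G (fgl_iter G (Suc k)) (var_block (Suc k))"

definition lie_bracket ::
  "('n::finite, 'a::comm_ring_1) fgl \<Rightarrow> ('n \<Rightarrow> 'a) \<Rightarrow> ('n \<Rightarrow> 'a) \<Rightarrow> 'n \<Rightarrow> 'a" where
  "lie_bracket G x y = (\<lambda>j. \<Sum>l\<in>UNIV. \<Sum>k\<in>UNIV.
     (fgl_gamma G j l k - fgl_gamma G j k l) * x l * y k)"


section \<open>Complete filtered modules and completed tensor products\<close>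

text \<open>
  A filtered module is a submodule \<open>fil M 0\<close> of an ambient module with scalar multiplication
  \<open>scl M\<close>, together with the descending chain \<open>fil M i\<close>.
\<close>
record ('a, 'h) filtered_module =
  scl :: "'a \<Rightarrow> 'h \<Rightarrow> 'h"
  fil :: "nat \<Rightarrow> 'h set"

abbreviation pts :: "('a, 'h, 'z) filtered_module_scheme \<Rightarrow> 'h set" where
  "pts M \<equiv> fil M 0"

text \<open>The last two conditions say that \<open>M \<rightarrow> lim M / F\<^sup>i M\<close> is injective and surjective.\<close>
definition complete_module :: "('a::comm_ring_1, 'h::ab_group_add) filtered_module \<Rightarrow> bool" where
  "complete_module M \<longleftrightarrow>
     module (scl M) \<and>
     (\<forall>i. module.subspace (scl M) (fil M i)) \<and>
     (\<forall>i. fil M (Suc i) \<subseteq> fil M i) \<and>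
     (\<Inter>i. fil M i) = {0} \<and>
     (\<forall>x. (\<forall>i. x i \<in> pts M \<and> x (Suc i) - x i \<in> fil M i) \<longrightarrow>
        (\<exists>y\<in>pts M. \<forall>i. y - x i \<in> fil M i))"

definition cont_linear ::
  "('a::comm_ring_1, 'h::ab_group_add) filtered_module \<Rightarrow> ('a, 'k::ab_group_add) filtered_module \<Rightarrow>
   ('h \<Rightarrow> 'k) \<Rightarrow> bool" where
  "cont_linear M N f \<longleftrightarrow>
     (\<forall>x\<in>pts M. f x \<in> pts N) \<and>
     (\<forall>x\<in>pts M. \<forall>y\<in>pts M. f (x + y) = f x + f y) \<and>
     (\<forall>r. \<forall>x\<in>pts M. f (scl M r x) = scl N r (f x)) \<and>
     (\<forall>k. \<exists>l. f ` fil M l \<subseteq> fil N k)"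

definition bilinear_on ::
  "('a::comm_ring_1, 'h::ab_group_add) filtered_module \<Rightarrow> ('a, 'k::ab_group_add) filtered_module \<Rightarrow>
   ('a, 't::ab_group_add) filtered_module \<Rightarrow> ('h \<Rightarrow> 'k \<Rightarrow> 't) \<Rightarrow> bool" where
  "bilinear_on M N T b \<longleftrightarrow>
     (\<forall>x\<in>pts M. \<forall>y\<in>pts N. b x y \<in> pts T) \<and>
     (\<forall>x\<in>pts M. \<forall>x'\<in>pts M. \<forall>y\<in>pts N. b (x + x') y = b x y + b x' y) \<and>
     (\<forall>x\<in>pts M. \<forall>y\<in>pts N. \<forall>y'\<in>pts N. b x (y + y') = b x y + b x y') \<and>
     (\<forall>r. \<forall>x\<in>pts M. \<forall>y\<in>pts N. b (scl M r x) y = scl T r (b x y) \<and> b x (scl N r y) = scl T r (b x y))"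

text \<open>Continuity for the tensor product filtration \<open>\<Sum>\<^bsub>i+j=l\<^esub> F\<^sup>i M \<otimes> F\<^sup>j N\<close>.\<close>
definition cont_bilinear ::
  "('a::comm_ring_1, 'h::ab_group_add) filtered_module \<Rightarrow> ('a, 'k::ab_group_add) filtered_module \<Rightarrow>
   ('a, 't::ab_group_add) filtered_module \<Rightarrow> ('h \<Rightarrow> 'k \<Rightarrow> 't) \<Rightarrow> bool" where
  "cont_bilinear M N T b \<longleftrightarrow> bilinear_on M N T b \<and>
     (\<forall>k. \<exists>l. \<forall>i j. i + j = l \<longrightarrow> (\<forall>x\<in>fil M i. \<forall>y\<in>fil N j. b x y \<in> fil T k))"

text \<open>
  The algebraic tensor product is the free module on pairs modulo the bilinearity relations.
  \<open>tensor_fil M N k\<close> is the preimage in the free module of \<open>\<Sum>\<^bsub>i+j=k\<^esub> F\<^sup>i M \<otimes> F\<^sup>j N\<close>.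
\<close>
definition tensor_rels ::
  "('a::comm_ring_1, 'h::ab_group_add) filtered_module \<Rightarrow> ('a, 'k::ab_group_add) filtered_module \<Rightarrow>
   ('h \<times> 'k \<Rightarrow>\<^sub>0 'a) set" where
  "tensor_rels M N =
     {Poly_Mapping.single (x + x', y) 1 - Poly_Mapping.single (x, y) 1 - Poly_Mapping.single (x', y) 1
       | x x' y. x \<in> pts M \<and> x' \<in> pts M \<and> y \<in> pts N} \<union>
     {Poly_Mapping.single (x, y + y') 1 - Poly_Mapping.single (x, y) 1 - Poly_Mapping.single (x, y') 1
       | x y y'. x \<in> pts M \<and> y \<in> pts N \<and> y' \<in> pts N} \<union>
     {Poly_Mapping.single (scl M r x, y) 1 - Poly_Mapping.single (x, y) r
       | r x y. x \<in> pts M \<and> y \<in> pts N} \<union>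
     {Poly_Mapping.single (x, scl N r y) 1 - Poly_Mapping.single (x, y) r
       | r x y. x \<in> pts M \<and> y \<in> pts N}"

definition tensor_fil ::
  "('a::comm_ring_1, 'h::ab_group_add) filtered_module \<Rightarrow> ('a, 'k::ab_group_add) filtered_module \<Rightarrow>
   nat \<Rightarrow> ('h \<times> 'k \<Rightarrow>\<^sub>0 'a) set" where
  "tensor_fil M N k = module.span (\<lambda>r. Poly_Mapping.map ((*) r))
     (tensor_rels M N \<union>
      {Poly_Mapping.single (x, y) 1 | x y i j. x \<in> fil M i \<and> y \<in> fil N j \<and> i + j = k})"

definition free_ext ::
  "('a::comm_ring_1, 't::ab_group_add) filtered_module \<Rightarrow> ('h \<Rightarrow> 'k \<Rightarrow> 't) \<Rightarrow> ('h \<times> 'k \<Rightarrow>\<^sub>0 'a) \<Rightarrow> 't"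
  where
  "free_ext T b z = (\<Sum>p\<in>Poly_Mapping.keys z. scl T (Poly_Mapping.lookup z p) (b (fst p) (snd p)))"

text \<open>
  \<open>T\<close> with the bilinear map \<open>b\<close> is the completed tensor product of \<open>M\<close> and \<open>N\<close>: \<open>T\<close> is complete, and
  \<open>b\<close> induces isomorphisms \<open>(M \<otimes> N) / F\<^sup>k (M \<otimes> N) \<cong> T / F\<^sup>k T\<close>, i.e. \<open>T\<close> is the completion
  \<open>lim (M \<otimes> N) / F\<^sup>k (M \<otimes> N)\<close>.
\<close>
definition is_completed_tensor ::
  "('a::comm_ring_1, 'h::ab_group_add) filtered_module \<Rightarrow> ('a, 'k::ab_group_add) filtered_module \<Rightarrow>
   ('a, 't::ab_group_add) filtered_module \<Rightarrow> ('h \<Rightarrow> 'k \<Rightarrow> 't) \<Rightarrow> bool" where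
  "is_completed_tensor M N T b \<longleftrightarrow>
     complete_module T \<and> bilinear_on M N T b \<and>
     (\<forall>k z. Poly_Mapping.keys z \<subseteq> pts M \<times> pts N \<longrightarrow>
        (free_ext T b z \<in> fil T k \<longleftrightarrow> z \<in> tensor_fil M N k)) \<and>
     (\<forall>k. \<forall>t\<in>pts T. \<exists>z. Poly_Mapping.keys z \<subseteq> pts M \<times> pts N \<and> t - free_ext T b z \<in> fil T k)"


section \<open>Complete Hopf algebras\<close>

text \<open>
  Completed tensor products are determined up to unique isomorphism; the models in which the
  structure maps take their values are part of the data. \<open>sq\<close> is \<open>H \<otimes> H\<close> with \<open>x \<otimes> y = ten x y\<close>,
  and \<open>cube\<close> is \<open>H \<otimes> H \<otimes> H\<close>, seen both as \<open>(H \<otimes> H) \<otimes> H\<close> through \<open>tenl\<close> and as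
  \<open>H \<otimes> (H \<otimes> H)\<close> through \<open>tenr\<close>.
\<close>
record ('a, 'h, 's, 'c) hopf_data =
  mdl :: "('a, 'h) filtered_module"
  sq :: "('a, 's) filtered_module"
  ten :: "'h \<Rightarrow> 'h \<Rightarrow> 's"
  cube :: "('a, 'c) filtered_module"
  tenl :: "'s \<Rightarrow> 'h \<Rightarrow> 'c"
  tenr :: "'h \<Rightarrow> 's \<Rightarrow> 'c"
  mul :: "'h \<Rightarrow> 'h \<Rightarrow> 'h"
  unt :: "'h"
  comul :: "'h \<Rightarrow> 's"
  counit :: "'h \<Rightarrow> 'a"
  antipode :: "'h \<Rightarrow> 'h"

text \<open>
  A map such as \<open>\<mu> \<otimes> id\<close> on a completed tensor product is the (unique) continuous linear map with
  the given values on the elements \<open>x \<otimes> y\<close>. The ground ring is discrete.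
\<close>
definition complete_hopf_algebra ::
  "('a::comm_ring_1, 'h::ab_group_add, 's::ab_group_add, 'c::ab_group_add) hopf_data \<Rightarrow> bool" where
  "complete_hopf_algebra H \<longleftrightarrow>
    complete_module (mdl H) \<and>
    is_completed_tensor (mdl H) (mdl H) (sq H) (ten H) \<and>
    is_completed_tensor (sq H) (mdl H) (cube H) (tenl H) \<and>
    is_completed_tensor (mdl H) (sq H) (cube H) (tenr H) \<and>
    (\<forall>x\<in>pts (mdl H). \<forall>y\<in>pts (mdl H). \<forall>z\<in>pts (mdl H).
       tenl H (ten H x y) z = tenr H x (ten H y z)) \<and>
    cont_bilinear (mdl H) (mdl H) (mdl H) (mul H) \<and>
    (\<forall>x\<in>pts (mdl H). \<forall>y\<in>pts (mdl H). \<forall>z\<in>pts (mdl H).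
       mul H (mul H x y) z = mul H x (mul H y z)) \<and>
    unt H \<in> pts (mdl H) \<and>
    (\<forall>x\<in>pts (mdl H). mul H (unt H) x = x \<and> mul H x (unt H) = x) \<and>
    cont_linear (mdl H) (sq H) (comul H) \<and>
    (\<exists>L R. cont_linear (sq H) (cube H) L \<and> cont_linear (sq H) (cube H) R \<and>
       (\<forall>x\<in>pts (mdl H). \<forall>y\<in>pts (mdl H).
          L (ten H x y) = tenl H (comul H x) y \<and> R (ten H x y) = tenr H x (comul H y)) \<and>
       (\<forall>x\<in>pts (mdl H). L (comul H x) = R (comul H x))) \<and>
    cont_linear (mdl H) \<lparr>scl = (*), fil = (\<lambda>i. if i = 0 then UNIV else {0})\<rparr> (counit H) \<and>
    (\<exists>L R. cont_linear (sq H) (mdl H) L \<and> cont_linear (sq H) (mdl H) R \<and>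
       (\<forall>x\<in>pts (mdl H). \<forall>y\<in>pts (mdl H).
          L (ten H x y) = scl (mdl H) (counit H x) y \<and>
          R (ten H x y) = scl (mdl H) (counit H y) x) \<and>
       (\<forall>x\<in>pts (mdl H). L (comul H x) = x \<and> R (comul H x) = x)) \<and>
    (\<exists>M. cont_bilinear (sq H) (sq H) (sq H) M \<and>
       (\<forall>x\<in>pts (mdl H). \<forall>y\<in>pts (mdl H). \<forall>x'\<in>pts (mdl H). \<forall>y'\<in>pts (mdl H).
          M (ten H x y) (ten H x' y') = ten H (mul H x x') (mul H y y')) \<and>
       (\<forall>x\<in>pts (mdl H). \<forall>y\<in>pts (mdl H). comul H (mul H x y) = M (comul H x) (comul H y))) \<and>
    comul H (unt H) = ten H (unt H) (unt H) \<and>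
    (\<forall>x\<in>pts (mdl H). \<forall>y\<in>pts (mdl H). counit H (mul H x y) = counit H x * counit H y) \<and>
    counit H (unt H) = 1 \<and>
    cont_linear (mdl H) (mdl H) (antipode H) \<and>
    (\<exists>L R. cont_linear (sq H) (mdl H) L \<and> cont_linear (sq H) (mdl H) R \<and>
       (\<forall>x\<in>pts (mdl H). \<forall>y\<in>pts (mdl H).
          L (ten H x y) = mul H (antipode H x) y \<and> R (ten H x y) = mul H x (antipode H y)) \<and>
       (\<forall>x\<in>pts (mdl H).
          L (comul H x) = scl (mdl H) (counit H x) (unt H) \<and>
          R (comul H x) = scl (mdl H) (counit H x) (unt H)))"

definition complete_hopf_hom ::
  "('a::comm_ring_1, 'h::ab_group_add, 's::ab_group_add, 'c::ab_group_add) hopf_data \<Rightarrow>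
   ('a, 'h2::ab_group_add, 's2::ab_group_add, 'c2::ab_group_add) hopf_data \<Rightarrow> ('h \<Rightarrow> 'h2) \<Rightarrow> bool" where
  "complete_hopf_hom H K \<phi> \<longleftrightarrow>
    cont_linear (mdl H) (mdl K) \<phi> \<and>
    (\<forall>x\<in>pts (mdl H). \<forall>y\<in>pts (mdl H). \<phi> (mul H x y) = mul K (\<phi> x) (\<phi> y)) \<and>
    \<phi> (unt H) = unt K \<and>
    (\<exists>\<Phi>. cont_linear (sq H) (sq K) \<Phi> \<and>
       (\<forall>x\<in>pts (mdl H). \<forall>y\<in>pts (mdl H). \<Phi> (ten H x y) = ten K (\<phi> x) (\<phi> y)) \<and>
       (\<forall>x\<in>pts (mdl H). comul K (\<phi> x) = \<Phi> (comul H x))) \<and>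
    (\<forall>x\<in>pts (mdl H). counit K (\<phi> x) = counit H x) \<and>
    (\<forall>x\<in>pts (mdl H). antipode K (\<phi> x) = \<phi> (antipode H x))"

definition complete_hopf_iso ::
  "('a::comm_ring_1, 'h::ab_group_add, 's::ab_group_add, 'c::ab_group_add) hopf_data \<Rightarrow>
   ('a, 'h2::ab_group_add, 's2::ab_group_add, 'c2::ab_group_add) hopf_data \<Rightarrow> ('h \<Rightarrow> 'h2) \<Rightarrow> bool" where
  "complete_hopf_iso H K \<phi> \<longleftrightarrow>
    complete_hopf_algebra H \<and> complete_hopf_algebra K \<and>
    bij_betw \<phi> (pts (mdl H)) (pts (mdl K)) \<and>
    complete_hopf_hom H K \<phi> \<and>
    complete_hopf_hom K H (inv_into (pts (mdl H)) \<phi>)"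


section \<open>The modified ring of functions\<close>

definition to_quot :: "'a::idom \<Rightarrow> 'a fract" where
  "to_quot a = Fract a 1"

text \<open>
  Also used with \<open>'n + 'n\<close> and \<open>'n + ('n + 'n)\<close> as variables, where it is the completed tensor square
  and cube.
\<close>
definition mod_functions :: "('v, 'a::idom fract) mps set" where
  "mod_functions = {f. \<forall>m. of_nat (mono_fact m) * mcoeff f m \<in> range to_quot}"

definition mod_functions_module :: "('a::idom, ('v, 'a fract) mps) filtered_module" where
  "mod_functions_module =
     \<lparr>scl = (\<lambda>r f. mps_const (to_quot r) * f),
      fil = (\<lambda>i. {f \<in> mod_functions. \<forall>m. mcoeff f m \<noteq> 0 \<longrightarrow> i \<le> mono_deg m})\<rparr>"

definition mps_rename :: "('v \<Rightarrow> 'w) \<Rightarrow> ('v, 'a::comm_ring_1) mps \<Rightarrow> ('w, 'a) mps" where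
  "mps_rename \<rho> f = mps_subst f (\<lambda>v. mps_var (\<rho> v))"

definition mod_functions_hopf ::
  "('n::finite, 'a::idom) fgl \<Rightarrow>
   ('a, ('n, 'a fract) mps, ('n + 'n, 'a fract) mps, ('n + ('n + 'n), 'a fract) mps) hopf_data" where
  "mod_functions_hopf G =
     \<lparr>mdl = mod_functions_module,
      sq = mod_functions_module,
      ten = (\<lambda>f g. mps_rename Inl f * mps_rename Inr g),
      cube = mod_functions_module,
      tenl = (\<lambda>p h. mps_rename (case_sum Inl (Inr \<circ> Inl)) p * mps_rename (Inr \<circ> Inr) h),
      tenr = (\<lambda>f p. mps_rename Inl f * mps_rename Inr p),
      mul = (*),
      unt = 1,
      comul = (\<lambda>f. mps_subst f (\<lambda>j. mps_map to_quot (G j))),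
      counit = (\<lambda>f. the_inv to_quot (mcoeff f 0)),
      antipode = (\<lambda>f. mps_subst f (\<lambda>j. mps_map to_quot (fgl_inverse G j)))\<rparr>"


section \<open>Quotients of monoid algebras and their duals\<close>

text \<open>
  \<open>'w \<Rightarrow>\<^sub>0 'a\<close> is the monoid algebra \<open>R[W]\<close>. Both \<open>\<U>(\<gg>)\<close> and its tensor powers are quotients of
  such algebras by the two-sided ideal generated by a set \<open>S\<close>; their elements are cosets. Maps out of
  a quotient are given on representatives.
\<close>

definition two_sided_ideal :: "'t::ring_1 set \<Rightarrow> bool" where
  "two_sided_ideal I \<longleftrightarrow> 0 \<in> I \<and> (\<forall>x\<in>I. \<forall>y\<in>I. x + y \<in> I) \<and> (\<forall>x\<in>I. \<forall>a. a * x \<in> I \<and> x * a \<in> I)"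

definition ideal_gen :: "'t::ring_1 set \<Rightarrow> 't set" where
  "ideal_gen S = \<Inter>{I. two_sided_ideal I \<and> S \<subseteq> I}"

definition cls :: "'t::ring_1 set \<Rightarrow> 't \<Rightarrow> 't set" where
  "cls S x = {y. y - x \<in> ideal_gen S}"

definition quot_carrier :: "'t::ring_1 set \<Rightarrow> 't set set" where
  "quot_carrier S = range (cls S)"

definition on_cls :: "('t \<Rightarrow> 'b) \<Rightarrow> 't set \<Rightarrow> 'b" where
  "on_cls f C = the_elem (f ` C)"

text \<open>Functionals on a quotient are extended by \<open>0\<close> outside its carrier.\<close>
definition functional :: "'t::ring_1 set \<Rightarrow> ('t set \<Rightarrow> 'a::zero) \<Rightarrow> 't set \<Rightarrow> 'a" where
  "functional S f = (\<lambda>C. if C \<in> quot_carrier S then f C else 0)"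

definition quot_dual :: "('w::monoid_add \<Rightarrow>\<^sub>0 'a::comm_ring_1) set \<Rightarrow> (('w \<Rightarrow>\<^sub>0 'a) set \<Rightarrow> 'a) set" where
  "quot_dual S = {\<phi>.
     (\<forall>C. C \<notin> quot_carrier S \<longrightarrow> \<phi> C = 0) \<and>
     (\<forall>x y. \<phi> (cls S (x + y)) = \<phi> (cls S x) + \<phi> (cls S y)) \<and>
     (\<forall>r x. \<phi> (cls S (Poly_Mapping.single 0 r * x)) = r * \<phi> (cls S x))}"

definition lin_ext :: "('w \<Rightarrow> 'a) \<Rightarrow> ('w \<Rightarrow>\<^sub>0 'a::comm_ring_1) \<Rightarrow> 'a" where
  "lin_ext c z = (\<Sum>w\<in>Poly_Mapping.keys z. Poly_Mapping.lookup z w * c w)"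

definition alg_ext ::
  "('w \<Rightarrow> ('u::monoid_add \<Rightarrow>\<^sub>0 'a)) \<Rightarrow> ('w \<Rightarrow>\<^sub>0 'a::comm_ring_1) \<Rightarrow> ('u \<Rightarrow>\<^sub>0 'a)" where
  "alg_ext c z = (\<Sum>w\<in>Poly_Mapping.keys z. Poly_Mapping.single 0 (Poly_Mapping.lookup z w) * c w)"

abbreviation gen :: "'w \<Rightarrow> ('w \<Rightarrow>\<^sub>0 'a::comm_ring_1)" where
  "gen w \<equiv> Poly_Mapping.single w 1"

text \<open>\<open>R[V] \<otimes> R[W] = R[V \<times> W]\<close>, as algebras.\<close>
definition outer ::
  "('v \<Rightarrow>\<^sub>0 'a) \<Rightarrow> ('w \<Rightarrow>\<^sub>0 'a::comm_ring_1) \<Rightarrow> ('v \<times> 'w \<Rightarrow>\<^sub>0 'a)" where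
  "outer x y = (\<Sum>v\<in>Poly_Mapping.keys x. \<Sum>w\<in>Poly_Mapping.keys y.
     Poly_Mapping.single (v, w) (Poly_Mapping.lookup x v * Poly_Mapping.lookup y w))"

text \<open>\<open>R[V]/I \<otimes> R[W]/J\<close> is the quotient of \<open>R[V \<times> W]\<close> by the ideal generated by \<open>I \<otimes> 1\<close> and \<open>1 \<otimes> J\<close>.\<close>
definition tensor_ideal ::
  "('v::monoid_add \<Rightarrow>\<^sub>0 'a) set \<Rightarrow> ('w::monoid_add \<Rightarrow>\<^sub>0 'a::comm_ring_1) set \<Rightarrow> ('v \<times> 'w \<Rightarrow>\<^sub>0 'a) set" where
  "tensor_ideal S S' = (\<lambda>x. outer x 1) ` ideal_gen S \<union> (\<lambda>y. outer 1 y) ` ideal_gen S'"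

definition tensor_functional ::
  "('v::monoid_add \<Rightarrow>\<^sub>0 'a::comm_ring_1) set \<Rightarrow> ('w::monoid_add \<Rightarrow>\<^sub>0 'a) set \<Rightarrow>
   (('v \<Rightarrow>\<^sub>0 'a) set \<Rightarrow> 'a) \<Rightarrow> (('w \<Rightarrow>\<^sub>0 'a) set \<Rightarrow> 'a) \<Rightarrow> ('v \<times> 'w \<Rightarrow>\<^sub>0 'a) set \<Rightarrow> 'a" where
  "tensor_functional S S' \<phi> \<psi> = functional (tensor_ideal S S')
     (on_cls (lin_ext (\<lambda>(v, w). \<phi> (cls S (gen v)) * \<psi> (cls S' (gen w)))))"


section \<open>The universal enveloping algebra\<close>

datatype 'n fword = FWord (letters: "'n list")

instantiation fword :: (type) monoid_add
begin
definition "0 = FWord []"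
definition "u + v = FWord (letters u @ letters v)"
instance by standard (auto simp: zero_fword_def plus_fword_def)
end

text \<open>The tensor algebra of the free module on \<open>e\<^sub>j\<close> is the free algebra, with basis the words.\<close>
type_synonym ('n, 'a) tensor_alg = "'n fword \<Rightarrow>\<^sub>0 'a"

definition lie_incl :: "('n::finite \<Rightarrow> 'a::comm_ring_1) \<Rightarrow> ('n, 'a) tensor_alg" where
  "lie_incl x = (\<Sum>j\<in>UNIV. Poly_Mapping.single (FWord [j]) (x j))"

definition uea_rels :: "('n::finite, 'a::comm_ring_1) fgl \<Rightarrow> ('n, 'a) tensor_alg set" where
  "uea_rels G = {lie_incl x * lie_incl y - lie_incl y * lie_incl x - lie_incl (lie_bracket G x y)
     | x y. True}"

definition uea_rels2 ::
  "('n::finite, 'a::comm_ring_1) fgl \<Rightarrow> ('n fword \<times> 'n fword \<Rightarrow>\<^sub>0 'a) set" where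
  "uea_rels2 G = tensor_ideal (uea_rels G) (uea_rels G)"

definition uea_rels3 ::
  "('n::finite, 'a::comm_ring_1) fgl \<Rightarrow> ('n fword \<times> ('n fword \<times> 'n fword) \<Rightarrow>\<^sub>0 'a) set" where
  "uea_rels3 G = tensor_ideal (uea_rels G) (uea_rels2 G)"

definition uea_mul ::
  "('n::finite, 'a::comm_ring_1) fgl \<Rightarrow> ('n fword \<times> 'n fword \<Rightarrow>\<^sub>0 'a) set \<Rightarrow> ('n, 'a) tensor_alg set" where
  "uea_mul G = on_cls (\<lambda>z. cls (uea_rels G) (alg_ext (\<lambda>(u, v). gen u * gen v) z))"

definition uea_comul ::
  "('n::finite, 'a::comm_ring_1) fgl \<Rightarrow> ('n, 'a) tensor_alg set \<Rightarrow> ('n fword \<times> 'n fword \<Rightarrow>\<^sub>0 'a) set" where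
  "uea_comul G = on_cls (\<lambda>x. cls (uea_rels2 G) (alg_ext (\<lambda>w.
     prod_list (map (\<lambda>i. outer (gen (FWord [i])) 1 + outer 1 (gen (FWord [i]))) (letters w))) x))"

definition uea_counit :: "('n::finite, 'a::comm_ring_1) fgl \<Rightarrow> ('n, 'a) tensor_alg set \<Rightarrow> 'a" where
  "uea_counit G = on_cls (lin_ext (\<lambda>w. prod_list (map (\<lambda>_. 0) (letters w))))"

definition uea_antipode ::
  "('n::finite, 'a::comm_ring_1) fgl \<Rightarrow> ('n, 'a) tensor_alg set \<Rightarrow> ('n, 'a) tensor_alg set" where
  "uea_antipode G = on_cls (\<lambda>x. cls (uea_rels G) (alg_ext (\<lambda>w.
     prod_list (map (\<lambda>i. - gen (FWord [i])) (rev (letters w)))) x))"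

text \<open>The element \<open>e\<^sub>1\<^bsup>j\<^sub>1\<^esup> \<cdots> e\<^sub>m\<^bsup>j\<^sub>m\<^esup>\<close>; the factors are in the order of the index type.\<close>
definition pbw :: "('n::{finite,linorder} \<Rightarrow> nat) \<Rightarrow> ('n, 'a::comm_ring_1) tensor_alg" where
  "pbw j = prod_list (map (\<lambda>i. gen (FWord [i]) ^ j i) (sorted_list_of_set UNIV))"

definition expo_deg :: "('n::finite \<Rightarrow> nat) \<Rightarrow> nat" where
  "expo_deg j = (\<Sum>i\<in>UNIV. j i)"


section \<open>The dual of the universal enveloping algebra\<close>

definition uea_dual_module ::
  "('n::{finite,linorder}, 'a::comm_ring_1) fgl \<Rightarrow>
   ('a, ('n fword \<Rightarrow>\<^sub>0 'a) set \<Rightarrow> 'a) filtered_module" where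
  "uea_dual_module G =
     \<lparr>scl = (\<lambda>r \<phi> C. r * \<phi> C),
      fil = (\<lambda>k. {\<phi> \<in> quot_dual (uea_rels G).
        \<forall>j. expo_deg j < k \<longrightarrow> \<phi> (cls (uea_rels G) (pbw j)) = 0})\<rparr>"

definition uea_dual2_module ::
  "('n::{finite,linorder}, 'a::comm_ring_1) fgl \<Rightarrow>
   ('a, ('n fword \<times> 'n fword \<Rightarrow>\<^sub>0 'a) set \<Rightarrow> 'a) filtered_module" where
  "uea_dual2_module G =
     \<lparr>scl = (\<lambda>r \<phi> C. r * \<phi> C),
      fil = (\<lambda>k. {\<phi> \<in> quot_dual (uea_rels2 G).
        \<forall>i j. expo_deg i + expo_deg j < k \<longrightarrow>
          \<phi> (cls (uea_rels2 G) (outer (pbw i) (pbw j))) = 0})\<rparr>"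

definition uea_dual3_module ::
  "('n::{finite,linorder}, 'a::comm_ring_1) fgl \<Rightarrow>
   ('a, ('n fword \<times> ('n fword \<times> 'n fword) \<Rightarrow>\<^sub>0 'a) set \<Rightarrow> 'a) filtered_module" where
  "uea_dual3_module G =
     \<lparr>scl = (\<lambda>r \<phi> C. r * \<phi> C),
      fil = (\<lambda>k. {\<phi> \<in> quot_dual (uea_rels3 G).
        \<forall>h i j. expo_deg h + expo_deg i + expo_deg j < k \<longrightarrow>
          \<phi> (cls (uea_rels3 G) (outer (pbw h) (outer (pbw i) (pbw j)))) = 0})\<rparr>"

text \<open>Here \<open>\<U>\<^sup>\<star> \<otimes> \<U>\<^sup>\<star>\<close> is identified with \<open>(\<U> \<otimes> \<U>)\<^sup>\<star>\<close>, and the triple tensor product with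
  \<open>(\<U> \<otimes> (\<U> \<otimes> \<U>))\<^sup>\<star>\<close>.\<close>
definition uea_dual_hopf ::
  "('n::{finite,linorder}, 'a::comm_ring_1) fgl \<Rightarrow>
   ('a, ('n fword \<Rightarrow>\<^sub>0 'a) set \<Rightarrow> 'a, ('n fword \<times> 'n fword \<Rightarrow>\<^sub>0 'a) set \<Rightarrow> 'a,
    ('n fword \<times> ('n fword \<times> 'n fword) \<Rightarrow>\<^sub>0 'a) set \<Rightarrow> 'a) hopf_data" where
  "uea_dual_hopf G = (let S = uea_rels G; S2 = uea_rels2 G; S3 = uea_rels3 G in
     \<lparr>mdl = uea_dual_module G,
      sq = uea_dual2_module G,
      ten = tensor_functional S S,
      cube = uea_dual3_module G,
      tenl = (\<lambda>p \<phi>. functional S3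
        (on_cls (lin_ext (\<lambda>(u, v, w). p (cls S2 (gen (u, v))) * \<phi> (cls S (gen w)))))),
      tenr = tensor_functional S S2,
      mul = (\<lambda>\<psi> \<phi>. functional S (\<lambda>C. tensor_functional S S \<psi> \<phi> (uea_comul G C))),
      unt = functional S (uea_counit G),
      comul = (\<lambda>\<phi>. functional S2 (\<lambda>C. \<phi> (uea_mul G C))),
      counit = (\<lambda>\<phi>. \<phi> (cls S 1)),
      antipode = (\<lambda>\<phi>. functional S (\<lambda>C. \<phi> (uea_antipode G C)))\<rparr>)"


section \<open>The comparison map\<close>

text \<open>
  The functional with
  \<open>e\<^bsub>i\<^sub>0\<^esub> \<cdots> e\<^bsub>i\<^sub>k\<^sub>-\<^sub>1\<^esub> \<mapsto> \<partial>\<^sup>k / \<partial>t\<^sub>0\<^bsup>(i\<^sub>0)\<^esup> \<cdots> \<partial>t\<^bsub>k-1\<^esub>\<^bsup>(i\<^sub>k\<^sub>-\<^sub>1)\<^esup> f(G(\<^bold>t\<^sub>0, \<dots>, \<^bold>t\<^bsub>k-1\<^esub>))\<close> at \<open>0\<close>.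
  For the empty word this is \<open>1 \<mapsto> f(0)\<close>.
\<close>
definition beta_star ::
  "('n::{finite,linorder}, 'a::idom) fgl \<Rightarrow> ('n, 'a fract) mps \<Rightarrow> ('n fword \<Rightarrow>\<^sub>0 'a) set \<Rightarrow> 'a" where
  "beta_star G f = (THE \<phi>. \<phi> \<in> quot_dual (uea_rels G) \<and>
     (\<forall>is. to_quot (\<phi> (cls (uea_rels G) (prod_list (map (\<lambda>i. gen (FWord [i])) is)))) =
        mcoeff (foldr mps_deriv (List.enumerate 0 is)
          (mps_subst f (\<lambda>j. mps_map to_quot (fgl_iter G (length is) j)))) 0))"

end

theory Submission
  imports Defs "HOL-Library.Multiset"
begin

text \<open>
  Let \<open>D\<^sub>i f\<close> be the derivative of \<open>f(G(\<^bold>X, \<^bold>Y))\<close> with respect to \<open>Y\<^sub>i\<close> at \<open>\<^bold>Y = 0\<close>. Associativity makes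
  \<open>D\<^sub>i\<close> a left invariant derivation, \<open>[D\<^sub>l, D\<^sub>k] = \<Sum>\<^sub>j (\<gamma>\<^bsup>j\<^esup>\<^bsub>lk\<^esub> - \<gamma>\<^bsup>j\<^esup>\<^bsub>kl\<^esub>) D\<^sub>j\<close>, and the comparison map becomes
  \<open>f \<mapsto> (e\<^bsub>i\<^sub>1\<^esub> \<cdots> e\<^bsub>i\<^sub>k\<^esub> \<mapsto> (D\<^bsub>i\<^sub>1\<^esub> \<cdots> D\<^bsub>i\<^sub>k\<^esub> f)(0))\<close>. Since \<open>D\<^sub>i\<close> is \<open>\<partial>\<^sub>i\<close> up to terms of higher order, the
  pairing of the divided power monomials with the PBW monomials is unitriangular for the degree. As the
  PBW monomials span by reordering, this proves the PBW theorem for \<open>\<gg>\<close> and the bijectivity of the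
  comparison map together with its compatibility with the filtrations; likewise for the tensor square and
  cube. Both sides are therefore products of copies of \<open>R\<close>, for which completed tensor products are
  computed on coordinates, and every identity in \<open>\<U>(\<gg>)\<close> can be tested against modified functions: the
  product of \<open>\<U>(\<gg>)\<close> corresponds to \<open>f(G(\<^bold>X, \<^bold>Y))\<close> by left invariance, its coproduct to the Leibniz
  rule, and its antipode to \<open>f \<circ> s\<close>. The Hopf algebra axioms are checked for modified functions and
  transported to the dual.
\<close>


section \<open>Monomials\<close>

text \<open>The definition of a complete Hopf algebra asks for continuous extensions of maps such as
  \<open>\<mu> \<otimes> id\<close> to completed tensor products. On modified functions each of them
  is an explicit substitution of power series, whereas no formula of this kind is at hand for
  functionals; this decides on which side the axioms are verified. The second obstacle is that maps
  on the enveloping algebra are given on representatives of cosets. Their well-definedness rests on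
  a kernel criterion: an element of the free algebra lies in the defining ideal exactly when it
  pairs to 0 with every divided power monomial. One implication comes from letting the free algebra
  act by differential operators, the other from spanning together with unitriangularity.
  Computations take place over the quotient field and return to the ground ring by injectivity of
  \<open>to_quot\<close>. What keeps them integral is that a coefficient scaled by its factorial is
  an iterated derivative at 0, so that integrality passes through the Leibniz and chain rules; and
  the factorial produced by differentiating a divided power cancels its denominator, which puts 1 on
  the diagonal of the pairing although factorials need not be invertible in the ground ring.\<close>

lemma lookup_Abs_finite [simp]:
  fixes f :: "'v::finite \<Rightarrow> 'b::zero"
  shows "Poly_Mapping.lookup (Abs_poly_mapping f) = f"
  by (rule lookup_Abs_poly_mapping) (rule finite)

lemma mono_deg_finite: "mono_deg (m :: 'v::finite mono) = (\<Sum>v\<in>UNIV. Poly_Mapping.lookup m v)"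
  unfolding mono_deg_def by (rule sum.mono_neutral_left) (auto simp: in_keys_iff)

lemma mono_fact_finite: "mono_fact (m :: 'v::finite mono) = (\<Prod>v\<in>UNIV. fact (Poly_Mapping.lookup m v))"
  unfolding mono_fact_def by (rule prod.mono_neutral_left) (auto simp: in_keys_iff)

lemma mono_deg_superset:
  assumes "finite A" "Poly_Mapping.keys m \<subseteq> A"
  shows "mono_deg m = (\<Sum>v\<in>A. Poly_Mapping.lookup m v)"
  unfolding mono_deg_def using assms by (intro sum.mono_neutral_left) (auto simp: in_keys_iff)

lemma mono_deg_add [simp]: "mono_deg (a + b) = mono_deg a + mono_deg b"
proof -
  let ?A = "Poly_Mapping.keys a \<union> Poly_Mapping.keys b"
  have "mono_deg (a + b) = (\<Sum>v\<in>?A. Poly_Mapping.lookup (a + b) v)"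
    by (rule mono_deg_superset) (auto simp: Poly_Mapping.keys_add)
  also have "\<dots> = (\<Sum>v\<in>?A. Poly_Mapping.lookup a v) + (\<Sum>v\<in>?A. Poly_Mapping.lookup b v)"
    by (simp add: lookup_add sum.distrib)
  also have "\<dots> = mono_deg a + mono_deg b"
    by (simp add: mono_deg_superset[of ?A a] mono_deg_superset[of ?A b])
  finally show ?thesis .
qed

lemma mono_deg_zero [simp]: "mono_deg 0 = 0"
  by (simp add: mono_deg_def)

lemma mono_deg_single [simp]: "mono_deg (Poly_Mapping.single v k) = k"
  by (simp add: mono_deg_def)

lemma mono_deg_eq_0 [simp]: "mono_deg m = 0 \<longleftrightarrow> m = 0"
proof
  assume "mono_deg m = 0"
  hence "Poly_Mapping.lookup m v = 0" for v
    by (cases "v \<in> Poly_Mapping.keys m") (auto simp: mono_deg_def in_keys_iff)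
  thus "m = 0" by (intro poly_mapping_eqI) simp
qed simp

lemma mono_fact_0 [simp]: "mono_fact 0 = 1"
  by (simp add: mono_fact_def)

lemma mono_nonzeroE:
  assumes "(m :: 'v mono) \<noteq> 0"
  obtains m' v where "m = m' + Poly_Mapping.single v 1"
proof -
  obtain v where v: "Poly_Mapping.lookup m v \<noteq> 0"
    using assms by (metis lookup_zero poly_mapping_eqI)
  have "m = (m - Poly_Mapping.single v 1) + Poly_Mapping.single v 1"
    using v by (intro poly_mapping_eqI)
      (auto simp: lookup_add lookup_minus lookup_single when_def)
  thus ?thesis by (rule that)
qed

lemma mono_induct [case_names zero add]:
  assumes "P 0" "\<And>m v. P m \<Longrightarrow> P (m + Poly_Mapping.single v 1)"
  shows "P (m :: 'v mono)"
proof (induction "mono_deg m" arbitrary: m)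
  case 0
  then show ?case using assms by simp
next
  case (Suc n)
  hence "m \<noteq> 0" by auto
  then obtain m' v where m: "m = m' + Poly_Mapping.single v 1" by (rule mono_nonzeroE)
  show ?case using Suc unfolding m by (intro assms) simp
qed

lemma mono_fact_add_single:
  fixes m :: "'v mono"
  shows "mono_fact (m + Poly_Mapping.single v 1) = (Poly_Mapping.lookup m v + 1) * mono_fact m"
proof -
  let ?A = "insert v (Poly_Mapping.keys m)"
  have sup: "mono_fact x = (\<Prod>u\<in>?A. fact (Poly_Mapping.lookup x u))"
    if "Poly_Mapping.keys x \<subseteq> ?A" for x :: "'v mono"
    unfolding mono_fact_def using that by (intro prod.mono_neutral_left) (auto simp: in_keys_iff)
  have "Poly_Mapping.keys (m + Poly_Mapping.single v 1) \<subseteq> ?A"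
    using Poly_Mapping.keys_add[of m "Poly_Mapping.single v 1"] by auto
  hence "mono_fact (m + Poly_Mapping.single v 1) =
      (\<Prod>u\<in>?A. fact (Poly_Mapping.lookup m u + (if u = v then 1 else 0)))"
    by (subst sup) (auto simp: lookup_add lookup_single when_def intro!: prod.cong)
  also have "\<dots> = (\<Prod>u\<in>?A. (if u = v then Poly_Mapping.lookup m v + 1 else 1) * fact (Poly_Mapping.lookup m u))"
    by (intro prod.cong) auto
  also have "\<dots> = (Poly_Mapping.lookup m v + 1) * mono_fact m"
    unfolding prod.distrib by (subst sup[of m]) (auto simp: prod.delta)
  finally show ?thesis .
qed

lemma mono_fact_nonzero [simp]: "mono_fact m \<noteq> 0"
  by (simp add: mono_fact_def)

lemma finite_mono_deg_le: "finite {m :: 'v::finite mono. mono_deg m \<le> n}"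
proof (rule finite_subset)
  let ?M = "Abs_poly_mapping (\<lambda>_. n) :: 'v mono"
  show "{m :: 'v mono. mono_deg m \<le> n} \<subseteq> {a. \<forall>v. Poly_Mapping.lookup a v \<le> Poly_Mapping.lookup ?M v}"
  proof clarsimp
    fix m :: "'v mono" and v assume "mono_deg m \<le> n"
    thus "Poly_Mapping.lookup m v \<le> n"
      using member_le_sum[of v UNIV "Poly_Mapping.lookup m"] by (simp add: mono_deg_finite)
  qed
qed (rule finite_mono_below)

lemma mono_splits_deg: "(a, b) \<in> mono_splits m \<Longrightarrow> mono_deg a + mono_deg b = mono_deg m"
  by (auto simp: mono_splits_def)


section \<open>Coefficients and orders of power series\<close>

lemma mcoeff_0 [simp]: "mcoeff 0 m = 0"
  by (simp add: zero_mps_def)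
lemma mcoeff_add [simp]: "mcoeff (f + g) m = mcoeff f m + mcoeff g m"
  by (simp add: plus_mps_def)
lemma mcoeff_diff [simp]: "mcoeff (f - g) m = mcoeff f m - mcoeff g m"
  by (simp add: minus_mps_def)
lemma mcoeff_uminus [simp]: "mcoeff (- f) m = - mcoeff f m"
  by (simp add: uminus_mps_def)
lemma mcoeff_1: "mcoeff 1 m = (if m = 0 then 1 else 0)"
  by (simp add: one_mps_def)
lemma mcoeff_mult: "mcoeff (f * g) m = (\<Sum>(a, b)\<in>mono_splits m. mcoeff f a * mcoeff g b)"
  by (simp add: times_mps_def)
lemma mcoeff_sum [simp]: "mcoeff (sum f A) m = (\<Sum>x\<in>A. mcoeff (f x) m)"
  by (induction A rule: infinite_finite_induct) auto
lemma mcoeff_const: "mcoeff (mps_const c) m = (if m = 0 then c else 0)"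
  by (simp add: mps_const_def)
lemma mcoeff_var: "mcoeff (mps_var v) m = (if m = Poly_Mapping.single v 1 then 1 else 0)"
  by (simp add: mps_var_def)
lemma mcoeff_map [simp]: "mcoeff (mps_map h f) m = h (mcoeff f m)"
  by (simp add: mps_map_def)
lemma mcoeff_deriv: "mcoeff (mps_deriv v f) m =
    of_nat (Poly_Mapping.lookup m v + 1) * mcoeff f (m + Poly_Mapping.single v 1)"
  by (simp add: mps_deriv_def)

lemma single_1_neq_0 [simp]: "Poly_Mapping.single v (1::nat) \<noteq> 0" "Poly_Mapping.single v (Suc 0) \<noteq> 0"
  by (simp_all flip: mono_deg_eq_0)

lemma mono_add_eq_0 [simp]: "(a :: 'v mono) + b = 0 \<longleftrightarrow> a = 0 \<and> b = 0"
  by (simp flip: mono_deg_eq_0)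

lemma mono_splits_0 [simp]: "mono_splits 0 = {(0, 0)}"
  by (simp add: mono_splits_def)

lemma mcoeff_mult_0 [simp]: "mcoeff (f * g) 0 = mcoeff f 0 * mcoeff g 0"
  by (simp add: mcoeff_mult)

lemma mcoeff_const_mult [simp]: "mcoeff (mps_const c * f) m = c * mcoeff f m"
proof -
  have "mcoeff (mps_const c * f) m = (\<Sum>x\<in>mono_splits m. if x = (0, m) then c * mcoeff f m else 0)"
    unfolding mcoeff_mult mcoeff_const by (intro sum.cong) (auto simp: mono_splits_def split: if_splits)
  also have "\<dots> = c * mcoeff f m" by (subst sum.delta) (simp, simp add: mono_splits_def)
  finally show ?thesis .
qed

lemma mps_const_0 [simp]: "mps_const 0 = 0"
  by (rule mps_eqI) (simp add: mcoeff_const)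
lemma mps_const_1 [simp]: "mps_const 1 = 1"
  by (rule mps_eqI) (simp add: mcoeff_const mcoeff_1)
lemma mps_const_add: "mps_const (a + b) = mps_const a + mps_const b"
  by (rule mps_eqI) (simp add: mcoeff_const)
lemma mps_const_mult: "mps_const (a * b) = mps_const a * mps_const b"
  by (rule mps_eqI) (simp add: mcoeff_const)
text \<open>The \<open>k\<close>-th step of the order filtration. A lower bound for the order,
  rather than the order itself, treats the zero series like any other.\<close>

definition mord :: "nat \<Rightarrow> ('v, 'a::comm_ring_1) mps \<Rightarrow> bool" where
  "mord k f \<longleftrightarrow> (\<forall>m. mono_deg m < k \<longrightarrow> mcoeff f m = 0)"

lemma mordD: "mord k f \<Longrightarrow> mono_deg m < k \<Longrightarrow> mcoeff f m = 0"
  by (simp add: mord_def)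
lemma mord_0 [simp]: "mord 0 f" by (simp add: mord_def)
lemma mord_zero [simp]: "mord k 0" by (simp add: mord_def)
lemma mord_add: "mord k f \<Longrightarrow> mord k g \<Longrightarrow> mord k (f + g)" by (simp add: mord_def)
lemma mord_diff: "mord k f \<Longrightarrow> mord k g \<Longrightarrow> mord k (f - g)" by (simp add: mord_def)
lemma mord_uminus: "mord k f \<Longrightarrow> mord k (- f)" by (simp add: mord_def)
lemma mord_sum: "(\<And>x. x \<in> A \<Longrightarrow> mord k (f x)) \<Longrightarrow> mord k (sum f A)"
  by (induction A rule: infinite_finite_induct) (auto simp: mord_add)
lemma mord_mono: "mord k f \<Longrightarrow> l \<le> k \<Longrightarrow> mord l f" by (simp add: mord_def)
lemma mord_1_iff: "mord (Suc 0) f \<longleftrightarrow> mcoeff f 0 = 0" by (auto simp: mord_def)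

lemma mord_mult: assumes "mord k f" "mord l g" shows "mord (k + l) (f * g)"
  unfolding mord_def
proof (intro allI impI)
  fix m :: "'a mono" assume m: "mono_deg m < k + l"
  show "mcoeff (f * g) m = 0"
    unfolding mcoeff_mult
  proof (rule sum.neutral, clarify)
    fix a b assume "(a, b) \<in> mono_splits m"
    from mono_splits_deg[OF this] have "mono_deg a < k \<or> mono_deg b < l" using m by linarith
    thus "mcoeff f a * mcoeff g b = 0" using assms by (auto simp: mordD)
  qed
qed

lemma mord_mult_left: "mord k f \<Longrightarrow> mord k (g * f)"
  using mord_mult[of 0 g k f] by simp

lemma mord_mult_right: "mord k f \<Longrightarrow> mord k (f * g)"
  using mord_mult[of k f 0 g] by simp

lemma mord_all_imp_0: "(\<And>k. mord k f) \<Longrightarrow> f = 0"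
  by (rule mps_eqI) (simp add: mordD[OF _ lessI])

lemma mord_var: "mord (Suc 0) (mps_var v)"
  using single_1_neq_0(1)[of v] by (auto simp: mord_1_iff mcoeff_var simp del: single_1_neq_0)

lemma mord_deriv: "mord (Suc k) f \<Longrightarrow> mord k (mps_deriv v f)"
  by (auto simp: mord_def mcoeff_deriv)

lemma mps_deriv_add: "mps_deriv v (f + g) = mps_deriv v f + mps_deriv v (g :: ('v, 'a::comm_ring_1) mps)"
  by (rule mps_eqI) (simp add: mcoeff_deriv algebra_simps)

lemma mps_deriv_0 [simp]: "mps_deriv v 0 = (0 :: ('v, 'a::comm_ring_1) mps)"
  by (rule mps_eqI) (simp add: mcoeff_deriv)

lemma mps_deriv_sum: "mps_deriv v (sum f A) = (\<Sum>x\<in>A. mps_deriv v (f x :: ('v, 'a::comm_ring_1) mps))"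
  by (induction A rule: infinite_finite_induct) (auto simp: mps_deriv_add)

lemma mps_deriv_const_mult: "mps_deriv v (mps_const c * f) = mps_const c * mps_deriv v (f :: ('v, 'a::comm_ring_1) mps)"
  by (rule mps_eqI) (simp add: mcoeff_deriv mult.left_commute)

lemma mps_deriv_const [simp]: "mps_deriv v (mps_const (c :: 'a::comm_ring_1)) = 0"
proof -
  have "m + Poly_Mapping.single v (Suc 0) \<noteq> 0" for m :: "'b mono"
    by (metis add_Suc_right mono_deg_add mono_deg_single mono_deg_zero nat.distinct(1))
  thus ?thesis by (intro mps_eqI) (simp add: mcoeff_deriv mcoeff_const)
qed

lemma mps_deriv_var: "mps_deriv v (mps_var u) = (if u = v then 1 else (0 :: ('v, 'a::comm_ring_1) mps))"
proof (rule mps_eqI)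
  fix m :: "'v mono"
  have eq: "m + Poly_Mapping.single v (Suc 0) = Poly_Mapping.single u (Suc 0) \<longleftrightarrow> m = 0 \<and> u = v"
  proof
    assume h: "m + Poly_Mapping.single v (Suc 0) = Poly_Mapping.single u (Suc 0)"
    from arg_cong[OF h, of mono_deg] have "m = 0" by simp
    moreover from this h have "u = v"
      by (metis add_0 lookup_single_eq lookup_single_not_eq nat.distinct(1))
    ultimately show "m = 0 \<and> u = v" by simp
  qed auto
  show "mcoeff (mps_deriv v (mps_var u)) m = mcoeff (if u = v then 1 else (0 :: ('v, 'a) mps)) m"
    by (auto simp: mcoeff_deriv mcoeff_var eq mcoeff_1)
qed

text \<open>Pairs \<open>(a, b)\<close> with \<open>a + b = m + v\<close> are counted with weight \<open>a\<^sub>v + b\<^sub>v\<close>.\<close>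
lemma mps_deriv_mult:
  fixes f g :: "('v, 'a::comm_ring_1) mps"
  shows "mps_deriv v (f * g) = mps_deriv v f * g + f * mps_deriv v g"
proof (rule mps_eqI)
  fix m :: "'v mono"
  let ?s = "Poly_Mapping.single v 1 :: 'v mono"
  let ?l = "\<lambda>a :: 'v mono. Poly_Mapping.lookup a v"
  have reduce: "a = (a - ?s) + ?s" if "?l a \<noteq> 0" for a :: "'v mono"
    using that by (intro poly_mapping_eqI) (auto simp: lookup_add lookup_minus lookup_single when_def)
  have half: "(\<Sum>(a, b)\<in>mono_splits (m + ?s). of_nat (?l a) * mcoeff f a * mcoeff g b) =
      mcoeff (mps_deriv v f * g) m" for f g :: "('v, 'a) mps"
  proof -
    have "(\<Sum>(a, b)\<in>mono_splits (m + ?s). of_nat (?l a) * mcoeff f a * mcoeff g b) =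
        (\<Sum>(a, b)\<in>{(a, b)\<in>mono_splits (m + ?s). ?l a \<noteq> 0}. of_nat (?l a) * mcoeff f a * mcoeff g b)"
      by (rule sum.mono_neutral_right) (auto intro: ccontr)
    also have "\<dots> = (\<Sum>(a, b)\<in>mono_splits m. mcoeff (mps_deriv v f) a * mcoeff g b)"
    proof (rule sum.reindex_bij_witness[where i = "\<lambda>(a, b). (a + ?s, b)" and j = "\<lambda>(a, b). (a - ?s, b)"])
      fix x assume "x \<in> {(a, b)\<in>mono_splits (m + ?s). ?l a \<noteq> 0}"
      then obtain a b where x: "x = (a, b)" "a + b = m + ?s" "?l a \<noteq> 0" by (auto simp: mono_splits_def)
      define c where "c = a - ?s"
      have a: "a = c + ?s" using reduce[OF x(3)] by (simp only: c_def)
      have "c + b + ?s = m + ?s" using x(2) by (simp only: a add_ac)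
      hence "c + b = m" by (rule add_right_imp_eq)
      thus "(case case x of (a, b) \<Rightarrow> (a - ?s, b) of (a, b) \<Rightarrow> (a + ?s, b)) = x"
        "(case x of (a, b) \<Rightarrow> (a - ?s, b)) \<in> mono_splits m"
        "(case case x of (a, b) \<Rightarrow> (a - ?s, b) of (a, b) \<Rightarrow> mcoeff (mps_deriv v f) a * mcoeff g b) =
          (case x of (a, b) \<Rightarrow> of_nat (?l a) * mcoeff f a * mcoeff g b)"
        unfolding x a by (simp_all add: mono_splits_def mcoeff_deriv lookup_add)
    next
      fix x assume "x \<in> mono_splits m"
      thus "(case case x of (a, b) \<Rightarrow> (a + ?s, b) of (a, b) \<Rightarrow> (a - ?s, b)) = x"
        "(case x of (a, b) \<Rightarrow> (a + ?s, b)) \<in> {(a, b)\<in>mono_splits (m + ?s). ?l a \<noteq> 0}"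
        by (auto simp: mono_splits_def lookup_add add_ac)
    qed
    finally show ?thesis by (simp add: mcoeff_mult)
  qed
  have "mcoeff (mps_deriv v (f * g)) m =
      (\<Sum>(a, b)\<in>mono_splits (m + ?s). of_nat (?l a + ?l b) * (mcoeff f a * mcoeff g b))"
    unfolding mcoeff_deriv mcoeff_mult sum_distrib_left
  proof (intro sum.cong refl, clarify)
    fix a b assume "(a, b) \<in> mono_splits (m + ?s)"
    hence "?l (a + b) = ?l (m + ?s)" by (simp add: mono_splits_def)
    hence "?l m + 1 = ?l a + ?l b" by (simp add: lookup_add)
    thus "of_nat (?l m + 1) * (mcoeff f a * mcoeff g b) = of_nat (?l a + ?l b) * (mcoeff f a * mcoeff g b)"
      by (simp only:)
  qed
  also have "\<dots> = (\<Sum>(a, b)\<in>mono_splits (m + ?s). of_nat (?l a) * mcoeff f a * mcoeff g b)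
      + (\<Sum>(a, b)\<in>mono_splits (m + ?s). of_nat (?l b) * mcoeff g b * mcoeff f a)"
    unfolding sum.distrib[symmetric] by (intro sum.cong) (auto simp: algebra_simps)
  also have "(\<Sum>(a, b)\<in>mono_splits (m + ?s). of_nat (?l b) * mcoeff g b * mcoeff f a) =
      (\<Sum>(b, a)\<in>mono_splits (m + ?s). of_nat (?l b) * mcoeff g b * mcoeff f a)"
    by (rule sum.reindex_bij_witness[where i = prod.swap and j = prod.swap])
       (auto simp: mono_splits_def add.commute)
  finally show "mcoeff (mps_deriv v (f * g)) m = mcoeff (mps_deriv v f * g + f * mps_deriv v g) m"
    unfolding half by (simp add: mult.commute)
qed


section \<open>Substitution\<close>

definition mpow :: "('v \<Rightarrow> ('w, 'a::comm_ring_1) mps) \<Rightarrow> 'v mono \<Rightarrow> ('w, 'a) mps" where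
  "mpow \<sigma> j = (\<Prod>v\<in>Poly_Mapping.keys j. \<sigma> v ^ Poly_Mapping.lookup j v)"

lemma mpow_superset:
  assumes "finite A" "Poly_Mapping.keys j \<subseteq> A"
  shows "mpow \<sigma> j = (\<Prod>v\<in>A. \<sigma> v ^ Poly_Mapping.lookup j v)"
  unfolding mpow_def using assms by (intro prod.mono_neutral_left) (auto simp: in_keys_iff)

lemma mpow_add: "mpow \<sigma> (a + b) = mpow \<sigma> a * mpow \<sigma> b"
proof -
  let ?A = "Poly_Mapping.keys a \<union> Poly_Mapping.keys b"
  have "mpow \<sigma> (a + b) = (\<Prod>v\<in>?A. \<sigma> v ^ Poly_Mapping.lookup (a + b) v)"
    by (rule mpow_superset) (auto simp: Poly_Mapping.keys_add)
  also have "\<dots> = (\<Prod>v\<in>?A. \<sigma> v ^ Poly_Mapping.lookup a v) * (\<Prod>v\<in>?A. \<sigma> v ^ Poly_Mapping.lookup b v)"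
    by (simp add: lookup_add power_add prod.distrib)
  also have "\<dots> = mpow \<sigma> a * mpow \<sigma> b"
    by (simp add: mpow_superset[of ?A a] mpow_superset[of ?A b])
  finally show ?thesis .
qed

lemma mpow_0 [simp]: "mpow \<sigma> 0 = 1"
  by (simp add: mpow_def)

lemma mpow_single [simp]: "mpow \<sigma> (Poly_Mapping.single v (Suc 0)) = \<sigma> v"
  by (simp add: mpow_def)

abbreviation cfree :: "('v \<Rightarrow> ('w, 'a::comm_ring_1) mps) \<Rightarrow> bool" where
  "cfree \<sigma> \<equiv> \<forall>v. mord (Suc 0) (\<sigma> v)"

text \<open>In the iterated law there are infinitely many variables \<open>(a, j)\<close>. Sending
  almost all of them to 0 guarantees that only finitely many exponents contribute to a given
  coefficient of a substitution.\<close>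

definition adm :: "('v \<Rightarrow> ('w, 'a::comm_ring_1) mps) \<Rightarrow> bool" where
  "adm \<sigma> \<longleftrightarrow> finite {v. \<sigma> v \<noteq> 0} \<and> cfree \<sigma>"

lemma adm_finite [simp]:
  "adm (\<sigma> :: 'v::finite \<Rightarrow> ('w, 'a::comm_ring_1) mps) \<longleftrightarrow> cfree \<sigma>"
  by (simp add: adm_def)

lemma mord_mpow:
  assumes "\<And>v. mord (Suc 0) (\<sigma> v)"
  shows "mord (mono_deg j) (mpow \<sigma> j)"
proof (induction j rule: mono_induct)
  case (add m v)
  show ?case using mord_mult[OF add assms[of v]] by (simp add: mpow_add)
qed simp

lemma mpow_eq_0:
  assumes "\<sigma> v = 0" "v \<in> Poly_Mapping.keys j"
  shows "mpow \<sigma> j = 0"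
proof -
  have "\<sigma> v ^ Poly_Mapping.lookup j v = 0"
    using assms by (simp add: in_keys_iff zero_power)
  thus ?thesis unfolding mpow_def using assms by (metis finite_keys prod_zero)
qed

text \<open>The exponents that can contribute to coefficients of degree at most \<open>d\<close>.\<close>
definition subst_supp :: "('v \<Rightarrow> ('w, 'a::comm_ring_1) mps) \<Rightarrow> nat \<Rightarrow> 'v mono set" where
  "subst_supp \<sigma> d = {j. Poly_Mapping.keys j \<subseteq> {v. \<sigma> v \<noteq> 0} \<and> mono_deg j \<le> d}"

lemma finite_subst_supp:
  assumes "adm \<sigma>"
  shows "finite (subst_supp \<sigma> d)"
proof (rule finite_subset)
  let ?A = "{v. \<sigma> v \<noteq> 0}"
  have fin: "finite ?A" using assms by (simp add: adm_def)
  let ?M = "Abs_poly_mapping (\<lambda>v. if v \<in> ?A then d else 0)"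
  have "{v. (if v \<in> ?A then d else 0) \<noteq> 0} \<subseteq> ?A" by auto
  hence l: "Poly_Mapping.lookup ?M = (\<lambda>v. if v \<in> ?A then d else 0)"
    using finite_subset[OF _ fin] by (intro lookup_Abs_poly_mapping) blast
  show "subst_supp \<sigma> d \<subseteq> {a. \<forall>v. Poly_Mapping.lookup a v \<le> Poly_Mapping.lookup ?M v}"
  proof safe
    fix j v assume j: "j \<in> subst_supp \<sigma> d"
    show "Poly_Mapping.lookup j v \<le> Poly_Mapping.lookup ?M v"
    proof (cases "v \<in> Poly_Mapping.keys j")
      case True
      hence "Poly_Mapping.lookup j v \<le> mono_deg j" by (auto simp: mono_deg_def intro: member_le_sum)
      with j True show ?thesis unfolding l by (auto simp: subst_supp_def)
    qed (simp add: in_keys_iff)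
  qed
qed (rule finite_mono_below)

lemma mpow_coeff_eq_0:
  assumes "adm \<sigma>" "j \<notin> subst_supp \<sigma> d" "mono_deg m \<le> d"
  shows "mcoeff (mpow \<sigma> j) m = 0"
proof (cases "Poly_Mapping.keys j \<subseteq> {v. \<sigma> v \<noteq> 0}")
  case True
  hence "mono_deg m < mono_deg j" using assms by (auto simp: subst_supp_def)
  thus ?thesis using mord_mpow[of \<sigma> j] assms by (auto simp: mordD adm_def)
next
  case False
  thus ?thesis using mpow_eq_0[of \<sigma> _ j] by auto
qed

text \<open>The bound \<open>d\<close> may exceed \<open>mono_deg m\<close>, so that coefficients at
  several monomials can be expanded over one common finite set; the product formula relies on
  this.\<close>

lemma mcoeff_subst:
  assumes "adm \<sigma>" "mono_deg m \<le> d"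
  shows "mcoeff (mps_subst f \<sigma>) m = (\<Sum>j\<in>subst_supp \<sigma> d. mcoeff f j * mcoeff (mpow \<sigma> j) m)"
proof -
  have "mcoeff (mps_subst f \<sigma>) m = Sum_any (\<lambda>j. mcoeff f j * mcoeff (mpow \<sigma> j) m)"
    by (simp add: mps_subst_def mpow_def)
  also have "\<dots> = (\<Sum>j\<in>subst_supp \<sigma> d. mcoeff f j * mcoeff (mpow \<sigma> j) m)"
    using mpow_coeff_eq_0[OF assms(1) _ assms(2)]
    by (intro Sum_any.expand_superset finite_subst_supp assms) force
  finally show ?thesis .
qed

lemma subst_add:
  assumes "adm \<sigma>"
  shows "mps_subst (f + g) \<sigma> = mps_subst f \<sigma> + mps_subst g \<sigma>"
  by (rule mps_eqI) (simp add: mcoeff_subst[OF assms order_refl] algebra_simps sum.distrib)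

lemma subst_const_mult:
  assumes "adm \<sigma>"
  shows "mps_subst (mps_const c * f) \<sigma> = mps_const c * mps_subst f \<sigma>"
  by (rule mps_eqI) (simp add: mcoeff_subst[OF assms order_refl] sum_distrib_left mult.assoc)

lemma subst_0 [simp]: "mps_subst 0 \<sigma> = 0"
  by (rule mps_eqI) (simp add: mps_subst_def)

lemma subst_uminus:
  assumes "adm \<sigma>"
  shows "mps_subst (- f) \<sigma> = - mps_subst f \<sigma>"
  using subst_add[OF assms, of f "- f"] by (simp add: eq_neg_iff_add_eq_0 add.commute)

lemma subst_diff:
  assumes "adm \<sigma>"
  shows "mps_subst (f - g) \<sigma> = mps_subst f \<sigma> - mps_subst g \<sigma>"
  using subst_add[OF assms, of f "- g"] by (simp add: subst_uminus[OF assms])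

lemma subst_sum:
  assumes "adm \<sigma>"
  shows "mps_subst (sum f A) \<sigma> = (\<Sum>x\<in>A. mps_subst (f x) \<sigma>)"
  by (induction A rule: infinite_finite_induct) (auto simp: subst_add[OF assms])

definition mmono :: "'v mono \<Rightarrow> ('v, 'a::comm_ring_1) mps" where
  "mmono j = Abs_mps (\<lambda>m. if m = j then 1 else 0)"

lemma mcoeff_mmono: "mcoeff (mmono j) m = (if m = j then 1 else 0)"
  by (simp add: mmono_def)

lemma mmono_0: "mmono 0 = 1"
  by (rule mps_eqI) (auto simp: mcoeff_mmono mcoeff_1)

lemma mmono_single: "mmono (Poly_Mapping.single v (Suc 0)) = mps_var v"
  by (rule mps_eqI) (auto simp: mcoeff_mmono mcoeff_var)

lemma mmono_add: "mmono (a + b) = mmono a * (mmono b :: ('v, 'a::comm_ring_1) mps)"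
proof (rule mps_eqI)
  fix m :: "'v mono"
  have "mcoeff (mmono a * mmono b :: ('v, 'a) mps) m =
      (\<Sum>x\<in>mono_splits m. if x = (a, b) then 1 else 0)"
    unfolding mcoeff_mult mcoeff_mmono by (intro sum.cong) (auto split: if_splits)
  also have "\<dots> = (if (a, b) \<in> mono_splits m then 1 else 0)" by (rule sum.delta) simp
  finally show "mcoeff (mmono (a + b)) m = mcoeff (mmono a * mmono b :: ('v, 'a) mps) m"
    by (auto simp: mcoeff_mmono mono_splits_def)
qed

lemma mpow_var: "mpow mps_var j = mmono j"
proof (induction j rule: mono_induct)
  case (add m v)
  thus ?case by (simp add: mpow_add mmono_add mmono_single)
qed (simp add: mmono_0)

lemma subst_mmono:
  assumes "adm \<sigma>"
  shows "mps_subst (mmono j) \<sigma> = mpow \<sigma> j"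
proof (rule mps_eqI)
  fix m
  have "mcoeff (mps_subst (mmono j) \<sigma>) m =
      (\<Sum>i\<in>subst_supp \<sigma> (mono_deg m). if i = j then mcoeff (mpow \<sigma> j) m else 0)"
    unfolding mcoeff_subst[OF assms order_refl] by (intro sum.cong) (auto simp: mcoeff_mmono)
  also have "\<dots> = mcoeff (mpow \<sigma> j) m"
    using mpow_coeff_eq_0[OF assms, of j "mono_deg m" m] by (simp add: finite_subst_supp[OF assms])
  finally show "mcoeff (mps_subst (mmono j) \<sigma>) m = mcoeff (mpow \<sigma> j) m" .
qed

lemma subst_1: "adm \<sigma> \<Longrightarrow> mps_subst 1 \<sigma> = 1"
  using subst_mmono[of \<sigma> 0] by (simp add: mmono_0)

lemma subst_const: "adm \<sigma> \<Longrightarrow> mps_subst (mps_const c) \<sigma> = mps_const c"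
  using subst_const_mult[of \<sigma> c 1] by (simp add: subst_1)

lemma subst_var: "adm \<sigma> \<Longrightarrow> mps_subst (mps_var v) \<sigma> = \<sigma> v"
  using subst_mmono[of \<sigma> "Poly_Mapping.single v (Suc 0)"] by (simp add: mmono_single)

text \<open>The sum over pairs \<open>(a, b)\<close> with \<open>a + b\<close> in the support is
  enlarged to the full square of the support, since the added terms vanish at \<open>m\<close>.
  After this both sides are rearrangements of one finite sum.\<close>

lemma subst_mult:
  fixes \<sigma> :: "'v \<Rightarrow> ('w, 'a::comm_ring_1) mps"
  assumes "adm \<sigma>"
  shows "mps_subst (f * g) \<sigma> = mps_subst f \<sigma> * mps_subst g \<sigma>"
proof (rule mps_eqI)
  fix m :: "'w mono"
  define d where "d = mono_deg m"
  let ?S = "subst_supp \<sigma> d"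
  let ?h = "\<lambda>(a, b). mcoeff f a * mcoeff g b * mcoeff (mpow \<sigma> (a + b)) m"
  have fin: "finite ?S" by (rule finite_subst_supp[OF assms])
  have sub: "a \<in> ?S" "b \<in> ?S" if "a + b \<in> ?S" for a b
  proof -
    have "Poly_Mapping.keys a \<subseteq> Poly_Mapping.keys (a + b)" "Poly_Mapping.keys b \<subseteq> Poly_Mapping.keys (a + b)"
      by (auto simp: in_keys_iff lookup_add)
    thus "a \<in> ?S" "b \<in> ?S" using that by (auto simp: subst_supp_def)
  qed
  have "mcoeff (mps_subst (f * g) \<sigma>) m = (\<Sum>j\<in>?S. \<Sum>x\<in>mono_splits j. ?h x)"
    unfolding mcoeff_subst[OF assms order_refl] d_def mcoeff_mult sum_distrib_right
    by (intro sum.cong refl) (auto simp: mono_splits_def)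
  also have "\<dots> = (\<Sum>x\<in>(\<Union>j\<in>?S. mono_splits j). ?h x)"
  proof (rule sum.UNION_disjoint[symmetric])
    show "\<forall>i\<in>?S. \<forall>j\<in>?S. i \<noteq> j \<longrightarrow> mono_splits i \<inter> mono_splits j = {}"
      by (auto simp: mono_splits_def)
  qed (simp_all add: fin)
  also have "\<dots> = (\<Sum>x\<in>?S \<times> ?S. ?h x)"
  proof (rule sum.mono_neutral_left)
    show "\<Union> (mono_splits ` ?S) \<subseteq> ?S \<times> ?S"
    proof clarify
      fix a b j assume "(a, b) \<in> mono_splits j" "j \<in> ?S"
      hence "a + b \<in> ?S" by (simp add: mono_splits_def)
      thus "a \<in> ?S \<and> b \<in> ?S" using sub[of a b] by simp
    qed
    show "\<forall>x\<in>?S \<times> ?S - \<Union> (mono_splits ` ?S). ?h x = 0"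
    proof clarify
      fix a b assume "(a, b) \<notin> \<Union> (mono_splits ` ?S)"
      hence "a + b \<notin> ?S" by (auto simp: mono_splits_def)
      thus "mcoeff f a * mcoeff g b * mcoeff (mpow \<sigma> (a + b)) m = 0"
        using mpow_coeff_eq_0[OF assms, of _ d m] by (simp add: d_def)
    qed
  qed (simp add: fin)
  also have "\<dots> = (\<Sum>a\<in>?S. \<Sum>b\<in>?S. \<Sum>(p, q)\<in>mono_splits m.
      mcoeff f a * mcoeff g b * (mcoeff (mpow \<sigma> a) p * mcoeff (mpow \<sigma> b) q))"
    unfolding sum.cartesian_product' prod.case mpow_add mcoeff_mult sum_distrib_left case_prod_unfold fst_conv snd_conv ..
  also have "\<dots> = (\<Sum>a\<in>?S. \<Sum>(p, q)\<in>mono_splits m. \<Sum>b\<in>?S.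
      mcoeff f a * mcoeff g b * (mcoeff (mpow \<sigma> a) p * mcoeff (mpow \<sigma> b) q))"
    unfolding case_prod_unfold by (intro sum.cong refl sum.swap)
  also have "\<dots> = (\<Sum>(p, q)\<in>mono_splits m. \<Sum>a\<in>?S. \<Sum>b\<in>?S.
      mcoeff f a * mcoeff g b * (mcoeff (mpow \<sigma> a) p * mcoeff (mpow \<sigma> b) q))"
    unfolding case_prod_unfold by (rule sum.swap)
  also have "\<dots> = (\<Sum>(p, q)\<in>mono_splits m. mcoeff (mps_subst f \<sigma>) p * mcoeff (mps_subst g \<sigma>) q)"
  proof (intro sum.cong refl, clarify)
    fix p q assume "(p, q) \<in> mono_splits m"
    from mono_splits_deg[OF this] have "mono_deg p \<le> d" "mono_deg q \<le> d" by (auto simp: d_def)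
    thus "(\<Sum>a\<in>?S. \<Sum>b\<in>?S. mcoeff f a * mcoeff g b * (mcoeff (mpow \<sigma> a) p * mcoeff (mpow \<sigma> b) q)) =
        mcoeff (mps_subst f \<sigma>) p * mcoeff (mps_subst g \<sigma>) q"
      unfolding mcoeff_subst[OF assms \<open>mono_deg p \<le> d\<close>] mcoeff_subst[OF assms \<open>mono_deg q \<le> d\<close>] sum_product
      by (intro sum.cong refl) (simp add: mult_ac)
  qed
  finally show "mcoeff (mps_subst (f * g) \<sigma>) m = mcoeff (mps_subst f \<sigma> * mps_subst g \<sigma>) m"
    by (simp add: mcoeff_mult)
qed

lemma subst_mpow: "adm \<tau> \<Longrightarrow> mps_subst (mpow \<sigma> j) \<tau> = mpow (\<lambda>v. mps_subst (\<sigma> v) \<tau>) j"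
  by (induction j rule: mono_induct) (auto simp: subst_1 subst_mult mpow_add)

lemma mord_subst:
  fixes \<sigma> :: "'v \<Rightarrow> ('w, 'a::comm_ring_1) mps"
  assumes "mord k f" "adm \<sigma>"
  shows "mord k (mps_subst f \<sigma>)"
  unfolding mord_def
proof (intro allI impI)
  fix m :: "'w mono" assume m: "mono_deg m < k"
  show "mcoeff (mps_subst f \<sigma>) m = 0"
    unfolding mcoeff_subst[OF assms(2) order_refl]
    using m by (intro sum.neutral) (simp add: subst_supp_def mordD[OF assms(1)])
qed

lemma mcoeff_subst_0 [simp]:
  assumes "adm \<sigma>"
  shows "mcoeff (mps_subst f \<sigma>) 0 = mcoeff f 0"
proof -
  have "mord (Suc 0) (f - mps_const (mcoeff f 0))"
    by (simp add: mord_1_iff mcoeff_const)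
  from mord_subst[OF this assms] have "mcoeff (mps_subst f \<sigma> - mps_const (mcoeff f 0)) 0 = 0"
    unfolding mord_1_iff subst_diff[OF assms] subst_const[OF assms] .
  thus ?thesis by (simp add: mcoeff_const)
qed

text \<open>
  With finitely many variables, a series is a polynomial up to a given order; so identities between
  additive maps that are continuous for the order filtration need only be checked on monomials.
\<close>
definition mcont :: "(('v, 'a::comm_ring_1) mps \<Rightarrow> 'b::ab_group_add) \<Rightarrow> bool" where
  "mcont T \<longleftrightarrow> (\<forall>f g. T (f + g) = T f + T g) \<and> (\<exists>N. \<forall>f. mord N f \<longrightarrow> T f = 0)"

lemma mcont_eq:
  fixes f :: "('v::finite, 'a::comm_ring_1) mps"
  assumes "mcont S" "mcont T" "\<And>c j. S (mps_const c * mmono j) = T (mps_const c * mmono j)"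
  shows "S f = T f"
proof -
  obtain N1 N2 where N: "\<And>f. mord N1 f \<Longrightarrow> S f = 0" "\<And>f. mord N2 f \<Longrightarrow> T f = 0"
    using assms by (auto simp: mcont_def)
  have add: "S (f + g) = S f + S g" "T (f + g) = T f + T g" for f g
    using assms by (auto simp: mcont_def)
  define N where "N = max N1 N2"
  define p where "p = (\<Sum>j\<in>{j :: 'v mono. mono_deg j \<le> N}. mps_const (mcoeff f j) * mmono j)"
  have zero: "S 0 = 0" "T 0 = 0" using add[of 0 0] by simp_all
  have sum: "S (sum g A) = (\<Sum>x\<in>A. S (g x))" "T (sum g A) = (\<Sum>x\<in>A. T (g x))" for g and A :: "'v mono set"
    by (induction A rule: infinite_finite_induct) (auto simp: add zero)
  have "mcoeff p m = mcoeff f m" if "mono_deg m \<le> N" for m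
  proof -
    have "mcoeff p m = (\<Sum>j\<in>{j. mono_deg j \<le> N}. if j = m then mcoeff f m else 0)"
      unfolding p_def mcoeff_sum by (intro sum.cong) (auto simp: mcoeff_mmono)
    thus ?thesis using that by (simp add: finite_mono_deg_le)
  qed
  hence "mord N (f - p)" by (auto simp: mord_def)
  hence "mord N1 (f - p)" "mord N2 (f - p)" by (auto simp: N_def elim: mord_mono)
  hence "S (f - p) = 0" "T (f - p) = 0" using N by blast+
  moreover have "S p = T p" unfolding p_def sum assms(3) ..
  ultimately show ?thesis using add[of "f - p" p] by simp
qed

text \<open>\<open>k\<close> is the order that \<open>T\<close> may lose: 0 for a substitution, 1
  for a derivation, the length of the word for an iterated operator.\<close>

lemma mcont_coeff_comp:
  fixes T :: "('v, 'a::comm_ring_1) mps \<Rightarrow> ('w, 'a) mps"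
  assumes "\<And>f g. T (f + g) = T f + T g" "\<And>n f. mord (n + k) f \<Longrightarrow> mord n (T f)"
  shows "mcont (\<lambda>f. mcoeff (T f) m)"
  unfolding mcont_def
proof (intro conjI allI exI impI)
  fix f :: "('v, 'a) mps" assume "mord (Suc (mono_deg m) + k) f"
  from assms(2)[OF this] show "mcoeff (T f) m = 0" by (rule mordD) simp
qed (simp add: assms(1))

lemma mcont_coeff_subst: "adm \<sigma> \<Longrightarrow> mcont (\<lambda>f. mcoeff (mps_subst f \<sigma>) m)"
  by (rule mcont_coeff_comp[where k = 0]) (auto simp: subst_add mord_subst)

lemma subst_subst:
  fixes f :: "('v::finite, 'a::comm_ring_1) mps"
  assumes \<sigma>: "cfree \<sigma>" and \<tau>: "adm \<tau>"
  shows "mps_subst (mps_subst f \<sigma>) \<tau> = mps_subst f (\<lambda>v. mps_subst (\<sigma> v) \<tau>)"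
proof (rule mps_eqI, rule mcont_eq[where f = f])
  fix m
  have \<sigma>\<tau>: "adm (\<lambda>v. mps_subst (\<sigma> v) \<tau>)" and \<sigma>': "adm \<sigma>" using mord_subst[OF _ \<tau>] \<sigma> by auto
  show "mcont (\<lambda>f. mcoeff (mps_subst f (\<lambda>v. mps_subst (\<sigma> v) \<tau>)) m)"
    by (rule mcont_coeff_subst[OF \<sigma>\<tau>])
  show "mcont (\<lambda>f. mcoeff (mps_subst (mps_subst f \<sigma>) \<tau>) m)"
    by (rule mcont_coeff_comp[where k = 0]) (auto simp: subst_add[OF \<sigma>'] subst_add[OF \<tau>] mord_subst[OF _ \<sigma>'] mord_subst[OF _ \<tau>])
  fix c j
  show "mcoeff (mps_subst (mps_subst (mps_const c * mmono j) \<sigma>) \<tau>) m =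
      mcoeff (mps_subst (mps_const c * mmono j) (\<lambda>v. mps_subst (\<sigma> v) \<tau>)) m"
    by (simp only: subst_const_mult[OF \<sigma>'] subst_const_mult[OF \<tau>] subst_const_mult[OF \<sigma>\<tau>]
        subst_mmono[OF \<sigma>'] subst_mmono[OF \<sigma>\<tau>] subst_mpow[OF \<tau>])
qed

lemma subst_id: "mps_subst f mps_var = (f :: ('v::finite, 'a::comm_ring_1) mps)"
proof (rule mps_eqI, rule mcont_eq[where f = f])
  fix m
  have adm: "adm (mps_var :: 'v \<Rightarrow> ('v, 'a) mps)" by (simp add: mord_var)
  show "mcont (\<lambda>f :: ('v, 'a) mps. mcoeff (mps_subst f mps_var) m)"
    by (rule mcont_coeff_subst[OF adm])
  show "mcont (\<lambda>f :: ('v, 'a) mps. mcoeff f m)"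
    by (rule mcont_coeff_comp[where k = 0]) auto
  show "mcoeff (mps_subst (mps_const c * mmono j) mps_var) m = mcoeff (mps_const c * mmono j :: ('v, 'a) mps) m" for c j
    by (simp add: subst_const_mult[OF adm] subst_mmono[OF adm] mpow_var)
qed

text \<open>Telescoping: one factor is traded for a difference of order \<open>k\<close>, while the
  other \<open>mono_deg j\<close> factors contribute order 1 each. Splitting off the variable
  \<open>u\<close> keeps subtraction out of the bound.\<close>

lemma mord_mpow_diff:
  assumes "\<And>v. mord (Suc 0) (\<sigma> v)" "\<And>v. mord (Suc 0) (\<tau> v)" "\<And>v. mord k (\<sigma> v - \<tau> v)"
  shows "mord (mono_deg j + k) (mpow \<sigma> (j + Poly_Mapping.single u (Suc 0)) - mpow \<tau> (j + Poly_Mapping.single u (Suc 0)))"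
proof (induction j arbitrary: u rule: mono_induct)
  case zero
  thus ?case using assms(3)[of u] by (simp add: mpow_add)
next
  case (add m v)
  let ?j = "m + Poly_Mapping.single v (Suc 0)"
  have "mpow \<sigma> (?j + Poly_Mapping.single u (Suc 0)) - mpow \<tau> (?j + Poly_Mapping.single u (Suc 0)) =
      (mpow \<sigma> ?j - mpow \<tau> ?j) * \<sigma> u + mpow \<tau> ?j * (\<sigma> u - \<tau> u)"
    unfolding mpow_add[of _ ?j] by (simp add: algebra_simps)
  moreover have "mord (mono_deg ?j + k) ((mpow \<sigma> ?j - mpow \<tau> ?j) * \<sigma> u)"
    using mord_mult[OF add assms(1)[of u]] by simp
  moreover have "mord (mono_deg ?j + k) (mpow \<tau> ?j * (\<sigma> u - \<tau> u))"
    using mord_mult[OF mord_mpow assms(3)] assms(2) by blast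
  ultimately show ?case by (simp add: mord_add)
qed

text \<open>A series of order \<open>n\<close> gains \<open>n - 1\<close> orders on the distance of
  its arguments. With \<open>n = 1\<close> nothing is lost; with \<open>n = 2\<close> one order is
  gained, which drives the successive approximation of the inverse.\<close>

lemma subst_close:
  fixes f :: "('v::finite, 'a::comm_ring_1) mps" and \<sigma> \<tau> :: "'v \<Rightarrow> ('w, 'a) mps"
  assumes \<sigma>: "\<And>v. mord (Suc 0) (\<sigma> v)" and \<tau>: "\<And>v. mord (Suc 0) (\<tau> v)"
    and diff: "\<And>v. mord k (\<sigma> v - \<tau> v)" and f: "mord n f"
  shows "mord (n + k - 1) (mps_subst f \<sigma> - mps_subst f \<tau>)"
  unfolding mord_def
proof (intro allI impI)
  fix m :: "'w mono" assume m: "mono_deg m < n + k - 1"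
  have adm: "adm \<sigma>" "adm \<tau>" using assms by auto
  let ?S = "subst_supp \<sigma> (mono_deg m) \<union> subst_supp \<tau> (mono_deg m)"
  have "mcoeff (mps_subst f \<sigma>) m = (\<Sum>j\<in>?S. mcoeff f j * mcoeff (mpow \<sigma> j) m)"
    unfolding mcoeff_subst[OF adm(1) order_refl]
    using finite_subst_supp[OF adm(1)] finite_subst_supp[OF adm(2)] mpow_coeff_eq_0[OF adm(1) _ order_refl]
    by (intro sum.mono_neutral_left) auto
  moreover have "mcoeff (mps_subst f \<tau>) m = (\<Sum>j\<in>?S. mcoeff f j * mcoeff (mpow \<tau> j) m)"
    unfolding mcoeff_subst[OF adm(2) order_refl]
    using finite_subst_supp[OF adm(1)] finite_subst_supp[OF adm(2)] mpow_coeff_eq_0[OF adm(2) _ order_refl]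
    by (intro sum.mono_neutral_left) auto
  moreover have "mcoeff f j * mcoeff (mpow \<sigma> j) m - mcoeff f j * mcoeff (mpow \<tau> j) m = 0" for j
  \<comment> \<open>For \<open>j = 0\<close> both powers are 1 and cancel; below degree
    \<open>n\<close> the coefficient of \<open>f\<close> is 0.\<close>
  proof (cases "j = 0 \<or> mono_deg j < n")
    case True
    thus ?thesis using f by (auto simp: mordD)
  next
    case False
    then obtain i u where j: "j = i + Poly_Mapping.single u 1" by (meson mono_nonzeroE)
    have "mono_deg m < mono_deg i + k" using False m unfolding j by simp
    hence "mcoeff (mpow \<sigma> j - mpow \<tau> j) m = 0"
      using mordD[OF mord_mpow_diff[of \<sigma> \<tau> k i u, OF \<sigma> \<tau> diff], of m] unfolding j by simp
    thus ?thesis by simp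
  qed
  ultimately show "mcoeff (mps_subst f \<sigma> - mps_subst f \<tau>) m = 0"
    by (simp flip: sum_subtractf)
qed

lemma chain_rule:
  fixes f :: "('v::finite, 'a::comm_ring_1) mps"
  assumes \<sigma>: "cfree \<sigma>"
  shows "mps_deriv w (mps_subst f \<sigma>) = (\<Sum>v\<in>UNIV. mps_subst (mps_deriv v f) \<sigma> * mps_deriv w (\<sigma> v))"
proof (rule mps_eqI, rule mcont_eq[where f = f])
  have adm: "adm \<sigma>" using \<sigma> by simp
  fix m
  let ?T = "\<lambda>f. (\<Sum>v\<in>UNIV. mps_subst (mps_deriv v f) \<sigma> * mps_deriv w (\<sigma> v))"
  show "mcont (\<lambda>f. mcoeff (mps_deriv w (mps_subst f \<sigma>)) m)"
    by (rule mcont_coeff_comp[where k = 1]) (auto simp: subst_add[OF adm] mps_deriv_add mord_deriv mord_subst[OF _ adm])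
  show "mcont (\<lambda>f. mcoeff (?T f) m)"
    by (rule mcont_coeff_comp[where k = 1])
      (auto simp: subst_add[OF adm] mps_deriv_add algebra_simps sum.distrib
        intro!: mord_sum mord_mult_right mord_mult_left mord_subst[OF _ adm] mord_deriv)
  fix c and j :: "'v mono"
  have "mps_deriv w (mps_subst (mmono j) \<sigma>) = ?T (mmono j)"
  proof (induction j rule: mono_induct)
    case zero
    show ?case by (simp add: mmono_0 subst_const[OF adm] flip: mps_const_1)
  next
    case (add m u)
    have "?T (mmono m * mps_var u) =
        (\<Sum>v\<in>UNIV. mps_subst (mps_deriv v (mmono m)) \<sigma> * mps_deriv w (\<sigma> v) * \<sigma> u
          + (if v = u then mpow \<sigma> m * mps_deriv w (\<sigma> u) else 0))"
      by (intro sum.cong refl)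
        (auto simp: mps_deriv_mult subst_add[OF adm] subst_mult[OF adm] subst_var[OF adm] mps_deriv_var
          subst_1[OF adm] subst_mmono[OF adm] algebra_simps)
    also have "\<dots> = ?T (mmono m) * \<sigma> u + mpow \<sigma> m * mps_deriv w (\<sigma> u)"
      by (simp add: sum.distrib sum_distrib_right)
    finally show ?case using add
      by (simp add: mmono_add mmono_single subst_mult[OF adm] mps_deriv_mult subst_var[OF adm] subst_mmono[OF adm])
  qed
  thus "mcoeff (mps_deriv w (mps_subst (mps_const c * mmono j) \<sigma>)) m = mcoeff (?T (mps_const c * mmono j)) m"
    by (simp add: subst_const_mult[OF adm] mps_deriv_const_mult sum_distrib_left mult.assoc del: mcoeff_sum)
qed


section \<open>Formal group laws\<close>

lemma cfree_case_sum: "cfree A \<Longrightarrow> cfree B \<Longrightarrow> cfree (case_sum A B)"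
  by (simp split: sum.split)

lemma case_sum_o: "(\<lambda>v. f (case_sum A B v)) = case_sum (\<lambda>j. f (A j)) (\<lambda>j. f (B j))"
  by (auto split: sum.split)

lemma cfree_subst: "cfree \<sigma> \<Longrightarrow> adm \<tau> \<Longrightarrow> cfree (\<lambda>v. mps_subst (\<sigma> v) \<tau>)"
  by (simp add: mord_subst)

lemma subst_close_1:
  fixes f :: "('v::finite, 'a::comm_ring_1) mps"
  assumes "cfree \<sigma>" "cfree \<tau>" "\<And>v. mord k (\<sigma> v - \<tau> v)" "mcoeff f 0 = 0"
  shows "mord k (mps_subst f \<sigma> - mps_subst f \<tau>)"
  using subst_close[of \<sigma> \<tau> k 1 f] assms by (simp add: mord_1_iff)

text \<open>If \<open>f\<close> has order \<open>n\<close>, then \<open>f\<close>, being the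
  difference of \<open>f\<close> at the identity and \<open>f\<close> at \<open>\<sigma>\<close>,
  has order \<open>n + 1\<close>, because the two substitutions agree up to second order. Hence
  \<open>f\<close> has every order.\<close>

lemma subst_inj:
  fixes f :: "('v::finite, 'a::comm_ring_1) mps"
  assumes \<sigma>: "cfree \<sigma>" and lin: "\<And>v. mord 2 (\<sigma> v - mps_var v)" and zero: "mps_subst f \<sigma> = 0"
  shows "f = 0"
proof (rule mord_all_imp_0)
  fix n show "mord n f"
  proof (induction n)
    case (Suc n)
    have "mord (n + 2 - 1) (mps_subst f \<sigma> - mps_subst f mps_var)"
      by (rule subst_close) (use \<sigma> lin Suc in \<open>auto simp: mord_var\<close>)
    thus ?case using mord_uminus by (fastforce simp: zero subst_id)
  qed simp
qed

lemma subst_zero: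
  fixes f :: "('v::finite, 'a::comm_ring_1) mps"
  shows "mps_subst f (\<lambda>_. 0) = (mps_const (mcoeff f 0) :: ('w, 'a) mps)"
proof (rule mps_eqI)
  fix m :: "'w mono"
  have "subst_supp (\<lambda>_ :: 'v. 0 :: ('w, 'a) mps) (mono_deg m) = {0}"
    by (auto simp: subst_supp_def)
  thus "mcoeff (mps_subst f (\<lambda>_. 0)) m = mcoeff (mps_const (mcoeff f 0) :: ('w, 'a) mps) m"
    by (subst mcoeff_subst[OF _ order_refl]) (auto simp: mcoeff_1 mcoeff_const)
qed

text \<open>Stated over an arbitrary commutative ring, so that it can be instantiated both for the
  given law and for its image over the quotient field.\<close>

locale formal_group =
  fixes G :: "('n::finite, 'a::comm_ring_1) fgl"
  assumes G_lin: "mord 2 (G j - mps_var (Inl j) - mps_var (Inr j))"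
    and assoc_var: "fgl_app G (fgl_app G (var_block 0) (var_block 1)) (var_block 2) =
      fgl_app G (var_block 0) (fgl_app G (var_block 1) (var_block 2))"

lemma formal_group_is_fgl:
  assumes "is_fgl G"
  shows "formal_group G"
proof -
  obtain \<gamma> where \<gamma>: "mcoeff (G j) m = mcoeff (mps_var (Inl j) + mps_var (Inr j) +
          (\<Sum>l\<in>UNIV. \<Sum>k\<in>UNIV. mps_const (\<gamma> j l k) * mps_var (Inl l) * mps_var (Inr k))) m"
    if "mono_deg m < 3" for j m
    using assms unfolding is_fgl_def by blast
  have q: "mord 2 (\<Sum>l\<in>UNIV. \<Sum>k\<in>UNIV. mps_const (\<gamma> j l k) * mps_var (Inl l) * mps_var (Inr k))" for j
  proof (intro mord_sum)
    fix l k
    show "mord 2 (mps_const (\<gamma> j l k) * mps_var (Inl l) * mps_var (Inr k))"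
      using mord_mult[OF mord_mult_left[OF mord_var] mord_var] by (simp add: numeral_2_eq_2)
  qed
  have "mord 2 (G j - mps_var (Inl j) - mps_var (Inr j))" for j
    unfolding mord_def
  proof (intro allI impI)
    fix m :: "('a + 'a) mono" assume m: "mono_deg m < 2"
    show "mcoeff (G j - mps_var (Inl j) - mps_var (Inr j)) m = 0"
      using \<gamma>[of m j] mordD[OF q m] m by simp
  qed
  thus ?thesis using assms by unfold_locales (auto simp: is_fgl_def)
qed

context formal_group
begin

lemma G_0: "mcoeff (G j) 0 = 0"
proof -
  have "mcoeff (G j - mps_var (Inl j) - mps_var (Inr j)) 0 = 0" by (rule mordD[OF G_lin]) simp
  thus ?thesis by (metis (no_types) diff_zero diff_diff_add mcoeff_diff mord_1_iff mord_var)
qed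

lemma cfree_G: "cfree G"
  by (simp add: mord_1_iff G_0)

lemma cfree_app: "cfree A \<Longrightarrow> cfree B \<Longrightarrow> cfree (fgl_app G A B)"
  by (simp add: fgl_app_def mord_subst cfree_G cfree_case_sum)

lemma subst_app:
  assumes "cfree A" "cfree B" "adm \<tau>"
  shows "mps_subst (fgl_app G A B j) \<tau> = fgl_app G (\<lambda>j. mps_subst (A j) \<tau>) (\<lambda>j. mps_subst (B j) \<tau>) j"
  unfolding fgl_app_def using cfree_case_sum[OF assms(1,2)] assms(3)
  by (simp add: subst_subst case_sum_o[of "\<lambda>f. mps_subst f \<tau>"])

lemma app_assoc:
  assumes A: "cfree A" and B: "cfree B" and C: "cfree C"
  shows "fgl_app G (fgl_app G A B) C = fgl_app G A (fgl_app G B C)"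
proof
  fix j
  \<comment> \<open>The three arguments are put into blocks 0, 1 and 2 of the generic associativity
    identity. Every further block goes to 0, which makes \<open>\<tau>\<close> admissible.\<close>
  define \<tau> where "\<tau> = (\<lambda>(a :: nat, j). if a = 0 then A j else if a = 1 then B j else if a = 2 then C j else 0)"
  have "{v. \<tau> v \<noteq> 0} \<subseteq> {0, 1, 2} \<times> UNIV" by (auto simp: \<tau>_def split: if_splits)
  hence "finite {v. \<tau> v \<noteq> 0}" by (rule finite_subset) simp
  hence adm: "adm \<tau>" unfolding adm_def using A B C by (auto simp: \<tau>_def)
  have blk: "(\<lambda>j. mps_subst (var_block a j) \<tau>) = (\<lambda>j. \<tau> (a, j))" for a
    by (simp add: var_block_def subst_var[OF adm])
  have cf: "cfree (var_block a :: 'n \<Rightarrow> (nat \<times> 'n, 'a) mps)" for a by (simp add: var_block_def mord_var)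
  have ab: "(\<lambda>j. mps_subst (fgl_app G (var_block a) (var_block b) j) \<tau>) = fgl_app G (\<lambda>j. \<tau> (a, j)) (\<lambda>j. \<tau> (b, j))" for a b
    by (rule ext) (simp add: subst_app[OF cf cf adm] blk)
  have "mps_subst (fgl_app G (fgl_app G (var_block 0) (var_block 1)) (var_block 2) j) \<tau> =
      mps_subst (fgl_app G (var_block 0) (fgl_app G (var_block 1) (var_block 2)) j) \<tau>"
    by (simp only: assoc_var)
  thus "fgl_app G (fgl_app G A B) C j = fgl_app G A (fgl_app G B C) j"
    by (simp only: subst_app[OF cfree_app[OF cf cf] cf adm] subst_app[OF cf cfree_app[OF cf cf] adm] blk ab)
      (simp add: \<tau>_def)
qed

lemma subst_G_0: "mps_subst (G j) (\<lambda>_. 0) = 0"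
  by (simp add: subst_zero G_0)

lemma case_sum_const: "case_sum (\<lambda>_. c) (\<lambda>_. c) = (\<lambda>_. c)"
  by (auto split: sum.split)

text \<open>
  The unit laws are a consequence of associativity: \<open>l(\<^bold>X) = G(0, \<^bold>X)\<close> satisfies \<open>l \<circ> l = l\<close> and agrees
  with \<open>\<^bold>X\<close> up to higher order terms.
\<close>
lemma app_unit_aux:
  fixes l :: "'n \<Rightarrow> ('n, 'a) mps"
  assumes l: "cfree l" and lin: "\<And>j. mord 2 (l j - mps_var j)" and idem: "\<And>j. mps_subst (l j) l = l j"
  shows "l j = mps_var j"
proof -
  have adm: "adm l" using l by simp
  have "mps_subst (l j - mps_var j) l = 0"
    by (simp add: subst_diff[OF adm] subst_var[OF adm] idem)
  from subst_inj[OF l lin this] show ?thesis by simp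
qed

lemma app_0_left: assumes "cfree A" shows "fgl_app G (\<lambda>_. 0) A = A"
proof -
  let ?l = "fgl_app G (\<lambda>_. 0) mps_var :: 'n \<Rightarrow> ('n, 'a) mps"
  have cv: "cfree (mps_var :: 'n \<Rightarrow> ('n, 'a) mps)" and c0: "cfree (\<lambda>_ :: 'n. 0 :: ('n, 'a) mps)" by (simp_all add: mord_var)
  have cl: "cfree ?l" by (rule cfree_app[OF c0 cv])
  have adm: "adm ?l" using cl by simp
  have "?l j = mps_var j" for j
  proof (rule app_unit_aux[OF cl])
    fix j
    let ?\<sigma> = "case_sum (\<lambda>_. 0) mps_var :: 'n + 'n \<Rightarrow> ('n, 'a) mps"
    have a: "adm ?\<sigma>" using cfree_case_sum[OF c0 cv] by simp
    show "mord 2 (?l j - mps_var j)"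
      using mord_subst[OF G_lin a, of j] by (simp add: fgl_app_def subst_diff[OF a] subst_var[OF a])
    \<comment> \<open>Idempotence by associativity:
      \<open>G(0, G(0, X)) = G(G(0, 0), X) = G(0, X)\<close>.\<close>
    have "mps_subst (?l j) ?l = fgl_app G (\<lambda>_. 0) ?l j"
      by (simp add: subst_app[OF c0 cv adm] subst_var[OF adm])
    also have "\<dots> = fgl_app G (fgl_app G (\<lambda>_. 0) (\<lambda>_. 0)) mps_var j"
      by (simp add: app_assoc[OF c0 c0 cv])
    also have "fgl_app G (\<lambda>_. 0) (\<lambda>_. 0) = (\<lambda>_. 0 :: ('n, 'a) mps)"
      by (simp add: fgl_app_def case_sum_const subst_G_0)
    finally show "mps_subst (?l j) ?l = ?l j" .
  qed
  \<comment> \<open>The law for generic \<open>X\<close> specialises to an arbitrary point by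
    substitution.\<close>
  moreover have "mps_subst (?l j) A = fgl_app G (\<lambda>_. 0) A j" for j
    using assms by (subst subst_app[OF c0 cv]) (simp_all add: subst_var)
  ultimately show ?thesis using assms by (simp add: fun_eq_iff subst_var)
qed

lemma app_0_right: assumes "cfree A" shows "fgl_app G A (\<lambda>_. 0) = A"
proof -
  let ?l = "fgl_app G mps_var (\<lambda>_. 0) :: 'n \<Rightarrow> ('n, 'a) mps"
  have cv: "cfree (mps_var :: 'n \<Rightarrow> ('n, 'a) mps)" and c0: "cfree (\<lambda>_ :: 'n. 0 :: ('n, 'a) mps)" by (simp_all add: mord_var)
  have cl: "cfree ?l" by (rule cfree_app[OF cv c0])
  have adm: "adm ?l" using cl by simp
  have "?l j = mps_var j" for j
  proof (rule app_unit_aux[OF cl])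
    fix j
    let ?\<sigma> = "case_sum mps_var (\<lambda>_. 0) :: 'n + 'n \<Rightarrow> ('n, 'a) mps"
    have a: "adm ?\<sigma>" using cfree_case_sum[OF cv c0] by simp
    show "mord 2 (?l j - mps_var j)"
      using mord_subst[OF G_lin a, of j] by (simp add: fgl_app_def subst_diff[OF a] subst_var[OF a])
    have "mps_subst (?l j) ?l = fgl_app G ?l (\<lambda>_. 0) j"
      by (simp add: subst_app[OF cv c0 adm] subst_var[OF adm])
    also have "\<dots> = fgl_app G mps_var (fgl_app G (\<lambda>_. 0) (\<lambda>_. 0)) j"
      by (simp add: app_assoc[OF cv c0 c0])
    also have "fgl_app G (\<lambda>_. 0) (\<lambda>_. 0) = (\<lambda>_. 0 :: ('n, 'a) mps)"
      by (simp add: fgl_app_def case_sum_const subst_G_0)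
    finally show "mps_subst (?l j) ?l = ?l j" .
  qed
  moreover have "mps_subst (?l j) A = fgl_app G A (\<lambda>_. 0) j" for j
    using assms by (subst subst_app[OF cv c0]) (simp_all add: subst_var)
  ultimately show ?thesis using assms by (simp add: fun_eq_iff subst_var)
qed

lemma app_close:
  assumes "cfree A" "cfree B" "cfree B'" "\<And>j. mord k (B j - B' j)"
  shows "mord k (fgl_app G A B j - fgl_app G A B' j)"
  unfolding fgl_app_def
  by (rule subst_close_1) (use assms G_0 in \<open>auto split: sum.split\<close>)

text \<open>Successive approximation of the solution \<open>s\<close> of \<open>G(\<^bold>X, s) = 0\<close>.\<close>
primrec inv_approx :: "nat \<Rightarrow> 'n \<Rightarrow> ('n, 'a) mps" where
  "inv_approx 0 = (\<lambda>_. 0)"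
| "inv_approx (Suc n) = (\<lambda>j. inv_approx n j - fgl_app G mps_var (inv_approx n) j)"

text \<open>With \<open>G = X + Y + h\<close> and \<open>h\<close> of order 2, the correction
  cancels the linear part of the error exactly. What remains is the difference of the values of
  \<open>h\<close> at two successive approximations, and this gains one order.\<close>

lemma inv_approx: "cfree (inv_approx n) \<and> (\<forall>j. mord (Suc n) (fgl_app G mps_var (inv_approx n) j))"
proof (induction n)
  case 0
  show ?case using app_0_right[of mps_var] by (simp add: mord_var)
next
  case (Suc n)
  let ?s = "inv_approx n" and ?s' = "inv_approx (Suc n)"
  have s: "cfree ?s" and o: "\<And>j. mord (Suc n) (fgl_app G mps_var ?s j)" using Suc by auto
  have cv: "cfree (mps_var :: 'n \<Rightarrow> ('n, 'a) mps)" by (simp add: mord_var)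
  have s': "cfree ?s'" using s mord_mono[OF o, of "Suc 0"] by (simp add: mord_diff)
  have "mord (Suc (Suc n)) (fgl_app G mps_var ?s' j)" for j
  proof -
    define h where "h = G j - mps_var (Inl j) - mps_var (Inr j)"
    have Gj: "G j = h + (mps_var (Inl j) + mps_var (Inr j))" by (simp add: h_def)
    have app: "fgl_app G mps_var B j = mps_subst h (case_sum mps_var B) + (mps_var j + B j)"
      if "cfree B" for B :: "'n \<Rightarrow> ('n, 'a) mps"
    proof -
      have a: "adm (case_sum mps_var B)" using cfree_case_sum[OF cv that] by simp
      show ?thesis unfolding fgl_app_def by (subst Gj) (simp add: subst_add[OF a] subst_var[OF a])
    qed
    have "mord (2 + Suc n - 1) (mps_subst h (case_sum mps_var ?s') - mps_subst h (case_sum mps_var ?s))"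
    proof (rule subst_close)
      show "mord 2 h" unfolding h_def by (rule G_lin)
      show "mord (Suc n) (case_sum mps_var ?s' v - case_sum mps_var ?s v)" for v
        using o by (auto split: sum.split intro: mord_uminus)
    qed (use cfree_case_sum[OF cv s] cfree_case_sum[OF cv s'] in auto)
    moreover have "fgl_app G mps_var ?s' j = mps_subst h (case_sum mps_var ?s') - mps_subst h (case_sum mps_var ?s)"
      using app[OF s] app[OF s'] by (simp add: algebra_simps)
    ultimately show ?thesis by simp
  qed
  with s' show ?case by blast
qed

lemma ex_inverse: "\<exists>s. cfree s \<and> fgl_app G mps_var s = (\<lambda>_. 0)"
proof -
  \<comment> \<open>By \<open>step\<close> below, the coefficient at \<open>m\<close> no longer
    changes from the approximation with index \<open>mono_deg m\<close> on.\<close>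
  define s where "s = (\<lambda>j. Abs_mps (\<lambda>m. mcoeff (inv_approx (mono_deg m) j) m))"
  have step: "mord (Suc n) (inv_approx (n + k) j - inv_approx n j)" for n k j
  proof (induction k)
    case (Suc k)
    have "mord (Suc n) (fgl_app G mps_var (inv_approx (n + k)) j)"
      using inv_approx[of "n + k"] mord_mono[of "Suc (n + k)" "fgl_app G mps_var (inv_approx (n + k)) j" "Suc n"] by simp
    from mord_diff[OF Suc this] show ?case by (simp add: algebra_simps)
  qed simp
  have close: "mord (Suc n) (s j - inv_approx n j)" for n j
    unfolding mord_def
  proof (intro allI impI)
    fix m :: "'n mono" assume "mono_deg m < Suc n"
    hence "n = mono_deg m + (n - mono_deg m)" by simp
    with mordD[OF step[of "mono_deg m" "n - mono_deg m" j], of m]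
    show "mcoeff (s j - inv_approx n j) m = 0" by (simp add: s_def)
  qed
  have s: "cfree s" using close[of 0] by simp
  have cv: "cfree (mps_var :: 'n \<Rightarrow> ('n, 'a) mps)" by (simp add: mord_var)
  have "mord n (fgl_app G mps_var s j)" for n j
  proof -
    have i: "cfree (inv_approx n)" "mord (Suc n) (fgl_app G mps_var (inv_approx n) j)" using inv_approx by auto
    have "mord (Suc n) (fgl_app G mps_var s j - fgl_app G mps_var (inv_approx n) j)"
      by (rule app_close[OF cv s i(1) close])
    from mord_add[OF this i(2)] show ?thesis by (auto elim: mord_mono)
  qed
  hence "fgl_app G mps_var s = (\<lambda>_. 0)" by (intro ext mord_all_imp_0)
  with s show ?thesis by blast
qed

text \<open>Substituting \<open>s\<close> into its own equation produces a right inverse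
  \<open>s' = s(s(X))\<close> of \<open>s\<close>, and associativity forces \<open>s' = X\<close>.
  So \<open>s\<close> is a two-sided inverse, and uniqueness follows as in any monoid.\<close>

lemma inverse_unique:
  assumes s: "cfree s" "fgl_app G mps_var s = (\<lambda>_. 0)" and r: "cfree r" "fgl_app G mps_var r = (\<lambda>_. 0)"
  shows "r = s" "fgl_app G s mps_var = (\<lambda>_. 0)"
proof -
  have cv: "cfree (mps_var :: 'n \<Rightarrow> ('n, 'a) mps)" by (simp add: mord_var)
  have adm: "adm s" using s by simp
  define s' where "s' = (\<lambda>j. mps_subst (s j) s)"
  have s': "cfree s'" unfolding s'_def by (rule cfree_subst[OF s(1) adm])
  have "fgl_app G s s' = (\<lambda>_. 0)"
  proof
    fix j
    have "fgl_app G s s' j = mps_subst (fgl_app G mps_var s j) s"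
      by (simp add: subst_app[OF cv s(1) adm] s'_def subst_var[OF adm])
    thus "fgl_app G s s' j = 0" by (simp add: s(2))
  qed
  hence "s' = mps_var"
    using app_assoc[OF cv s(1) s'] app_0_left[OF s'] app_0_right[OF cv] s(2) by simp
  with \<open>fgl_app G s s' = (\<lambda>_. 0)\<close> show left: "fgl_app G s mps_var = (\<lambda>_. 0)" by simp
  show "r = s"
    using app_assoc[OF s(1) cv r(1)] app_0_left[OF r(1)] app_0_right[OF s(1)] r(2) left by simp
qed

lemma fgl_inverse:
  shows cfree_inverse: "cfree (fgl_inverse G)"
    and inverse_right: "fgl_app G mps_var (fgl_inverse G) = (\<lambda>_. 0)"
    and inverse_left: "fgl_app G (fgl_inverse G) mps_var = (\<lambda>_. 0)"
proof -
  have "\<exists>!s. (\<forall>j. mcoeff (s j) 0 = 0) \<and> fgl_app G mps_var s = (\<lambda>_. 0)"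
    using ex_inverse inverse_unique(1) unfolding mord_1_iff by blast
  from theI'[OF this] have "cfree (fgl_inverse G) \<and> fgl_app G mps_var (fgl_inverse G) = (\<lambda>_. 0)"
    unfolding fgl_inverse_def mord_1_iff .
  thus "cfree (fgl_inverse G)" "fgl_app G mps_var (fgl_inverse G) = (\<lambda>_. 0)"
    "fgl_app G (fgl_inverse G) mps_var = (\<lambda>_. 0)" using inverse_unique(2) by blast+
qed

end

section \<open>Passage from the ground ring to its quotient field\<close>

lemma to_quot_simps [simp]:
  "to_quot (a + b) = to_quot a + to_quot b" "to_quot (a * b) = to_quot a * to_quot b"
  "to_quot (- a) = - to_quot a" "to_quot (a - b) = to_quot a - to_quot b"
  "to_quot 0 = 0" "to_quot 1 = 1" "to_quot (of_nat n) = of_nat n"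
  by (simp_all add: to_quot_def Zero_fract_def One_fract_def of_nat_fract)

lemma to_quot_inject [simp]: "to_quot a = to_quot b \<longleftrightarrow> a = b"
  by (simp add: to_quot_def eq_fract)

lemma to_quot_eq_0 [simp]: "to_quot a = 0 \<longleftrightarrow> a = 0"
  using to_quot_inject[of a 0] by (simp del: to_quot_inject)

lemma to_quot_sum [simp]: "to_quot (sum f A) = (\<Sum>x\<in>A. to_quot (f x))"
  by (induction A rule: infinite_finite_induct) auto

lemma inv_to_quot [simp]: "the_inv to_quot (to_quot a) = a"
  by (rule the_inv_f_f) (simp add: inj_def)

abbreviation mapq :: "('v, 'a::idom) mps \<Rightarrow> ('v, 'a fract) mps" where
  "mapq \<equiv> mps_map to_quot"

lemma mapq_mult: "mapq (f * g) = mapq f * mapq g"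
  by (rule mps_eqI) (simp add: mcoeff_mult case_prod_unfold)

lemma mapq_simps [simp]: "mapq 0 = 0" "mapq 1 = 1" "mapq (mps_var v) = mps_var v"
  "mapq (f + g) = mapq f + mapq g" "mapq (f - g) = mapq f - mapq g"
  by (rule mps_eqI; simp add: mcoeff_1 mcoeff_var)+

lemma mapq_mpow: "mapq (mpow \<sigma> j) = mpow (\<lambda>v. mapq (\<sigma> v)) j"
  by (induction j rule: mono_induct) (auto simp: mpow_add mapq_mult)

lemma mapq_eq_0 [simp]: "mapq f = 0 \<longleftrightarrow> f = 0"
  by (metis (no_types) mapq_simps(1) mcoeff_map mps_eqI to_quot_inject)

lemma mord_mapq [simp]: "mord k (mapq f) \<longleftrightarrow> mord k f"
  by (simp add: mord_def)

lemma adm_mapq [simp]: "adm (\<lambda>v. mapq (\<sigma> v)) \<longleftrightarrow> adm \<sigma>"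
  by (simp add: adm_def)

lemma mapq_subst:
  fixes \<sigma> :: "'v \<Rightarrow> ('w, 'a::idom) mps"
  assumes "adm \<sigma>"
  shows "mapq (mps_subst f \<sigma>) = mps_subst (mapq f) (\<lambda>v. mapq (\<sigma> v))"
proof (rule mps_eqI)
  fix m :: "'w mono"
  have "subst_supp (\<lambda>v. mapq (\<sigma> v)) (mono_deg m) = subst_supp \<sigma> (mono_deg m)"
    by (simp add: subst_supp_def)
  thus "mcoeff (mapq (mps_subst f \<sigma>)) m = mcoeff (mps_subst (mapq f) (\<lambda>v. mapq (\<sigma> v))) m"
    using assms by (simp add: mcoeff_subst[OF _ order_refl] mapq_mpow[symmetric])
qed

lemma mapq_fgl_app:
  fixes G :: "('n::finite, 'a::idom) fgl"
  assumes "cfree A" "cfree B"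
  shows "mapq (fgl_app G A B j) = fgl_app (\<lambda>j. mapq (G j)) (\<lambda>j. mapq (A j)) (\<lambda>j. mapq (B j)) j"
  unfolding fgl_app_def using cfree_case_sum[OF assms] by (simp add: mapq_subst case_sum_o[of mapq])

lemma mapq_var_block: "(\<lambda>j. mapq (var_block a j)) = var_block a"
  by (simp add: var_block_def)

lemma cfree_var_block: "cfree (var_block a :: 'n \<Rightarrow> (nat \<times> 'n, 'a::comm_ring_1) mps)"
  by (simp add: var_block_def mord_var)

lemma formal_group_mapq:
  fixes G :: "('n::finite, 'a::idom) fgl"
  assumes "formal_group G"
  shows "formal_group (\<lambda>j. mapq (G j))"
proof
  interpret formal_group G by fact
  let ?G = "\<lambda>j. mapq (G j)"
  show "mord 2 (?G j - mps_var (Inl j) - mps_var (Inr j))" for j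
    using G_lin[of j] mord_mapq[of 2 "G j - mps_var (Inl j) - mps_var (Inr j)"] by (simp del: mord_mapq)
  note c = cfree_var_block
  have app: "(\<lambda>j. mapq (fgl_app G A B j)) = fgl_app ?G (\<lambda>j. mapq (A j)) (\<lambda>j. mapq (B j))"
    if "cfree A" "cfree B" for A B :: "'n \<Rightarrow> (nat \<times> 'n, 'a) mps"
    using mapq_fgl_app[OF that] by blast
  show "fgl_app ?G (fgl_app ?G (var_block 0) (var_block 1)) (var_block 2) =
      fgl_app ?G (var_block 0) (fgl_app ?G (var_block 1) (var_block 2))"
    using arg_cong[OF assoc_var, of "\<lambda>F j. mapq (F j)"]
    by (simp only: app[OF cfree_app[OF c c] c] app[OF c cfree_app[OF c c]] app[OF c c] mapq_var_block)
qed


section \<open>The modified ring of functions\<close>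

definition integral :: "'a::idom fract \<Rightarrow> bool" where
  "integral x \<longleftrightarrow> x \<in> range to_quot"

lemma integral_to_quot [simp]: "integral (to_quot a)" by (simp add: integral_def)

lemma integralE: assumes "integral x" obtains a where "x = to_quot a"
  using assms by (auto simp: integral_def)

lemma integral_0 [simp]: "integral 0" and integral_1 [simp]: "integral 1"
  and integral_of_nat [simp]: "integral (of_nat n)"
  by (metis integral_to_quot to_quot_simps(5), metis integral_to_quot to_quot_simps(6),
      metis integral_to_quot to_quot_simps(7))

lemma integral_add: "integral a \<Longrightarrow> integral b \<Longrightarrow> integral (a + b)"
  by (metis integralE integral_to_quot to_quot_simps(1))

lemma integral_mult: "integral a \<Longrightarrow> integral b \<Longrightarrow> integral (a * b)"
  by (metis integralE integral_to_quot to_quot_simps(2))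

lemma to_quot_inv: "integral x \<Longrightarrow> to_quot (the_inv to_quot x) = x"
  by (auto elim: integralE)

text \<open>A degree-bounded form of membership in \<open>mod_functions\<close>. Derivatives lower
  the bound, which opens products and substitutions to induction on \<open>n\<close>.\<close>

definition modf :: "nat \<Rightarrow> ('v, 'a::idom fract) mps \<Rightarrow> bool" where
  "modf n f \<longleftrightarrow> (\<forall>m. mono_deg m \<le> n \<longrightarrow> integral (of_nat (mono_fact m) * mcoeff f m))"

lemma mod_functions_iff: "f \<in> mod_functions \<longleftrightarrow> (\<forall>n. modf n f)"
  by (auto simp: mod_functions_def modf_def integral_def)

lemma mod_functionsD: "f \<in> mod_functions \<Longrightarrow> integral (of_nat (mono_fact m) * mcoeff f m)"
  by (simp add: mod_functions_def integral_def)

lemma mod_functionsI: "(\<And>m. integral (of_nat (mono_fact m) * mcoeff f m)) \<Longrightarrow> f \<in> mod_functions"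
  by (simp add: mod_functions_def integral_def)

lemma modf_0: "modf 0 f \<longleftrightarrow> integral (mcoeff f 0)"
  by (auto simp: modf_def)

text \<open>The coefficient at \<open>m + v\<close> times its factorial equals the coefficient at
  \<open>m\<close> of the \<open>v\<close>-derivative times its factorial, so differentiation only
  shifts the scaled coefficients.\<close>

lemma modf_Suc:
  fixes f :: "('v, 'a::idom fract) mps"
  shows "modf (Suc n) f \<longleftrightarrow> integral (mcoeff f 0) \<and> (\<forall>v. modf n (mps_deriv v f))"
proof -
  have eq: "of_nat (mono_fact m) * mcoeff (mps_deriv v f) m =
      of_nat (mono_fact (m + Poly_Mapping.single v 1)) * mcoeff f (m + Poly_Mapping.single v 1)" for m v
    unfolding mono_fact_add_single mcoeff_deriv of_nat_mult by (simp only: mult_ac)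
  show ?thesis
  proof (intro iffI conjI allI)
    assume f: "modf (Suc n) f"
    thus "integral (mcoeff f 0)" using modf_def[of "Suc n" f] by (auto dest!: spec[of _ 0])
    show "modf n (mps_deriv v f)" for v
      unfolding modf_def eq using f by (simp add: modf_def)
  next
    assume f: "integral (mcoeff f 0) \<and> (\<forall>v. modf n (mps_deriv v f))"
    show "modf (Suc n) f"
      unfolding modf_def
    proof (intro allI impI)
      fix m :: "'v mono" assume m: "mono_deg m \<le> Suc n"
      show "integral (of_nat (mono_fact m) * mcoeff f m)"
      proof (cases "m = 0")
        case False
        then obtain m' v where m': "m = m' + Poly_Mapping.single v 1" by (rule mono_nonzeroE)
        with m f show ?thesis unfolding m' eq[symmetric] by (simp add: modf_def)
      qed (use f in simp)
    qed
  qed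
qed

lemma modf_mono: "modf n f \<Longrightarrow> k \<le> n \<Longrightarrow> modf k f"
  by (simp add: modf_def)

lemma modf_add: "modf n f \<Longrightarrow> modf n g \<Longrightarrow> modf n (f + g)"
  by (auto simp: modf_def algebra_simps intro!: integral_add)

lemma modf_sum: "(\<And>x. x \<in> A \<Longrightarrow> modf n (f x)) \<Longrightarrow> modf n (sum f A)"
  by (induction A rule: infinite_finite_induct) (simp_all add: modf_add, simp_all add: modf_def)

text \<open>The Leibniz rule and induction on the degree take the place of a computation with
  binomial coefficients.\<close>

lemma modf_mult: "modf n f \<Longrightarrow> modf n g \<Longrightarrow> modf n (f * g)"
proof (induction n arbitrary: f g)
  case 0
  thus ?case by (simp add: modf_0 integral_mult)
next
  case (Suc n)
  have "modf n (f * g')" if "modf n g'" for g' using Suc that by (blast intro: modf_mono le_SucI order_refl)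
  moreover have "modf n (f' * g)" if "modf n f'" for f' using Suc that by (blast intro: modf_mono le_SucI order_refl)
  ultimately show ?case using Suc.prems
    by (auto simp: modf_Suc mps_deriv_mult integral_mult intro!: modf_add)
qed

lemma modfun_mult: "f \<in> mod_functions \<Longrightarrow> g \<in> mod_functions \<Longrightarrow> f * g \<in> mod_functions"
  by (simp add: mod_functions_iff modf_mult)

lemma modfun_add: "f \<in> mod_functions \<Longrightarrow> g \<in> mod_functions \<Longrightarrow> f + g \<in> mod_functions"
  by (simp add: mod_functions_iff modf_add)

lemma modfun_sum: "(\<And>x. x \<in> A \<Longrightarrow> f x \<in> mod_functions) \<Longrightarrow> sum f A \<in> mod_functions"
  by (simp add: mod_functions_iff modf_sum)

lemma modfun_mapq [simp]: "mapq f \<in> mod_functions"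
  by (rule mod_functionsI) (simp flip: to_quot_simps(7) to_quot_simps(2))

lemma modfun_var [simp]: "mps_var v \<in> mod_functions"
  using modfun_mapq[of "mps_var v"] by simp

lemma modfun_0 [simp]: "0 \<in> mod_functions" and modfun_1 [simp]: "1 \<in> mod_functions"
  using modfun_mapq[of 0] modfun_mapq[of 1] by simp_all

lemma modfun_const: "integral c \<Longrightarrow> mps_const c \<in> mod_functions"
  by (rule mod_functionsI) (simp add: mcoeff_const)

lemma modfun_deriv: "f \<in> mod_functions \<Longrightarrow> mps_deriv v f \<in> mod_functions"
  by (metis mod_functions_iff modf_Suc)

text \<open>By the chain rule every derivative of the composite is a sum of products of a derivative
  of \<open>f\<close> composed with \<open>\<sigma>\<close> and a derivative of
  \<open>\<sigma>\<close>. The induction therefore has to let \<open>f\<close> vary.\<close>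

lemma modf_subst:
  fixes f :: "('v::finite, 'a::idom fract) mps"
  assumes \<sigma>: "cfree \<sigma>" "\<And>v. \<sigma> v \<in> mod_functions" and f: "f \<in> mod_functions"
  shows "modf n (mps_subst f \<sigma>)"
  using f
proof (induction n arbitrary: f)
  case 0
  hence "modf 0 f" by (simp add: mod_functions_iff)
  thus ?case using \<sigma> by (simp add: modf_0)
next
  case (Suc n)
  have "modf n (\<Sum>u\<in>UNIV. mps_subst (mps_deriv u f) \<sigma> * mps_deriv v (\<sigma> u))" for v
  proof (intro modf_sum modf_mult)
    show "modf n (mps_deriv v (\<sigma> u))" for u
      using modfun_deriv[OF \<sigma>(2)] by (simp add: mod_functions_iff)
    show "modf n (mps_subst (mps_deriv u f) \<sigma>)" for u
      by (rule Suc.IH) (rule modfun_deriv[OF Suc.prems])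
  qed
  moreover have "integral (mcoeff f 0)" using mod_functionsD[OF Suc.prems, of 0] by simp
  ultimately show ?case using \<sigma> by (simp add: modf_Suc chain_rule)
qed

lemma modfun_subst:
  fixes f :: "('v::finite, 'a::idom fract) mps"
  assumes "cfree \<sigma>" "\<And>v. \<sigma> v \<in> mod_functions" "f \<in> mod_functions"
  shows "mps_subst f \<sigma> \<in> mod_functions"
  using modf_subst[OF assms] by (simp add: mod_functions_iff)


section \<open>Renaming of variables\<close>

text \<open>The exponent of a renamed monomial; summing over fibres covers renamings that identify
  variables.\<close>

definition mpush :: "('v::finite \<Rightarrow> 'w::finite) \<Rightarrow> 'v mono \<Rightarrow> 'w mono" where
  "mpush \<rho> j = Abs_poly_mapping (\<lambda>w. \<Sum>v | \<rho> v = w. Poly_Mapping.lookup j v)"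

definition mpull :: "('v::finite \<Rightarrow> 'w) \<Rightarrow> 'w mono \<Rightarrow> 'v mono" where
  "mpull \<rho> m = Abs_poly_mapping (\<lambda>v. Poly_Mapping.lookup m (\<rho> v))"

lemma lookup_mpull [simp]: "Poly_Mapping.lookup (mpull \<rho> m) v = Poly_Mapping.lookup m (\<rho> v)"
  by (simp add: mpull_def)

lemma lookup_mpush: "Poly_Mapping.lookup (mpush \<rho> j) w = (\<Sum>v | \<rho> v = w. Poly_Mapping.lookup j v)"
  by (simp add: mpush_def)

lemma lookup_mpush_inj: "inj \<rho> \<Longrightarrow> Poly_Mapping.lookup (mpush \<rho> j) (\<rho> v) = Poly_Mapping.lookup j v"
proof -
  assume "inj \<rho>"
  hence "{v'. \<rho> v' = \<rho> v} = {v}" by (auto dest: injD)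
  thus ?thesis by (simp add: lookup_mpush)
qed

lemma mpush_add: "mpush \<rho> (a + b) = mpush \<rho> a + mpush \<rho> b"
  by (rule poly_mapping_eqI) (simp add: lookup_mpush lookup_add sum.distrib)

lemma mpush_0 [simp]: "mpush \<rho> 0 = 0"
  by (rule poly_mapping_eqI) (simp add: lookup_mpush)

lemma mpush_single: "mpush \<rho> (Poly_Mapping.single v k) = Poly_Mapping.single (\<rho> v) k"
  by (rule poly_mapping_eqI) (auto simp: lookup_mpush lookup_single when_def)

lemma mpow_rename: "mpow (\<lambda>v. mps_var (\<rho> v)) j = mmono (mpush \<rho> j)"
  by (induction j rule: mono_induct) (simp_all add: mpow_add mpush_add mpush_single mmono_add mmono_single mmono_0)

lemma rename_mmono: "mps_rename \<rho> (mmono j) = mmono (mpush \<rho> j)"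
  by (simp add: mps_rename_def subst_mmono mord_var mpow_rename)

lemma mord_rename: "mord k f \<Longrightarrow> mord k (mps_rename \<rho> f)" for f :: "('v::finite, 'a::comm_ring_1) mps"
  by (simp add: mps_rename_def mord_subst mord_var)

lemma rename_hom:
  fixes f g :: "('v::finite, 'a::comm_ring_1) mps"
  shows "mps_rename \<rho> (f + g) = mps_rename \<rho> f + mps_rename \<rho> g"
    "mps_rename \<rho> (f - g) = mps_rename \<rho> f - mps_rename \<rho> g"
    "mps_rename \<rho> (f * g) = mps_rename \<rho> f * mps_rename \<rho> g"
    "mps_rename \<rho> (mps_const c * f) = mps_const c * mps_rename \<rho> f"
    "mps_rename \<rho> (mps_var v) = (mps_var (\<rho> v) :: ('w, 'a) mps)"
    "mps_rename \<rho> (mps_const c) = mps_const c"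
    "mps_rename \<rho> 1 = (1 :: ('w, 'a) mps)" "mps_rename \<rho> 0 = (0 :: ('w, 'a) mps)"
  by (simp_all add: mps_rename_def subst_add subst_diff subst_mult subst_const_mult subst_const subst_1 subst_var mord_var)

lemma subst_rename:
  fixes f :: "('v::finite, 'a::comm_ring_1) mps"
  shows "adm \<tau> \<Longrightarrow> mps_subst (mps_rename \<rho> f) \<tau> = mps_subst f (\<lambda>v. \<tau> (\<rho> v))"
  by (simp add: mps_rename_def subst_subst mord_var subst_var)

lemma rename_rename:
  fixes f :: "('v::finite, 'a::comm_ring_1) mps" and \<rho>' :: "'w::finite \<Rightarrow> 'u"
  shows "mps_rename \<rho>' (mps_rename \<rho> f) = mps_rename (\<rho>' \<circ> \<rho>) f"
  by (simp add: mps_rename_def[of \<rho>'] subst_rename mord_var) (simp add: mps_rename_def)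

lemma rename_subst:
  fixes f :: "('v::finite, 'a::comm_ring_1) mps" and \<rho> :: "'w::finite \<Rightarrow> 'u"
  shows "cfree \<sigma> \<Longrightarrow> mps_rename \<rho> (mps_subst f \<sigma>) = mps_subst f (\<lambda>v. mps_rename \<rho> (\<sigma> v))"
  by (simp add: mps_rename_def subst_subst mord_var)

lemma modfun_rename: "f \<in> mod_functions \<Longrightarrow> mps_rename \<rho> f \<in> mod_functions" for f :: "('v::finite, 'a::idom fract) mps"
  by (simp add: mps_rename_def modfun_subst mord_var)

lemma mcont_eq2:
  fixes f :: "('v::finite, 'a::comm_ring_1) mps" and g :: "('w::finite, 'a) mps"
  assumes "\<And>g. mcont (\<lambda>f. S f g)" "\<And>g. mcont (\<lambda>f. T f g)" "\<And>f. mcont (\<lambda>g. S f g)" "\<And>f. mcont (\<lambda>g. T f g)"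
    and "\<And>c i d j. S (mps_const c * mmono i) (mps_const d * mmono j) = T (mps_const c * mmono i) (mps_const d * mmono j)"
  shows "S f g = T f g"
  by (rule mcont_eq[OF assms(1,2)], rule mcont_eq[OF assms(3,4)], rule assms(5))

lemma mcont_coeff: "mcont (\<lambda>f. mcoeff f m)"
  by (rule mcont_coeff_comp[where k = 0]) auto

lemma mcont_mult:
  fixes c :: "'a::comm_ring_1"
  assumes "mcont (S :: ('v, 'a) mps \<Rightarrow> 'a)" shows "mcont (\<lambda>f. S f * c)" "mcont (\<lambda>f. c * S f)"
  using assms unfolding mcont_def by (auto simp: algebra_simps) (metis mult_zero_left mult_zero_right)+

text \<open>When the variables fall into two disjoint blocks, every monomial factors uniquely into
  one monomial from each. By bilinearity and continuity it suffices to compare a pair of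
  monomials.\<close>

lemma mcoeff_rename_mult:
  fixes f :: "('v::finite, 'a::comm_ring_1) mps" and g :: "('w::finite, 'a) mps" and \<rho> :: "'v \<Rightarrow> 'u::finite"
  assumes inj: "inj \<rho>" "inj \<rho>'" "range \<rho> \<inter> range \<rho>' = {}" "range \<rho> \<union> range \<rho>' = UNIV"
  shows "mcoeff (mps_rename \<rho> f * mps_rename \<rho>' g) m = mcoeff f (mpull \<rho> m) * mcoeff g (mpull \<rho>' m)"
proof (rule mcont_eq2[where f = f and g = g and S = "\<lambda>f g. mcoeff (mps_rename \<rho> f * mps_rename \<rho>' g) m"
      and T = "\<lambda>f g. mcoeff f (mpull \<rho> m) * mcoeff g (mpull \<rho>' m)"])
  have zero: "Poly_Mapping.lookup (mpush \<rho> i) (\<rho>' w) = 0" "Poly_Mapping.lookup (mpush \<rho>' j) (\<rho> v) = 0" for i j v w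
  proof -
    have "{v. \<rho> v = \<rho>' w} = {}" "{w. \<rho>' w = \<rho> v} = {}" using inj(3) by auto
    thus "Poly_Mapping.lookup (mpush \<rho> i) (\<rho>' w) = 0" "Poly_Mapping.lookup (mpush \<rho>' j) (\<rho> v) = 0"
      by (simp_all add: lookup_mpush)
  qed
  have eq: "mpush \<rho> i + mpush \<rho>' j = m \<longleftrightarrow> i = mpull \<rho> m \<and> j = mpull \<rho>' m" for i j
  proof safe
    assume "m = mpush \<rho> i + mpush \<rho>' j"
    show "i = mpull \<rho> (mpush \<rho> i + mpush \<rho>' j)" "j = mpull \<rho>' (mpush \<rho> i + mpush \<rho>' j)"
      by (rule poly_mapping_eqI; simp add: lookup_add zero lookup_mpush_inj[OF inj(1)] lookup_mpush_inj[OF inj(2)])+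
  next
    show "mpush \<rho> (mpull \<rho> m) + mpush \<rho>' (mpull \<rho>' m) = m"
    proof (rule poly_mapping_eqI)
      fix u
      have "u \<in> range \<rho> \<or> u \<in> range \<rho>'" using inj(4) by blast
      thus "Poly_Mapping.lookup (mpush \<rho> (mpull \<rho> m) + mpush \<rho>' (mpull \<rho>' m)) u = Poly_Mapping.lookup m u"
        by (auto simp: lookup_add zero lookup_mpush_inj[OF inj(1)] lookup_mpush_inj[OF inj(2)])
    qed
  qed
  fix c d i j
  have "mps_rename \<rho> (mps_const c * mmono i) * mps_rename \<rho>' (mps_const d * mmono j) =
      mps_const c * (mps_const d * mmono (mpush \<rho> i + mpush \<rho>' j))"
    by (simp add: rename_hom rename_mmono mmono_add mult_ac)
  thus "mcoeff (mps_rename \<rho> (mps_const c * mmono i) * mps_rename \<rho>' (mps_const d * mmono j)) m =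
      mcoeff (mps_const c * mmono i) (mpull \<rho> m) * mcoeff (mps_const d * mmono j) (mpull \<rho>' m)"
    using eq[of i j] by (auto simp: mcoeff_mmono)
next
  show "mcont (\<lambda>f. mcoeff (mps_rename \<rho> f * mps_rename \<rho>' g) m)" for g
    by (rule mcont_coeff_comp[where k = 0]) (auto simp: rename_hom algebra_simps mord_rename intro: mord_mult_right)
  show "mcont (\<lambda>g. mcoeff (mps_rename \<rho> f * mps_rename \<rho>' g) m)" for f
    by (rule mcont_coeff_comp[where k = 0]) (auto simp: rename_hom algebra_simps mord_rename intro: mord_mult_left)
qed (intro mcont_mult mcont_coeff)+

definition mjoin :: "'v::finite mono \<Rightarrow> 'w::finite mono \<Rightarrow> ('v + 'w) mono" where
  "mjoin i j = Abs_poly_mapping (case_sum (Poly_Mapping.lookup i) (Poly_Mapping.lookup j))"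

lemma lookup_mjoin [simp]: "Poly_Mapping.lookup (mjoin i j) = case_sum (Poly_Mapping.lookup i) (Poly_Mapping.lookup j)"
  by (simp add: mjoin_def)

lemma mpull_mjoin [simp]: "mpull Inl (mjoin i j) = i" "mpull Inr (mjoin i j) = j"
  by (rule poly_mapping_eqI; simp)+

lemma mjoin_mpull [simp]: "mjoin (mpull Inl m) (mpull Inr m) = m"
  by (rule poly_mapping_eqI) (simp split: sum.split)

lemma mjoin_eq_iff [simp]: "mjoin i j = mjoin i' j' \<longleftrightarrow> i = i' \<and> j = j'"
  by (metis mpull_mjoin)

lemma sum_UNIV_Plus: "sum f (UNIV :: ('v::finite + 'w::finite) set) = (\<Sum>v\<in>UNIV. f (Inl v)) + (\<Sum>w\<in>UNIV. f (Inr w))"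
  unfolding UNIV_Plus_UNIV[symmetric] by (subst sum.Plus) auto

lemma prod_UNIV_Plus: "prod f (UNIV :: ('v::finite + 'w::finite) set) = (\<Prod>v\<in>UNIV. f (Inl v)) * (\<Prod>w\<in>UNIV. f (Inr w))"
  unfolding UNIV_Plus_UNIV[symmetric] by (subst prod.Plus) auto

lemma mono_deg_mjoin [simp]: "mono_deg (mjoin i j) = mono_deg i + mono_deg j"
  by (simp add: mono_deg_finite sum_UNIV_Plus)

lemma mono_fact_mjoin [simp]: "mono_fact (mjoin i j) = mono_fact i * mono_fact j"
  by (simp add: mono_fact_finite prod_UNIV_Plus)

abbreviation mten :: "('v::finite, 'a::comm_ring_1) mps \<Rightarrow> ('w::finite, 'a) mps \<Rightarrow> ('v + 'w, 'a) mps" where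
  "mten f g \<equiv> mps_rename Inl f * mps_rename Inr g"

lemma range_Inl_Inr: "range Inl \<union> range Inr = UNIV"
  by (metis UNIV_eq_I UnI1 UnI2 obj_sumE rangeI)

lemma mcoeff_mten: "mcoeff (mten f g) m = mcoeff f (mpull Inl m) * mcoeff g (mpull Inr m)"
  by (rule mcoeff_rename_mult) (auto simp: range_Inl_Inr)


section \<open>Left invariant differential operators\<close>

declare mord_var [simp] split_sum_all [simp]

lemma mps_deriv_commute: "mps_deriv u (mps_deriv v f) = mps_deriv v (mps_deriv u (f :: ('v, 'a::comm_ring_1) mps))"
proof (cases "u = v")
  case False
  thus ?thesis
    by (intro mps_eqI) (simp add: mcoeff_deriv lookup_add lookup_single when_def add_ac mult_ac)
qed simp

lemma mps_deriv_rename: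
  fixes f :: "('v::finite, 'a::comm_ring_1) mps"
  assumes "inj \<rho>"
  shows "mps_deriv (\<rho> v) (mps_rename \<rho> f) = mps_rename \<rho> (mps_deriv v f)"
proof -
  have "mps_deriv (\<rho> v) (mps_rename \<rho> f) = (\<Sum>u\<in>UNIV. mps_rename \<rho> (mps_deriv u f) * (if u = v then 1 else 0))"
    unfolding mps_rename_def using assms by (simp add: chain_rule mord_var mps_deriv_var inj_eq)
  thus ?thesis by (simp add: if_distrib cong: if_cong)
qed

lemma mps_deriv_rename_0:
  fixes f :: "('v::finite, 'a::comm_ring_1) mps"
  assumes "w \<notin> range \<rho>"
  shows "mps_deriv w (mps_rename \<rho> f) = 0"
  unfolding mps_rename_def using assms by (simp add: chain_rule mord_var mps_deriv_var) (auto intro!: sum.neutral)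

lemma mcoeff_deriv_fact:
  "of_nat (mono_fact m) * mcoeff (mps_deriv v f) m =
    of_nat (mono_fact (m + Poly_Mapping.single v 1)) * (mcoeff f (m + Poly_Mapping.single v 1) :: 'a::comm_ring_1)"
  unfolding mono_fact_add_single mcoeff_deriv of_nat_mult by (simp only: mult_ac)

definition wmono :: "'v list \<Rightarrow> 'v mono" where
  "wmono w = (\<Sum>v\<leftarrow>w. Poly_Mapping.single v 1)"

lemma wmono_simps [simp]: "wmono [] = 0" "wmono (v # w) = Poly_Mapping.single v 1 + wmono w"
  by (simp_all add: wmono_def)

lemma mono_deg_wmono [simp]: "mono_deg (wmono w) = length w"
  by (induction w) auto

lemma mcoeff_derivs_fact:
  fixes f :: "('v, 'a::comm_ring_1) mps"
  shows "of_nat (mono_fact m) * mcoeff (foldr mps_deriv w f) m = of_nat (mono_fact (m + wmono w)) * mcoeff f (m + wmono w)"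
proof (induction w arbitrary: m)
  case (Cons v w)
  have "of_nat (mono_fact m) * mcoeff (foldr mps_deriv (v # w) f) m =
      of_nat (mono_fact (m + Poly_Mapping.single v 1)) * mcoeff (foldr mps_deriv w f) (m + Poly_Mapping.single v 1)"
    by (simp only: foldr_Cons o_apply mcoeff_deriv_fact)
  thus ?case unfolding Cons by (simp add: add_ac)
qed simp

lemma mcoeff_derivs_0:
  "mcoeff (foldr mps_deriv w f) 0 = of_nat (mono_fact (wmono w)) * (mcoeff f (wmono w) :: 'a::comm_ring_1)"
  using mcoeff_derivs_fact[of 0 w f] by simp

abbreviation ev0 :: "('v::finite + 'w::finite, 'a::comm_ring_1) mps \<Rightarrow> ('v, 'a) mps" where
  "ev0 F \<equiv> mps_subst F (case_sum mps_var (\<lambda>_. 0))"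

lemma ev0_rename_Inl: "ev0 (mps_rename Inl f) = (f :: ('v::finite, 'a::comm_ring_1) mps)"
  by (simp add: subst_rename subst_id)

lemma ev0_rename_Inr: "ev0 (mps_rename Inr f) = mps_const (mcoeff f 0)"
  by (simp add: subst_rename subst_zero)

lemma deriv_ev0: "mps_deriv v (ev0 F) = ev0 (mps_deriv (Inl v) F)"
proof -
  have "mps_deriv v (ev0 F) = (\<Sum>u\<in>UNIV. ev0 (mps_deriv (Inl u) F) * (if u = v then 1 else 0))"
    by (simp add: chain_rule sum_UNIV_Plus mps_deriv_var mord_var split: sum.split)
  thus ?thesis by (simp add: if_distrib cong: if_cong)
qed

lemma deriv_diag:
  fixes F :: "('v::finite + 'v, 'a::comm_ring_1) mps"
  shows "mps_deriv v (mps_subst F (case_sum mps_var mps_var)) =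
    mps_subst (mps_deriv (Inl v) F + mps_deriv (Inr v) F) (case_sum mps_var mps_var)"
proof -
  have adm: "adm (case_sum mps_var mps_var :: 'v + 'v \<Rightarrow> ('v, 'a) mps)"
    by (simp add: mord_var split: sum.split)
  have "mps_deriv v (mps_subst F (case_sum mps_var mps_var)) =
      (\<Sum>u\<in>UNIV. mps_subst (mps_deriv (Inl u) F) (case_sum mps_var mps_var) * (if u = v then 1 else 0)) +
      (\<Sum>u\<in>UNIV. mps_subst (mps_deriv (Inr u) F) (case_sum mps_var mps_var) * (if u = v then 1 else 0))"
    using adm by (simp add: chain_rule sum_UNIV_Plus mps_deriv_var)
  thus ?thesis by (simp add: if_distrib subst_add[OF adm] cong: if_cong)
qed

context formal_group
begin

text \<open>The coefficient matrix of the left invariant vector fields with respect to the partial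
  derivatives: row \<open>i\<close> is the velocity of \<open>G(X, Y)\<close> in the direction
  \<open>Y_i\<close> at \<open>Y = 0\<close>. At the origin it is the identity matrix.\<close>

definition frame :: "'n \<Rightarrow> 'n \<Rightarrow> ('n, 'a) mps" where
  "frame i j = ev0 (mps_deriv (Inr i) (G j))"

text \<open>
  The left invariant derivation \<open>f \<mapsto> \<partial>/\<partial>Y\<^sub>i f(G(\<^bold>X, \<^bold>Y))\<close> at \<open>\<^bold>Y = 0\<close>, acting on the variables \<open>\<rho> j\<close>.
\<close>
definition ldiff :: "('n \<Rightarrow> 'v::finite) \<Rightarrow> 'n \<Rightarrow> ('v, 'a) mps \<Rightarrow> ('v, 'a) mps" where
  "ldiff \<rho> i F = (\<Sum>j\<in>UNIV. mps_rename \<rho> (frame i j) * mps_deriv (\<rho> j) F)"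

abbreviation ldiffs :: "('n \<Rightarrow> 'v::finite) \<Rightarrow> 'n list \<Rightarrow> ('v, 'a) mps \<Rightarrow> ('v, 'a) mps" where
  "ldiffs \<rho> w \<equiv> foldr (ldiff \<rho>) w"

lemma ldiff_add: "ldiff \<rho> i (F + H) = ldiff \<rho> i F + ldiff \<rho> i H"
  by (simp add: ldiff_def mps_deriv_add algebra_simps sum.distrib)

lemma ldiff_const_mult: "ldiff \<rho> i (mps_const c * F) = mps_const c * ldiff \<rho> i F"
  unfolding ldiff_def mps_deriv_const_mult sum_distrib_left by (simp only: mult.left_commute)

lemma ldiff_0 [simp]: "ldiff \<rho> i 0 = 0"
  by (simp add: ldiff_def)

lemma ldiff_sum: "ldiff \<rho> i (sum f A) = (\<Sum>x\<in>A. ldiff \<rho> i (f x))"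
  by (induction A rule: infinite_finite_induct) (auto simp: ldiff_add)

lemma ldiff_mult: "ldiff \<rho> i (F * H) = ldiff \<rho> i F * H + F * ldiff \<rho> i H"
  by (simp add: ldiff_def mps_deriv_mult algebra_simps sum.distrib sum_distrib_left)

lemma ldiff_1 [simp]: "ldiff \<rho> i 1 = 0"
  by (simp add: ldiff_def flip: mps_const_1)

lemma ldiff_const [simp]: "ldiff \<rho> i (mps_const c) = 0"
  by (simp add: ldiff_def)

lemma mord_ldiff: "mord (Suc k) F \<Longrightarrow> mord k (ldiff \<rho> i F)"
  unfolding ldiff_def by (intro mord_sum mord_mult_left mord_deriv)

lemma ldiffs_add: "ldiffs \<rho> w (F + H) = ldiffs \<rho> w F + ldiffs \<rho> w H"
  by (induction w) (auto simp: ldiff_add)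

lemma ldiffs_const_mult: "ldiffs \<rho> w (mps_const c * F) = mps_const c * ldiffs \<rho> w F"
  by (induction w) (auto simp: ldiff_const_mult)

lemma ldiffs_0 [simp]: "ldiffs \<rho> w 0 = 0"
  by (induction w) auto

lemma mord_ldiffs: "mord (k + length w) F \<Longrightarrow> mord k (ldiffs \<rho> w F)"
  by (induction w arbitrary: k) (simp_all add: mord_ldiff)

lemma ldiff_rename_0:
  fixes f :: "('u::finite, 'a) mps"
  assumes "\<And>j. \<rho> j \<notin> range \<rho>'"
  shows "ldiff \<rho> i (mps_rename \<rho>' f) = 0"
  using assms by (simp add: ldiff_def mps_deriv_rename_0)

lemma ldiff_rename:
  assumes "inj \<rho>"
  shows "ldiff \<rho> i (mps_rename \<rho> f) = mps_rename \<rho> (ldiff (\<lambda>j. j) i f)"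
proof -
  have sum: "mps_rename \<rho> (sum g A) = (\<Sum>x\<in>A. mps_rename \<rho> (g x))" for g :: "'n \<Rightarrow> ('n, 'a) mps" and A
    by (induction A rule: infinite_finite_induct) (auto simp: rename_hom)
  show ?thesis by (simp add: ldiff_def mps_deriv_rename[OF assms] sum rename_hom rename_rename comp_def)
qed

lemma ldiffs_mten_Inr: "ldiffs Inr w (mten f g) = mten f (ldiffs (\<lambda>j. j) w g)"
  by (induction w) (simp_all add: ldiff_mult ldiff_rename_0 ldiff_rename image_iff)

lemma ldiffs_mten_Inl: "ldiffs Inl w (mten f g) = mten (ldiffs (\<lambda>j. j) w f) g"
  by (induction w) (simp_all add: ldiff_mult ldiff_rename_0 ldiff_rename image_iff)

text \<open>The coefficients of each operator involve only its own block and are constants for the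
  other one; what remains is the symmetry of second derivatives.\<close>

lemma ldiff_commute: "ldiff Inl i (ldiff Inr k F) = ldiff Inr k (ldiff Inl i F)"
proof -
  have "ldiff Inl i (ldiff Inr k F) = (\<Sum>j\<in>UNIV. \<Sum>l\<in>UNIV.
      mps_rename Inl (frame i j) * (mps_rename Inr (frame k l) * mps_deriv (Inl j) (mps_deriv (Inr l) F)))"
    by (simp add: ldiff_def mps_deriv_sum mps_deriv_mult mps_deriv_rename_0 image_iff sum_distrib_left)
  also have "\<dots> = (\<Sum>l\<in>UNIV. \<Sum>j\<in>UNIV.
      mps_rename Inl (frame i j) * (mps_rename Inr (frame k l) * mps_deriv (Inl j) (mps_deriv (Inr l) F)))"
    by (rule sum.swap)
  also have "\<dots> = ldiff Inr k (ldiff Inl i F)"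
    by (simp add: ldiff_def mps_deriv_sum mps_deriv_mult mps_deriv_rename_0 image_iff sum_distrib_left
        mps_deriv_commute[of "Inl _"] mult_ac)
  finally show ?thesis .
qed

lemma ldiffs_commute: "ldiff Inr k (ldiffs Inl w F) = ldiffs Inl w (ldiff Inr k F)"
  by (induction w) (simp_all flip: ldiff_commute)

lemma ev0_sum: "ev0 (sum f A) = (\<Sum>x\<in>A. ev0 (f x))"
  by (rule subst_sum) simp

lemma ev0_ldiff_Inl: "ev0 (ldiff Inl i F) = ldiff (\<lambda>j. j) i (ev0 F)"
  by (simp add: ldiff_def ev0_sum subst_mult ev0_rename_Inl deriv_ev0) (simp add: mps_rename_def subst_id)

lemma ev0_ldiffs_Inl: "ev0 (ldiffs Inl w F) = ldiffs (\<lambda>j. j) w (ev0 F)"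
  by (induction w) (simp_all add: ev0_ldiff_Inl)

lemma ldiff_diag:
  "ldiff (\<lambda>j. j) i (mps_subst F (case_sum mps_var mps_var)) =
    mps_subst (ldiff Inl i F + ldiff Inr i F) (case_sum mps_var mps_var)"
proof -
  have adm: "adm (case_sum mps_var mps_var :: 'n + 'n \<Rightarrow> ('n, 'a) mps)"
    by (simp add: mord_var split: sum.split)
  show ?thesis
    by (simp add: ldiff_def subst_sum[OF adm] subst_add[OF adm] subst_mult[OF adm] subst_rename[OF adm]
        deriv_diag algebra_simps sum.distrib) (simp add: mps_rename_def subst_id)
qed

lemma deriv_app:
  assumes "cfree A" "cfree B" "\<And>j. mps_deriv w (A j) = 0"
  shows "mps_deriv w (fgl_app G A B l) =
    (\<Sum>j\<in>UNIV. mps_subst (mps_deriv (Inr j) (G l)) (case_sum A B) * mps_deriv w (B j))"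
  unfolding fgl_app_def using cfree_case_sum[OF assms(1,2)] assms(3)
  by (simp add: chain_rule sum_UNIV_Plus)

lemma deriv_app_unit:
  assumes "cfree A" "cfree B" "\<And>j. mps_deriv w (A j) = 0" "\<And>j. mps_deriv w (B j) = (if j = i then 1 else 0)"
  shows "mps_deriv w (fgl_app G A B l) = mps_subst (mps_deriv (Inr i) (G l)) (case_sum A B)"
  unfolding deriv_app[OF assms(1-3)] by (simp add: assms(4) if_distrib cong: if_cong)

lemma subst_frame:
  assumes "cfree A"
  shows "mps_subst (frame i l) A = mps_subst (mps_deriv (Inr i) (G l)) (case_sum A (\<lambda>_. 0))"
  unfolding frame_def using assms
  by (subst subst_subst) (simp_all add: mord_var case_sum_o[of "\<lambda>f. mps_subst f A"] subst_var split: sum.split)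

text \<open>Obtained from associativity by differentiating with respect to the last variable at \<open>0\<close>.\<close>
lemma ldiff_app_coord:
  fixes A :: "'n \<Rightarrow> ('n + 'n, 'a) mps"
  assumes A: "cfree A" "\<And>j v. mps_deriv (Inr v) (A j) = 0"
  defines "B \<equiv> \<lambda>j. mps_var (Inr j)"
  shows "ldiff Inr i (fgl_app G A B l) = mps_subst (frame i l) (fgl_app G A B)"
proof -
  let ?\<tau> = "case_sum mps_var (\<lambda>_. 0) :: ('n + 'n) + 'n \<Rightarrow> ('n + 'n, 'a) mps"
  \<comment> \<open>A third block is adjoined: \<open>C\<close> is its generic point,
    \<open>A'\<close> and \<open>B'\<close> do not involve it, and \<open>?\<tau>\<close> sets it to
    0 after differentiation.\<close>
  define A' B' C where "A' = (\<lambda>j. mps_rename Inl (A j) :: (('n + 'n) + 'n, 'a) mps)"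
    and "B' = (\<lambda>j. mps_rename Inl (B j) :: (('n + 'n) + 'n, 'a) mps)"
    and "C = (\<lambda>j. mps_var (Inr j) :: (('n + 'n) + 'n, 'a) mps)"
  have B: "cfree B" by (simp add: B_def mord_var)
  have cf: "cfree A'" "cfree B'" "cfree C" using A B by (simp_all add: A'_def B'_def C_def mord_rename mord_var)
  have \<tau>: "mps_subst (A' j) ?\<tau> = A j" "mps_subst (B' j) ?\<tau> = B j" "mps_subst (C j) ?\<tau> = 0" for j
    by (simp_all add: A'_def B'_def C_def ev0_rename_Inl subst_var)
  have dA: "mps_deriv (Inr v) (A' j) = 0" "mps_deriv (Inr v) (B' j) = 0" for v j
    by (simp_all add: A'_def B'_def mps_deriv_rename_0 image_iff)
  have dC: "mps_deriv (Inr v) (C j) = (if j = v then 1 else 0)" for v j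
    by (simp add: C_def mps_deriv_var)
  have sub: "mps_subst (mps_subst H (case_sum P Q)) ?\<tau> =
      mps_subst H (case_sum (\<lambda>j. mps_subst (P j) ?\<tau>) (\<lambda>j. mps_subst (Q j) ?\<tau>))"
    if "cfree P" "cfree Q" for H :: "('n + 'n, 'a) mps" and P Q :: "'n \<Rightarrow> (('n + 'n) + 'n, 'a) mps"
    using cfree_case_sum[OF that] by (simp add: subst_subst case_sum_o[of "\<lambda>f. mps_subst f ?\<tau>"])
  have app: "fgl_app G A' B' = (\<lambda>j. mps_rename Inl (fgl_app G A B j))"
    using A B by (simp add: fun_eq_iff mps_rename_def subst_app mord_var A'_def B'_def)
  have "mps_deriv (Inr i) (fgl_app G (fgl_app G A' B') C l) =
      mps_subst (mps_deriv (Inr i) (G l)) (case_sum (fgl_app G A' B') C)"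
    by (intro deriv_app_unit cfree_app cf allI dC) (simp add: app mps_deriv_rename_0 image_iff)
  hence "ev0 (mps_deriv (Inr i) (fgl_app G (fgl_app G A' B') C l)) =
      mps_subst (mps_deriv (Inr i) (G l)) (case_sum (fgl_app G A B) (\<lambda>_. 0))"
    by (simp add: sub[OF cfree_app[OF cf(1,2)] cf(3)] \<tau>) (simp add: app ev0_rename_Inl)
  also have "\<dots> = mps_subst (frame i l) (fgl_app G A B)"
    by (simp add: subst_frame cfree_app A B)
  finally have left: "ev0 (mps_deriv (Inr i) (fgl_app G (fgl_app G A' B') C l)) = mps_subst (frame i l) (fgl_app G A B)" .
  have dE: "mps_deriv (Inr i) (fgl_app G B' C j) = mps_subst (mps_deriv (Inr i) (G j)) (case_sum B' C)" for j
    by (intro deriv_app_unit cf dA dC)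
  have evE: "(\<lambda>j. mps_subst (fgl_app G B' C j) ?\<tau>) = B"
    by (simp add: subst_app cf \<tau> app_0_right B)
  \<comment> \<open>In the other bracketing the new variable is reached through the inner product,
    and the chain rule produces the sum over \<open>j\<close> that makes up
    \<open>ldiff Inr i\<close>.\<close>
  have "ev0 (mps_deriv (Inr i) (fgl_app G A' (fgl_app G B' C) l)) =
      (\<Sum>j\<in>UNIV. mps_subst (mps_deriv (Inr j) (G l)) (case_sum A B) * mps_subst (frame i j) B)"
    unfolding deriv_app[OF cf(1) cfree_app[OF cf(2,3)] dA(1)] dE ev0_sum
    by (simp add: subst_mult sub[OF cf(1) cfree_app[OF cf(2,3)]] sub[OF cf(2,3)] \<tau> evE subst_frame B)
  also have "\<dots> = (\<Sum>j\<in>UNIV. mps_rename Inr (frame i j) * mps_deriv (Inr j) (fgl_app G A B l))"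
  proof (intro sum.cong refl)
    fix j
    have "mps_deriv (Inr j) (fgl_app G A B l) = mps_subst (mps_deriv (Inr j) (G l)) (case_sum A B)"
      by (rule deriv_app_unit[OF A(1) B A(2)]) (simp add: B_def mps_deriv_var)
    thus "mps_subst (mps_deriv (Inr j) (G l)) (case_sum A B) * mps_subst (frame i j) B =
        mps_rename Inr (frame i j) * mps_deriv (Inr j) (fgl_app G A B l)"
      by (simp add: mps_rename_def B_def)
  qed
  finally show ?thesis
    using left app_assoc[OF cf] by (simp add: ldiff_def)
qed

text \<open>\<open>A\<close> may be any point that does not involve the second block. It will be the
  generic first block for the coproduct and \<open>s(X)\<close> for the antipode.\<close>

lemma ldiff_app:
  fixes A :: "'n \<Rightarrow> ('n + 'n, 'a) mps"
  assumes A: "cfree A" "\<And>j v. mps_deriv (Inr v) (A j) = 0"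
  shows "ldiff Inr i (mps_subst f (fgl_app G A (\<lambda>j. mps_var (Inr j)))) =
    mps_subst (ldiff (\<lambda>j. j) i f) (fgl_app G A (\<lambda>j. mps_var (Inr j)))"
proof -
  let ?\<sigma> = "fgl_app G A (\<lambda>j. mps_var (Inr j))"
  have \<sigma>: "cfree ?\<sigma>" by (intro cfree_app A) (simp add: mord_var)
  hence adm: "adm ?\<sigma>" by simp
  have "ldiff Inr i (mps_subst f ?\<sigma>) =
      (\<Sum>j\<in>UNIV. \<Sum>l\<in>UNIV. mps_subst (mps_deriv l f) ?\<sigma> * (mps_rename Inr (frame i j) * mps_deriv (Inr j) (?\<sigma> l)))"
    using \<sigma> by (simp add: ldiff_def chain_rule sum_distrib_left mult_ac)
  also have "\<dots> = (\<Sum>l\<in>UNIV. mps_subst (mps_deriv l f) ?\<sigma> * ldiff Inr i (?\<sigma> l))"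
    by (subst sum.swap) (simp add: ldiff_def sum_distrib_left)
  also have "\<dots> = mps_subst (ldiff (\<lambda>j. j) i f) ?\<sigma>"
    unfolding ldiff_app_coord[OF A] by (simp add: ldiff_def subst_sum[OF adm] subst_mult[OF adm] subst_rename[OF adm] mult.commute)
  finally show ?thesis .
qed

lemma ldiffs_app:
  fixes A :: "'n \<Rightarrow> ('n + 'n, 'a) mps"
  assumes "cfree A" "\<And>j v. mps_deriv (Inr v) (A j) = 0"
  shows "ldiffs Inr w (mps_subst f (fgl_app G A (\<lambda>j. mps_var (Inr j)))) =
    mps_subst (ldiffs (\<lambda>j. j) w f) (fgl_app G A (\<lambda>j. mps_var (Inr j)))"
  by (induction w) (simp_all add: ldiff_app[OF assms])

lemma mult_group: "fgl_app G (\<lambda>j. mps_var (Inl j)) (\<lambda>j. mps_var (Inr j)) = G"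
proof
  fix j
  have "case_sum (\<lambda>j. mps_var (Inl j)) (\<lambda>j. mps_var (Inr j)) = (mps_var :: 'n + 'n \<Rightarrow> ('n + 'n, 'a) mps)"
    by (auto split: sum.split)
  thus "fgl_app G (\<lambda>j. mps_var (Inl j)) (\<lambda>j. mps_var (Inr j)) j = G j"
    by (simp add: fgl_app_def subst_id)
qed

lemma ldiffs_comult: "ldiffs Inr w (mps_subst f G) = mps_subst (ldiffs (\<lambda>j. j) w f) G"
  using ldiffs_app[of "\<lambda>j. mps_var (Inl j)" w f] by (simp add: mult_group mord_var mps_deriv_var)

lemma ev0_app:
  fixes A :: "'n \<Rightarrow> ('n, 'a) mps"
  assumes "cfree A"
  shows "ev0 (mps_subst f (fgl_app G (\<lambda>j. mps_rename Inl (A j)) (\<lambda>j. mps_var (Inr j)))) = mps_subst f A"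
proof -
  have c: "cfree (\<lambda>j. mps_rename Inl (A j) :: ('n + 'n, 'a) mps)" "cfree (\<lambda>j. mps_var (Inr j) :: ('n + 'n, 'a) mps)"
    using assms by (simp_all add: mord_rename mord_var)
  have "(\<lambda>v. ev0 (fgl_app G (\<lambda>j. mps_rename Inl (A j)) (\<lambda>j. mps_var (Inr j)) v)) = A"
    using app_0_right[OF assms] by (simp add: subst_app[OF c] ev0_rename_Inl subst_var)
  thus ?thesis using cfree_app[OF c] by (simp add: subst_subst)
qed

lemma ev0_comult: "ev0 (mps_subst f G) = f"
  using ev0_app[of mps_var f] by (simp add: rename_hom mult_group mord_var subst_id)

text \<open>Left invariance moves the operators of \<open>v\<close> into the second block of
  \<open>f(G(X, Y))\<close>; setting this block to 0 recovers an operator on \<open>f\<close>. This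
  is the duality between concatenation of words and the group law.\<close>

lemma mcoeff_ldiffs_append:
  "mcoeff (ldiffs (\<lambda>j. j) (u @ v) f) 0 = mcoeff (ldiffs Inl u (ldiffs Inr v (mps_subst f G))) 0"
proof -
  have "mcoeff (ldiffs Inl u (ldiffs Inr v (mps_subst f G))) 0 = mcoeff (ev0 (ldiffs Inl u (mps_subst (ldiffs (\<lambda>j. j) v f) G))) 0"
    by (simp add: ldiffs_comult)
  thus ?thesis by (simp add: ev0_ldiffs_Inl ev0_comult)
qed

lemma mcoeff_G_lin: "mcoeff (G j) (Poly_Mapping.single (Inr i) 1) = (if i = j then 1 else 0)"
proof -
  have "mcoeff (G j - mps_var (Inl j) - mps_var (Inr j)) (Poly_Mapping.single (Inr i) 1) = 0"
    by (rule mordD[OF G_lin]) simp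
  moreover have "Poly_Mapping.single (Inr i) (Suc 0) = (Poly_Mapping.single u (Suc 0) :: ('n + 'n) mono) \<longleftrightarrow> u = Inr i" for u
    by (metis lookup_single_eq lookup_single_not_eq nat.distinct(1))
  ultimately show ?thesis by (auto simp: mcoeff_var)
qed

lemma mcoeff_frame_0: "mcoeff (frame i j) 0 = (if i = j then 1 else 0)"
  using mcoeff_G_lin[of j i] by (simp add: frame_def mcoeff_deriv)

lemma mcoeff_deriv_frame_0: "mcoeff (mps_deriv l (frame k j)) 0 = fgl_gamma G j l k"
  by (simp add: frame_def deriv_ev0 mcoeff_deriv lookup_single fgl_gamma_def)

lemma ev0_ldiff_Inr: "ev0 (ldiff Inr i F) = ev0 (mps_deriv (Inr i) F)"
proof -
  have "ev0 (ldiff Inr i F) = (\<Sum>j\<in>UNIV. if i = j then ev0 (mps_deriv (Inr i) F) else 0)"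
    unfolding ldiff_def ev0_sum by (intro sum.cong refl) (auto simp: subst_mult ev0_rename_Inr mcoeff_frame_0)
  thus ?thesis by simp
qed

text \<open>\<open>D_l D_k f\<close> differs from the second partial derivative of
  \<open>f(G(X, Y))\<close> in \<open>Y_l\<close>, \<open>Y_k\<close> at \<open>Y = 0\<close> only
  by a first order term with coefficients \<open>\<gamma>\<close>, the linear part of
  \<open>frame\<close>. The second partials are symmetric and cancel.\<close>

lemma ldiff_bracket:
  "ldiff (\<lambda>j. j) l (ldiff (\<lambda>j. j) k f) - ldiff (\<lambda>j. j) k (ldiff (\<lambda>j. j) l f) =
    (\<Sum>j\<in>UNIV. mps_const (fgl_gamma G j l k - fgl_gamma G j k l) * ldiff (\<lambda>j. j) j f)"
proof -
  let ?F = "mps_subst f G"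
  have ev: "ldiffs (\<lambda>j. j) w f = ev0 (ldiffs Inr w ?F)" for w
    by (simp add: ldiffs_comult ev0_comult)
  have two: "ldiff (\<lambda>j. j) l (ldiff (\<lambda>j. j) k f) =
      (\<Sum>j\<in>UNIV. mps_const (fgl_gamma G j l k) * ldiff (\<lambda>j. j) j f) + ev0 (mps_deriv (Inr l) (mps_deriv (Inr k) ?F))" for l k
  proof -
    have "ldiff (\<lambda>j. j) l (ldiff (\<lambda>j. j) k f) = ev0 (mps_deriv (Inr l) (ldiff Inr k ?F))"
      using ev[of "[l, k]"] by (simp add: ev0_ldiff_Inr)
    also have "\<dots> = (\<Sum>j\<in>UNIV. mps_const (fgl_gamma G j l k) * ev0 (mps_deriv (Inr j) ?F)
        + (if k = j then ev0 (mps_deriv (Inr l) (mps_deriv (Inr k) ?F)) else 0))"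
      unfolding ldiff_def mps_deriv_sum ev0_sum
      by (intro sum.cong refl)
        (auto simp: mps_deriv_mult subst_add subst_mult ev0_rename_Inr mcoeff_frame_0 mps_deriv_rename mcoeff_deriv_frame_0)
    also have "\<dots> = (\<Sum>j\<in>UNIV. mps_const (fgl_gamma G j l k) * ldiff (\<lambda>j. j) j f) + ev0 (mps_deriv (Inr l) (mps_deriv (Inr k) ?F))"
      using ev[of "[_]"] by (simp add: sum.distrib ev0_ldiff_Inr)
    finally show ?thesis .
  qed
  have m: "mps_const (a - b) * (x :: ('n, 'a) mps) = mps_const a * x - mps_const b * x" for a b x
    by (rule mps_eqI) (simp only: mcoeff_const_mult mcoeff_diff left_diff_distrib)
  show ?thesis
    unfolding m sum_subtractf two[of l k] two[of k l] by (simp add: mps_deriv_commute[of "Inr l"])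
qed

lemma ldiff_lead: "mord (Suc k) f \<Longrightarrow> mord (Suc k) (ldiff (\<lambda>j. j) i f - mps_deriv i f)"
proof -
  assume f: "mord (Suc k) f"
  have "mps_deriv i f = (\<Sum>j\<in>UNIV. if i = j then mps_deriv j f else 0)" by simp
  hence "ldiff (\<lambda>j. j) i f - mps_deriv i f = (\<Sum>j\<in>UNIV. (frame i j - (if i = j then 1 else 0)) * mps_deriv j f)"
    unfolding ldiff_def by (simp only: sum_subtractf[symmetric])
      (intro sum.cong refl, auto simp: mps_rename_def subst_id algebra_simps)
  moreover have "mord (Suc 0 + k) ((frame i j - (if i = j then 1 else 0)) * mps_deriv j f)" for j
    by (intro mord_mult mord_deriv f) (auto simp: mord_1_iff mcoeff_frame_0 mcoeff_1)
  ultimately show ?thesis by (simp add: mord_sum)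
qed

text \<open>Each operator lowers the order by one, but its deviation from the partial derivative
  does not, so the leading forms agree.\<close>

lemma ldiffs_lead: "mord (k + length w) f \<Longrightarrow> mord (Suc k) (ldiffs (\<lambda>j. j) w f - foldr mps_deriv w f)"
proof (induction w arbitrary: k)
  case (Cons i w)
  let ?g = "ldiffs (\<lambda>j. j) w f" and ?h = "foldr mps_deriv w f"
  have "mord (Suc k) (ldiff (\<lambda>j. j) i ?g - mps_deriv i ?g)"
    using Cons.prems by (intro ldiff_lead mord_ldiffs) simp
  moreover have "mord (Suc k) (mps_deriv i (?g - ?h))"
    using Cons by (intro mord_deriv) simp
  moreover have "mps_deriv i (?g - ?h) = mps_deriv i ?g - mps_deriv i ?h"
    using mps_deriv_add[of i "?g - ?h" ?h] by (simp add: algebra_simps)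
  ultimately show ?case using mord_add by fastforce
qed simp

lemma mcoeff_ldiffs_lead:
  assumes "mord (length w) f"
  shows "mcoeff (ldiffs (\<lambda>j. j) w f) 0 = of_nat (mono_fact (wmono w)) * mcoeff f (wmono w)"
  using ldiffs_lead[of 0 w f] assms by (simp add: mord_1_iff mcoeff_derivs_0)

lemma mcoeff_ldiffs_eq_0: "mord (Suc (length w)) f \<Longrightarrow> mcoeff (ldiffs \<rho> w f) 0 = 0"
  using mord_ldiffs[of "Suc 0" w f] by (simp add: mord_1_iff)

end


section \<open>The inverse and the iterated group law\<close>

text \<open>Complementary pairs of subsequences, with multiplicity: the terms of the iterated
  Leibniz rule, or of the coproduct of a product of primitive elements.\<close>

fun splits :: "'n list \<Rightarrow> ('n list \<times> 'n list) list" where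
  "splits [] = [([], [])]"
| "splits (i # w) = map (\<lambda>(u, v). (i # u, v)) (splits w) @ map (\<lambda>(u, v). (u, i # v)) (splits w)"

text \<open>Isolates the one term in which the whole word acts on the first factor, so that the
  recursion for the inverse can be solved for it.\<close>

lemma splits_hd: "\<exists>r. splits w = (w, []) # r \<and> (\<forall>(u, v)\<in>set r. length u < length w)"
proof (induction w)
  case (Cons i w)
  then obtain r where r: "splits w = (w, []) # r" "\<forall>(u, v)\<in>set r. length u < length w" by blast
  show ?case by (rule exI[of _ "map (\<lambda>(u, v). (i # u, v)) r @ map (\<lambda>(u, v). (u, i # v)) (splits w)"])
    (use r in \<open>auto simp: less_Suc_eq\<close>)
qed simp

context formal_group
begin

lemma ldiffs_diag:
  "ldiffs (\<lambda>j. j) w (mps_subst F (case_sum mps_var mps_var)) =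
    (\<Sum>(u, v)\<leftarrow>splits w. mps_subst (ldiffs Inl u (ldiffs Inr v F)) (case_sum mps_var mps_var))"
proof (induction w)
  case (Cons i w)
  have adm: "adm (case_sum mps_var mps_var :: 'n + 'n \<Rightarrow> ('n, 'a) mps)"
    by simp
  have sum: "ldiff (\<lambda>j. j) i (sum_list xs) = (\<Sum>x\<leftarrow>xs. ldiff (\<lambda>j. j) i x)" for xs
    by (induction xs) (auto simp: ldiff_add)
  show ?case
    by (simp add: Cons sum o_def case_prod_unfold ldiff_diag subst_add[OF adm] ldiffs_commute sum_list_addf)
qed simp

text \<open>The first letter \<open>i\<close> goes to \<open>u\<close> or to \<open>v\<close>. Both
  choices give the same word, since \<open>rev (i # u) @ v = rev u @ i # v\<close>, but with
  opposite signs.\<close>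

lemma splits_telescope:
  "w \<noteq> [] \<Longrightarrow> (\<Sum>(u, v)\<leftarrow>splits w. (- 1) ^ length u * mcoeff (ldiffs (\<lambda>j. j) (rev u @ v) f) 0) = 0"
  by (cases w) (simp_all add: o_def case_prod_unfold flip: sum_list_addf)

text \<open>
  Expanding \<open>f(G(s(\<^bold>X), \<^bold>X)) = f(0)\<close> with the Leibniz rule expresses the pairing of \<open>f \<circ> s\<close> with a word
  through shorter words; the signed reversed words satisfy the same recursion.
\<close>
lemma mcoeff_ldiffs_inverse:
  fixes s :: "'n \<Rightarrow> ('n, 'a) mps"
  assumes s: "cfree s" "fgl_app G s mps_var = (\<lambda>_. 0)"
  shows "mcoeff (ldiffs (\<lambda>j. j) w (mps_subst f s)) 0 = (- 1) ^ length w * mcoeff (ldiffs (\<lambda>j. j) (rev w) f) 0"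
proof (induction "length w" arbitrary: w f rule: less_induct)
  case less
  let ?P = "\<lambda>w f. mcoeff (ldiffs (\<lambda>j. j) w f) 0"
  have adm: "adm s" using s by simp
  show ?case
  proof (cases "w = []")
    case True
    thus ?thesis using adm by simp
  next
    case False
    let ?A = "\<lambda>j. mps_rename Inl (s j) :: ('n + 'n, 'a) mps"
    let ?B = "\<lambda>j. mps_var (Inr j) :: ('n + 'n, 'a) mps"
    let ?d = "case_sum mps_var mps_var :: 'n + 'n \<Rightarrow> ('n, 'a) mps"
    let ?F = "\<lambda>f. mps_subst f (fgl_app G ?A ?B)"
    have c: "cfree ?A" "cfree ?B" using s by (simp_all add: mord_rename)
    have "(\<lambda>v. mps_subst (fgl_app G ?A ?B v) ?d) = (\<lambda>_. 0)"
      using s by (simp add: fun_eq_iff subst_app c subst_rename subst_id subst_var)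
    hence "mps_subst (?F f) ?d = mps_const (mcoeff f 0)"
      using cfree_app[OF c] by (simp add: subst_subst subst_zero)
    moreover have "ldiffs (\<lambda>j. j) w (mps_const c) = 0" for c
      using False by (induction w rule: rev_induct) simp_all
    ultimately have "0 = mcoeff (\<Sum>(u, v)\<leftarrow>splits w. mps_subst (ldiffs Inl u (ldiffs Inr v (?F f))) ?d) 0"
      by (simp flip: ldiffs_diag)
    \<comment> \<open>Left invariance lets the letters of \<open>v\<close> act on \<open>f\<close>
      itself. At the origin the second block may then be set to 0, which leaves the letters of
      \<open>u\<close> acting on a composite with \<open>s\<close>.\<close>
    also have "\<dots> = (\<Sum>(u, v)\<leftarrow>splits w. ?P u (mps_subst (ldiffs (\<lambda>j. j) v f) s))"
    proof -
      have "mcoeff (mps_subst (ldiffs Inl u (ldiffs Inr v (?F f))) ?d) 0 = ?P u (mps_subst (ldiffs (\<lambda>j. j) v f) s)" for u v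
      proof -
        have "mcoeff (mps_subst (ldiffs Inl u (ldiffs Inr v (?F f))) ?d) 0 = mcoeff (ldiffs Inl u (ldiffs Inr v (?F f))) 0"
          by simp
        also have "\<dots> = mcoeff (ev0 (ldiffs Inl u (?F (ldiffs (\<lambda>j. j) v f)))) 0"
          by (simp add: ldiffs_app[OF c(1)] mps_deriv_rename_0 image_iff)
        also have "\<dots> = ?P u (mps_subst (ldiffs (\<lambda>j. j) v f) s)"
          by (simp add: ev0_ldiffs_Inl ev0_app[OF s(1)])
        finally show ?thesis .
      qed
      moreover have "mcoeff (sum_list xs) 0 = (\<Sum>x\<leftarrow>xs. mcoeff x 0)" for xs :: "('n, 'a) mps list"
        by (induction xs) auto
      ultimately show ?thesis by (simp add: o_def case_prod_unfold)
    qed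
    finally have rec: "(\<Sum>(u, v)\<leftarrow>splits w. ?P u (mps_subst (ldiffs (\<lambda>j. j) v f) s)) = 0" by simp
    obtain r where r: "splits w = (w, []) # r" "\<forall>(u, v)\<in>set r. length u < length w"
      using splits_hd by blast
    \<comment> \<open>Every \<open>u\<close> in \<open>r\<close> is shorter than \<open>w\<close>;
      the induction hypothesis is applied to the function obtained from \<open>f\<close> by the
      letters of \<open>v\<close>.\<close>
    have "(\<Sum>(u, v)\<leftarrow>r. ?P u (mps_subst (ldiffs (\<lambda>j. j) v f) s)) = (\<Sum>(u, v)\<leftarrow>r. (- 1) ^ length u * ?P (rev u @ v) f)"
      using r(2) less by (intro arg_cong[of _ _ sum_list] map_cong) auto
    moreover have "?P w (mps_subst f s) + (\<Sum>(u, v)\<leftarrow>r. ?P u (mps_subst (ldiffs (\<lambda>j. j) v f) s)) = 0"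
      using rec by (simp add: r(1))
    moreover have "(- 1) ^ length w * ?P (rev w) f + (\<Sum>(u, v)\<leftarrow>r. (- 1) ^ length u * ?P (rev u @ v) f) = 0"
      using splits_telescope[OF False, of f] by (simp add: r(1))
    ultimately have "?P w (mps_subst f s) + (\<Sum>(u, v)\<leftarrow>r. (- 1) ^ length u * ?P (rev u @ v) f) =
        (- 1) ^ length w * ?P (rev w) f + (\<Sum>(u, v)\<leftarrow>r. (- 1) ^ length u * ?P (rev u @ v) f)"
      by (simp only:)
    thus ?thesis by (rule add_right_imp_eq)
  qed
qed

text \<open>The unit law absorbs the special case of length 1 and leaves one uniform
  recursion.\<close>

lemma fgl_iter_Suc: "fgl_iter G (Suc k) = fgl_app G (fgl_iter G k) (var_block k)"
  by (cases k) (simp_all add: app_0_left cfree_var_block)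

lemma cfree_iter: "cfree (fgl_iter G k)"
proof (induction k)
  case (Suc k)
  thus ?case unfolding fgl_iter_Suc by (intro cfree_app cfree_var_block)
qed simp

lemma deriv_iter: "k \<le> b \<Longrightarrow> mps_deriv (b, i) (fgl_iter G k j) = 0"
proof (induction k arbitrary: j)
  case (Suc k)
  have "mps_deriv (b, i) (fgl_app G (fgl_iter G k) (var_block k) j) = 0"
    by (subst deriv_app[OF cfree_iter cfree_var_block]) (use Suc in \<open>simp_all add: var_block_def mps_deriv_var\<close>)
  thus ?case by (simp only: fgl_iter_Suc)
qed simp

abbreviation restr_vars :: "nat \<Rightarrow> nat \<times> 'n \<Rightarrow> (nat \<times> 'n, 'a) mps" where
  "restr_vars k \<equiv> \<lambda>v. if fst v < k then mps_var v else 0"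

lemma adm_restr: "adm (restr_vars k)"
proof -
  have "{v. restr_vars k v \<noteq> 0} \<subseteq> {..<k} \<times> UNIV" by auto
  hence "finite {v. restr_vars k v \<noteq> 0}" by (rule finite_subset) simp
  thus ?thesis by (simp add: adm_def)
qed

lemma subst_iter_restr: "l \<le> k \<Longrightarrow> mps_subst (fgl_iter G l j) (restr_vars k) = fgl_iter G l j"
proof (induction l arbitrary: j)
  case (Suc l)
  hence "(\<lambda>j. mps_subst (fgl_iter G l j) (restr_vars k)) = fgl_iter G l" by auto
  moreover have "(\<lambda>j. mps_subst (var_block l j) (restr_vars k)) = var_block l"
    using Suc.prems by (simp add: var_block_def subst_var[OF adm_restr])
  ultimately show ?case
    unfolding fgl_iter_Suc by (simp add: subst_app[OF cfree_iter cfree_var_block adm_restr])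
qed simp

lemma mcoeff_subst_restr:
  assumes "Poly_Mapping.keys m \<subseteq> {v. fst v < k}"
  shows "mcoeff (mps_subst H (restr_vars k)) m = mcoeff H m"
proof -
  let ?S = "subst_supp (restr_vars k) (mono_deg m)"
  have nz: "mps_var v \<noteq> (0 :: (nat \<times> 'n, 'a) mps)" for v
    by (metis mcoeff_0 mcoeff_var zero_neq_one)
  have pw: "mpow (restr_vars k) j = mmono j" if "Poly_Mapping.keys j \<subseteq> {v. fst v < k}" for j
    unfolding mpow_var[symmetric] unfolding mpow_def using that by (intro prod.cong) auto
  have sub: "Poly_Mapping.keys j \<subseteq> {v. fst v < k}" if "j \<in> ?S" for j
    using that by (auto simp: subst_supp_def split: if_splits)
  have "mcoeff (mps_subst H (restr_vars k)) m = (\<Sum>j\<in>?S. if j = m then mcoeff H m else 0)"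
    unfolding mcoeff_subst[OF adm_restr order_refl]
    by (intro sum.cong refl) (auto simp: pw[OF sub] mcoeff_mmono)
  moreover have "m \<in> ?S" using assms nz by (auto simp: subst_supp_def)
  ultimately show ?thesis by (simp add: finite_subst_supp[OF adm_restr])
qed

lemma keys_wmono: "Poly_Mapping.keys (wmono w) = set w"
proof (induction w)
  case (Cons v w)
  thus ?case by (auto simp: in_keys_iff lookup_add lookup_single when_def set_eq_iff)
qed simp

text \<open>The pairing of the comparison map, computed from the last letter to the first.\<close>
lemma mcoeff_derivs_iter:
  "mcoeff (foldr mps_deriv (List.enumerate 0 w) (mps_subst f (fgl_iter G (length w)))) 0 =
    mcoeff (ldiffs (\<lambda>j. j) w f) 0"
proof (induction w arbitrary: f rule: rev_induct)
  case Nil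
  show ?case by (simp add: subst_zero mcoeff_const)
next
  case (snoc i w)
  let ?k = "length w" and ?P = "mps_subst f G"
  let ?F = "mps_subst f (fgl_iter G (Suc ?k))"
  let ?c = "case_sum (fgl_iter G ?k) (var_block ?k)"
  have cc: "cfree ?c" by (intro cfree_case_sum cfree_iter cfree_var_block)
  hence ac: "adm ?c" by simp
  have F: "?F = mps_subst ?P ?c"
    unfolding fgl_iter_Suc fgl_app_def using cfree_G ac by (simp add: subst_subst)
  \<comment> \<open>The last block enters only through the outermost factor. Differentiating in it
    and then setting it to 0 turns \<open>f\<close> into \<open>ldiff (\<lambda>j. j) i f\<close>,
    composed with the shorter iterated law.\<close>
  have "mps_deriv (?k, i) ?F = (\<Sum>j\<in>UNIV. if j = i then mps_subst (mps_deriv (Inr j) ?P) ?c else 0)"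
    unfolding F chain_rule[OF cc] sum_UNIV_Plus
    by (simp add: deriv_iter var_block_def mps_deriv_var if_distrib cong: if_cong)
  hence "mps_subst (mps_deriv (?k, i) ?F) (restr_vars ?k) = mps_subst (mps_subst (mps_deriv (Inr i) ?P) ?c) (restr_vars ?k)"
    by simp
  also have "\<dots> = mps_subst (mps_deriv (Inr i) ?P) (case_sum (fgl_iter G ?k) (\<lambda>_. 0))"
    using cc by (simp add: subst_subst adm_restr case_sum_o[of "\<lambda>f. mps_subst f (restr_vars ?k)"]
      subst_iter_restr var_block_def subst_var)
  also have "\<dots> = mps_subst (ev0 (mps_deriv (Inr i) ?P)) (fgl_iter G ?k)"
    using cfree_iter[of ?k] by (simp add: subst_subst case_sum_o[of "\<lambda>f. mps_subst f (fgl_iter G ?k)"] subst_var)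
  also have "ev0 (mps_deriv (Inr i) ?P) = ldiff (\<lambda>j. j) i f"
    using ldiffs_comult[of "[i]" f] by (simp add: ev0_comult flip: ev0_ldiff_Inr)
  finally have res: "mps_subst (mps_deriv (?k, i) ?F) (restr_vars ?k) = mps_subst (ldiff (\<lambda>j. j) i f) (fgl_iter G ?k)" .
  \<comment> \<open>The remaining derivatives concern earlier blocks only, so setting the last block
    to 0 beforehand does not change their value at the origin.\<close>
  have "Poly_Mapping.keys (wmono (List.enumerate 0 w)) \<subseteq> {v. fst v < ?k}"
    by (auto simp: keys_wmono in_set_enumerate_eq)
  from mcoeff_subst_restr[OF this]
  have "mcoeff (foldr mps_deriv (List.enumerate 0 w) H) 0 =
      mcoeff (foldr mps_deriv (List.enumerate 0 w) (mps_subst H (restr_vars ?k))) 0" for H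
    by (simp add: mcoeff_derivs_0)
  from this[of "mps_deriv (?k, i) ?F"] show ?case
    using snoc[of "ldiff (\<lambda>j. j) i f"] res by (simp add: enumerate_append_eq del: fgl_iter.simps)
qed

end


section \<open>Linear extensions\<close>

lemma poly_mapping_sum: "z = (\<Sum>w\<in>Poly_Mapping.keys z. Poly_Mapping.single w (Poly_Mapping.lookup z w))"
  by (rule poly_mapping_eqI)
    (auto simp: lookup_sum lookup_single when_def in_keys_iff if_distrib cong: if_cong)

text \<open>The added indices stay among the keys of the fixed element \<open>z0\<close>, so that
  support conditions survive the induction.\<close>

lemma poly_mapping_induct_add [case_names zero add]:
  assumes "P 0" "\<And>w r z. P z \<Longrightarrow> w \<in> Poly_Mapping.keys z0 \<Longrightarrow> P (Poly_Mapping.single w r + z)"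
  shows "P (z0 :: 'w \<Rightarrow>\<^sub>0 'a::comm_monoid_add)"
proof -
  have "P (\<Sum>w\<in>A. Poly_Mapping.single w (Poly_Mapping.lookup z0 w))" if "A \<subseteq> Poly_Mapping.keys z0" for A
    using finite_subset[OF that finite_keys] that by (induction A rule: finite_induct) (auto intro: assms)
  from this[OF order_refl] show ?thesis by (simp flip: poly_mapping_sum)
qed

lemma lookup_map_times: "Poly_Mapping.lookup (Poly_Mapping.map ((*) r) z) w = r * Poly_Mapping.lookup (z :: 'w \<Rightarrow>\<^sub>0 'a::comm_ring_1) w"
  by (auto simp: Poly_Mapping.map.rep_eq when_def in_keys_iff)

lemma map_times_single: "Poly_Mapping.map ((*) r) (Poly_Mapping.single p s) = Poly_Mapping.single p (r * s :: 'a::comm_ring_1)"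
  by (rule poly_mapping_eqI) (simp add: lookup_map_times lookup_single when_def)

global_interpretation pm: module "\<lambda>r :: 'a::comm_ring_1. Poly_Mapping.map ((*) r) :: ('w \<Rightarrow>\<^sub>0 'a) \<Rightarrow> 'w \<Rightarrow>\<^sub>0 'a"
  by unfold_locales (rule poly_mapping_eqI; simp add: lookup_map_times lookup_add algebra_simps)+

lemma lin_ext_superset:
  assumes "finite A" "Poly_Mapping.keys z \<subseteq> A"
  shows "lin_ext c z = (\<Sum>w\<in>A. Poly_Mapping.lookup z w * c w)"
  unfolding lin_ext_def using assms by (intro sum.mono_neutral_left) (auto simp: in_keys_iff)

lemma lin_ext_add: "lin_ext c (y + z) = lin_ext c y + lin_ext c z"
proof -
  let ?A = "Poly_Mapping.keys y \<union> Poly_Mapping.keys z"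
  have "lin_ext c x = (\<Sum>w\<in>?A. Poly_Mapping.lookup x w * c w)" if "Poly_Mapping.keys x \<subseteq> ?A" for x
    by (rule lin_ext_superset) (use that in auto)
  thus ?thesis using Poly_Mapping.keys_add[of y z] by (simp add: lookup_add algebra_simps sum.distrib)
qed

lemma lin_ext_scale: "lin_ext c (Poly_Mapping.map ((*) r) z) = r * lin_ext c z"
proof -
  have "Poly_Mapping.keys (Poly_Mapping.map ((*) r) z) \<subseteq> Poly_Mapping.keys z"
    by (auto simp: in_keys_iff lookup_map_times)
  thus ?thesis by (simp add: lin_ext_superset[of "Poly_Mapping.keys z"] lookup_map_times sum_distrib_left mult.assoc)
qed

lemma lin_ext_0 [simp]: "lin_ext c 0 = 0" by (simp add: lin_ext_def)

lemma lin_ext_single [simp]: "lin_ext c (Poly_Mapping.single w r) = r * c w"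
  by (cases "r = 0") (simp_all add: lin_ext_def)

lemma lin_ext_uminus: "lin_ext c (- z) = - lin_ext c z"
  using lin_ext_add[of c z "- z"] by (simp add: eq_neg_iff_add_eq_0 add.commute)

lemma lin_ext_diff: "lin_ext c (y - z) = lin_ext c y - lin_ext c z"
  using lin_ext_add[of c y "- z"] by (simp add: lin_ext_uminus)

lemma lin_ext_sum: "lin_ext c (sum f A) = (\<Sum>x\<in>A. lin_ext c (f x))"
  by (induction A rule: infinite_finite_induct) (auto simp: lin_ext_add)


section \<open>Modules with a topological basis\<close>

text \<open>\<open>M\<close> is the product of copies of the ground ring indexed by \<open>'i\<close>, filtered by the degree \<open>d\<close>.\<close>
locale coord_module = module "scl M"
  for M :: "('a::comm_ring_1, 'h::ab_group_add) filtered_module" +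
  fixes d :: "'i \<Rightarrow> nat" and c :: "'h \<Rightarrow> 'i \<Rightarrow> 'a"
  assumes subspace_pts: "subspace (pts M)"
    and c_add: "x \<in> pts M \<Longrightarrow> y \<in> pts M \<Longrightarrow> c (x + y) i = c x i + c y i"
    and c_scl: "x \<in> pts M \<Longrightarrow> c (scl M r x) i = r * c x i"
    and bij_c: "bij_betw c (pts M) UNIV"
    and fil_iff: "x \<in> fil M k \<longleftrightarrow> x \<in> pts M \<and> (\<forall>i. d i < k \<longrightarrow> c x i = 0)"
    and finite_deg: "finite {i. d i \<le> n}"
begin

lemmas pts_add = subspace_add[OF subspace_pts]
  and pts_scl = subspace_scale[OF subspace_pts]
  and pts_0 = subspace_0[OF subspace_pts]
  and pts_diff = subspace_diff[OF subspace_pts]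
  and pts_sum = subspace_sum[OF subspace_pts]

definition of_coord :: "('i \<Rightarrow> 'a) \<Rightarrow> 'h" where
  "of_coord = inv_into (pts M) c"

lemma of_coord_pts [simp]: "of_coord x \<in> pts M"
  unfolding of_coord_def using bij_c by (metis UNIV_I bij_betw_def inv_into_into)

lemma c_of_coord [simp]: "c (of_coord x) = x"
  unfolding of_coord_def using bij_c by (metis UNIV_I bij_betw_def f_inv_into_f)

lemma coord_eqI: "x \<in> pts M \<Longrightarrow> y \<in> pts M \<Longrightarrow> (\<And>i. c x i = c y i) \<Longrightarrow> x = y"
  using bij_c by (metis bij_betw_def ext inj_onD)

lemma c_0 [simp]: "c 0 i = 0"
  using c_add[OF pts_0 pts_0] by simp

lemma c_diff: "x \<in> pts M \<Longrightarrow> y \<in> pts M \<Longrightarrow> c (x - y) i = c x i - c y i"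
  using c_add[of "x - y" y i] pts_diff by (simp add: algebra_simps)

lemma c_sum: "(\<And>x. x \<in> A \<Longrightarrow> f x \<in> pts M) \<Longrightarrow> c (sum f A) i = (\<Sum>x\<in>A. c (f x) i)"
  by (induction A rule: infinite_finite_induct) (auto simp: c_add pts_sum)

lemma fil_pts: "x \<in> fil M k \<Longrightarrow> x \<in> pts M"
  using fil_iff by blast

lemma filI: "x \<in> pts M \<Longrightarrow> (\<And>i. d i < k \<Longrightarrow> c x i = 0) \<Longrightarrow> x \<in> fil M k"
  using fil_iff by blast

lemma filD: "x \<in> fil M k \<Longrightarrow> d i < k \<Longrightarrow> c x i = 0"
  using fil_iff by blast

lemma subspace_fil: "subspace (fil M k)"
proof (rule subspaceI)
  show "0 \<in> fil M k" by (rule filI[OF pts_0]) simp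
  show "x + y \<in> fil M k" if "x \<in> fil M k" "y \<in> fil M k" for x y
    by (rule filI[OF pts_add[OF that[THEN fil_pts]]]) (simp add: c_add[OF that[THEN fil_pts]] filD[OF that(1)] filD[OF that(2)])
  show "scl M r x \<in> fil M k" if "x \<in> fil M k" for r x
    by (rule filI[OF pts_scl[OF that[THEN fil_pts]]]) (simp add: c_scl[OF that[THEN fil_pts]] filD[OF that])
qed

lemma fil_antimono: "k \<le> l \<Longrightarrow> fil M l \<subseteq> fil M k"
  by (rule subsetI, rule filI, erule fil_pts, erule filD, simp)

lemma finite_deg_less: "finite {i. d i < n}"
  by (rule finite_subset[OF _ finite_deg[of n]]) auto

lemma complete: "complete_module M"
  unfolding complete_module_def
proof (intro conjI allI impI)
  show "subspace (fil M i)" for i by (rule subspace_fil)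
  show "fil M (Suc i) \<subseteq> fil M i" for i by (rule fil_antimono) simp
  show "(\<Inter>i. fil M i) = {0}"
  proof (intro equalityI subsetI)
    fix x assume "x \<in> (\<Inter>i. fil M i)"
    hence x: "x \<in> fil M i" for i by blast
    have "x = 0" by (rule coord_eqI[OF x pts_0]) (use filD[OF x lessI] in simp)
    thus "x \<in> {0}" by simp
  qed (simp add: subspace_0[OF subspace_fil])
  fix x assume x: "\<forall>i. x i \<in> pts M \<and> x (Suc i) - x i \<in> fil M i"
  hence xp: "x i \<in> pts M" for i by blast
  have step: "x (n + k) - x n \<in> fil M n" for n k
  proof (induction k)
    case 0
    show ?case by (simp add: subspace_0[OF subspace_fil])
  next
    case (Suc k)
    have "x (Suc (n + k)) - x (n + k) \<in> fil M n"
      using x fil_antimono[of n "n + k"] by auto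
    from subspace_add[OF subspace_fil this Suc] show ?case by simp
  qed
  \<comment> \<open>Coordinate \<open>i\<close> of the sequence is constant from index
    \<open>d i + 1\<close> on, because later differences lie in that filtration step.\<close>
  define y where "y = of_coord (\<lambda>i. c (x (Suc (d i))) i)"
  have y: "y \<in> pts M" by (simp add: y_def)
  have "y - x n \<in> fil M n" for n
  proof (rule filI[OF pts_diff[OF y xp]])
    fix i assume "d i < n"
    hence n: "n = Suc (d i) + (n - Suc (d i))" by simp
    have "c (x (Suc (d i) + (n - Suc (d i))) - x (Suc (d i))) i = 0" by (rule filD[OF step]) simp
    hence "c (x n - x (Suc (d i))) i = 0" by (simp only: n[symmetric])
    thus "c (y - x n) i = 0" by (simp add: c_diff[OF y xp] c_diff[OF xp xp]) (simp add: y_def)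
  qed
  thus "\<exists>y\<in>pts M. \<forall>i. y - x i \<in> fil M i" using y by blast
qed (rule module_axioms)

definition basis :: "'i \<Rightarrow> 'h" where
  "basis i = of_coord (\<lambda>j. if j = i then 1 else 0)"

lemma basis_pts [simp]: "basis i \<in> pts M" by (simp add: basis_def)

lemma c_basis: "c (basis i) j = (if j = i then 1 else 0)" by (simp add: basis_def)

lemma basis_fil: "basis i \<in> fil M (d i)" by (rule filI) (auto simp: c_basis)

lemma truncate:
  assumes "x \<in> pts M"
  shows "x - (\<Sum>i | d i < k. scl M (c x i) (basis i)) \<in> fil M k"
proof -
  have s: "(\<Sum>i | d i < k. scl M (c x i) (basis i)) \<in> pts M"
    by (intro pts_sum pts_scl) simp
  have "c (\<Sum>i | d i < k. scl M (c x i) (basis i)) j = c x j" if "d j < k" for j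
    using that by (subst c_sum) (simp_all add: pts_scl c_scl c_basis finite_deg_less if_distrib cong: if_cong)
  thus ?thesis by (intro filI[OF pts_diff[OF assms s]]) (simp add: c_diff[OF assms s])
qed

end

locale coord_tensor = M: coord_module M d c + N: coord_module N e c' + T: coord_module T "\<lambda>(i, j). d i + e j" cT
  for M :: "('a::comm_ring_1, 'h::ab_group_add) filtered_module" and d :: "'i \<Rightarrow> nat" and c
    and N :: "('a, 'k::ab_group_add) filtered_module" and e :: "'j \<Rightarrow> nat" and c'
    and T :: "('a, 't::ab_group_add) filtered_module" and cT +
  fixes b :: "'h \<Rightarrow> 'k \<Rightarrow> 't"
  assumes b_pts: "x \<in> pts M \<Longrightarrow> y \<in> pts N \<Longrightarrow> b x y \<in> pts T"
    and c_b: "x \<in> pts M \<Longrightarrow> y \<in> pts N \<Longrightarrow> cT (b x y) (i, j) = c x i * c' y j"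
begin

abbreviation \<phi> :: "'i \<times> 'j \<Rightarrow> ('h \<times> 'k \<Rightarrow>\<^sub>0 'a) \<Rightarrow> 'a" where
  "\<phi> ij \<equiv> lin_ext (\<lambda>p. c (fst p) (fst ij) * c' (snd p) (snd ij))"

lemma free_ext_pts: "Poly_Mapping.keys z \<subseteq> pts M \<times> pts N \<Longrightarrow> free_ext T b z \<in> pts T"
  unfolding free_ext_def by (intro T.pts_sum T.pts_scl b_pts) auto

lemma c_free_ext:
  assumes "Poly_Mapping.keys z \<subseteq> pts M \<times> pts N"
  shows "cT (free_ext T b z) ij = \<phi> ij z"
proof -
  have p: "fst p \<in> pts M" "snd p \<in> pts N" if "p \<in> Poly_Mapping.keys z" for p using assms that by auto
  have "cT (free_ext T b z) ij = (\<Sum>p\<in>Poly_Mapping.keys z. cT (scl T (Poly_Mapping.lookup z p) (b (fst p) (snd p))) ij)"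
    unfolding free_ext_def by (intro T.c_sum T.pts_scl b_pts p)
  also have "\<dots> = \<phi> ij z"
    unfolding lin_ext_def by (intro sum.cong refl) (cases ij, simp add: T.c_scl b_pts p c_b)
  finally show ?thesis .
qed

lemma free_ext_fil_iff:
  "Poly_Mapping.keys z \<subseteq> pts M \<times> pts N \<Longrightarrow>
    free_ext T b z \<in> fil T k \<longleftrightarrow> (\<forall>i j. d i + e j < k \<longrightarrow> \<phi> (i, j) z = 0)"
  by (subst T.fil_iff) (simp add: free_ext_pts c_free_ext)

lemma tensor_fil_imp:
  assumes "z \<in> tensor_fil M N k" "d i + e j < k"
  shows "\<phi> (i, j) z = 0"
  using assms(1) unfolding tensor_fil_def
proof (induction rule: pm.span_induct)
  show "pm.subspace {z. \<phi> (i, j) z = 0}"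
    by (rule pm.subspaceI) (auto simp: lin_ext_add lin_ext_scale)
  fix z assume "z \<in> tensor_rels M N \<union> {Poly_Mapping.single (x, y) 1 | x y i j. x \<in> fil M i \<and> y \<in> fil N j \<and> i + j = k}"
  thus "\<phi> (i, j) z = 0"
  proof
    assume "z \<in> tensor_rels M N"
    thus ?thesis unfolding tensor_rels_def
      by (auto simp: lin_ext_diff M.c_add N.c_add M.c_scl N.c_scl distrib_left distrib_right)
  next
    assume "z \<in> {Poly_Mapping.single (x, y) 1 | x y i j. x \<in> fil M i \<and> y \<in> fil N j \<and> i + j = k}"
    then obtain x y p q where z: "z = Poly_Mapping.single (x, y) 1" "x \<in> fil M p" "y \<in> fil N q" "p + q = k" by blast
    hence "d i < p \<or> e j < q" using assms(2) by linarith
    thus ?thesis using M.filD[OF z(2), of i] N.filD[OF z(3), of j] by (auto simp: z(1))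
  qed
qed

lemma tensor_fil_subspace: "pm.subspace (tensor_fil M N k)"
  unfolding tensor_fil_def by (rule pm.subspace_span)

lemma tensor_fil_rels: "z \<in> tensor_rels M N \<Longrightarrow> z \<in> tensor_fil M N k"
  unfolding tensor_fil_def by (rule pm.span_base) simp

lemma tensor_fil_gen:
  "x \<in> fil M i \<Longrightarrow> y \<in> fil N j \<Longrightarrow> i + j = k \<Longrightarrow> Poly_Mapping.single (x, y) 1 \<in> tensor_fil M N k"
  unfolding tensor_fil_def by (rule pm.span_base) blast

lemmas tf_add = pm.subspace_add[OF tensor_fil_subspace]
  and tf_diff = pm.subspace_diff[OF tensor_fil_subspace]
  and tf_scale = pm.subspace_scale[OF tensor_fil_subspace]
  and tf_0 = pm.subspace_0[OF tensor_fil_subspace]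
  and tf_sum = pm.subspace_sum[OF tensor_fil_subspace]

lemma tensor_sum_left:
  assumes "finite A" "\<And>i. i \<in> A \<Longrightarrow> f i \<in> pts M" "y \<in> pts N"
  shows "Poly_Mapping.single (\<Sum>i\<in>A. scl M (r i) (f i), y) 1 - (\<Sum>i\<in>A. Poly_Mapping.single (f i, y) (r i)) \<in> tensor_fil M N k"
  using assms(1,2)
proof (induction A rule: finite_induct)
  case empty
  \<comment> \<open>Homogeneity with scalar 0 shows that the pair \<open>(0, y)\<close> represents
    0.\<close>
  have "Poly_Mapping.single (scl M 0 0, y) 1 - Poly_Mapping.single (0, y) 0 \<in> tensor_rels M N"
    unfolding tensor_rels_def using assms(3) M.pts_0 by blast
  thus ?case using tensor_fil_rels by simp
next
  case (insert a A)
  let ?S = "\<Sum>i\<in>A. scl M (r i) (f i)"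
  have p: "scl M (r a) (f a) \<in> pts M" "?S \<in> pts M" using insert by (auto intro: M.pts_scl M.pts_sum)
  have "Poly_Mapping.single (scl M (r a) (f a) + ?S, y) 1 - Poly_Mapping.single (scl M (r a) (f a), y) 1 - Poly_Mapping.single (?S, y) 1 \<in> tensor_rels M N"
    unfolding tensor_rels_def using assms(3) p by blast
  note 1 = tensor_fil_rels[OF this, of k]
  have "Poly_Mapping.single (scl M (r a) (f a), y) 1 - Poly_Mapping.single (f a, y) (r a) \<in> tensor_rels M N"
    unfolding tensor_rels_def using assms(3) insert by blast
  note 2 = tensor_fil_rels[OF this, of k]
  have "Poly_Mapping.single (?S, y) 1 - (\<Sum>i\<in>A. Poly_Mapping.single (f i, y) (r i)) \<in> tensor_fil M N k"
    using insert by auto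
  from tf_add[OF tf_add[OF 1 2] this] show ?case using insert by (simp add: algebra_simps)
qed

lemma tensor_sum_right:
  assumes "finite A" "\<And>i. i \<in> A \<Longrightarrow> f i \<in> pts N" "x \<in> pts M"
  shows "Poly_Mapping.single (x, \<Sum>i\<in>A. scl N (r i) (f i)) 1 - (\<Sum>i\<in>A. Poly_Mapping.single (x, f i) (r i)) \<in> tensor_fil M N k"
  using assms(1,2)
proof (induction A rule: finite_induct)
  case empty
  have "Poly_Mapping.single (x, scl N 0 0) 1 - Poly_Mapping.single (x, 0) 0 \<in> tensor_rels M N"
    unfolding tensor_rels_def using assms(3) N.pts_0 by blast
  thus ?case using tensor_fil_rels by simp
next
  case (insert a A)
  let ?S = "\<Sum>i\<in>A. scl N (r i) (f i)"
  have p: "scl N (r a) (f a) \<in> pts N" "?S \<in> pts N" using insert by (auto intro: N.pts_scl N.pts_sum)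
  have "Poly_Mapping.single (x, scl N (r a) (f a) + ?S) 1 - Poly_Mapping.single (x, scl N (r a) (f a)) 1 - Poly_Mapping.single (x, ?S) 1 \<in> tensor_rels M N"
    unfolding tensor_rels_def using assms(3) p by blast
  note 1 = tensor_fil_rels[OF this, of k]
  have "Poly_Mapping.single (x, scl N (r a) (f a)) 1 - Poly_Mapping.single (x, f a) (r a) \<in> tensor_rels M N"
    unfolding tensor_rels_def using assms(3) insert by blast
  note 2 = tensor_fil_rels[OF this, of k]
  have "Poly_Mapping.single (x, ?S) 1 - (\<Sum>i\<in>A. Poly_Mapping.single (x, f i) (r i)) \<in> tensor_fil M N k"
    using insert by auto
  from tf_add[OF tf_add[OF 1 2] this] show ?case using insert by (simp add: algebra_simps)
qed

lemma tensor_add_fil: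
  assumes "x \<in> pts M" "x' \<in> pts M" "y \<in> pts N" "Poly_Mapping.single (x', y) 1 \<in> tensor_fil M N k"
  shows "Poly_Mapping.single (x + x', y) 1 - Poly_Mapping.single (x, y) 1 \<in> tensor_fil M N k"
proof -
  have "Poly_Mapping.single (x + x', y) 1 - Poly_Mapping.single (x, y) 1 - Poly_Mapping.single (x', y) 1 \<in> tensor_rels M N"
    unfolding tensor_rels_def using assms by blast
  from tf_add[OF tensor_fil_rels[OF this] assms(4)] show ?thesis by simp
qed

lemma tensor_add_fil':
  assumes "x \<in> pts M" "y \<in> pts N" "y' \<in> pts N" "Poly_Mapping.single (x, y') 1 \<in> tensor_fil M N k"
  shows "Poly_Mapping.single (x, y + y') 1 - Poly_Mapping.single (x, y) 1 \<in> tensor_fil M N k"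
proof -
  have "Poly_Mapping.single (x, y + y') 1 - Poly_Mapping.single (x, y) 1 - Poly_Mapping.single (x, y') 1 \<in> tensor_rels M N"
    unfolding tensor_rels_def using assms by blast
  from tf_add[OF tensor_fil_rels[OF this] assms(4)] show ?thesis by simp
qed

text \<open>The pairs with \<open>d i + e j < k\<close>, written as a dependent sum so that the two
  factors can be truncated one after the other.\<close>

abbreviation D :: "nat \<Rightarrow> ('i \<times> 'j) set" where "D k \<equiv> SIGMA i:{i. d i < k}. {j. e j < k - d i}"

lemma finite_D: "finite (D k)"
  using M.finite_deg_less N.finite_deg_less by blast

text \<open>Truncating \<open>x\<close> below degree \<open>k\<close> leaves a remainder in the
  \<open>k\<close>-th filtration step. In the term of \<open>M.basis i\<close>, which already lies
  in step \<open>d i\<close>, it is then enough to truncate \<open>y\<close> below degree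
  \<open>k - d i\<close>.\<close>

lemma single_normal_form:
  assumes x: "x \<in> pts M" and y: "y \<in> pts N"
  shows "Poly_Mapping.single (x, y) 1
    - (\<Sum>(i, j)\<in>D k. Poly_Mapping.single (M.basis i, N.basis j) (c x i * c' y j)) \<in> tensor_fil M N k"
proof -
  let ?I = "{i. d i < k}"
  let ?X = "\<Sum>i\<in>?I. scl M (c x i) (M.basis i)"
  have X: "?X \<in> pts M" by (intro M.pts_sum M.pts_scl) simp
  have "Poly_Mapping.single (?X + (x - ?X), y) 1 - Poly_Mapping.single (?X, y) 1 \<in> tensor_fil M N k"
    using M.truncate[OF x, of k] y by (intro tensor_add_fil tensor_fil_gen[where i = k and j = 0] X) (auto simp: M.fil_pts)
  moreover have "Poly_Mapping.single (?X, y) 1 - (\<Sum>i\<in>?I. Poly_Mapping.single (M.basis i, y) (c x i)) \<in> tensor_fil M N k"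
    by (rule tensor_sum_left) (simp_all add: M.finite_deg_less y)
  ultimately have 1: "Poly_Mapping.single (x, y) 1 - (\<Sum>i\<in>?I. Poly_Mapping.single (M.basis i, y) (c x i)) \<in> tensor_fil M N k"
    using tf_add by fastforce
  have 2: "Poly_Mapping.single (M.basis i, y) (c x i)
      - (\<Sum>j | e j < k - d i. Poly_Mapping.single (M.basis i, N.basis j) (c x i * c' y j)) \<in> tensor_fil M N k"
    if "i \<in> ?I" for i
  proof -
    let ?J = "{j. e j < k - d i}"
    let ?Y = "\<Sum>j\<in>?J. scl N (c' y j) (N.basis j)"
    have Y: "?Y \<in> pts N" by (intro N.pts_sum N.pts_scl) simp
    have "Poly_Mapping.single (M.basis i, ?Y + (y - ?Y)) 1 - Poly_Mapping.single (M.basis i, ?Y) 1 \<in> tensor_fil M N k"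
      using N.truncate[OF y, of "k - d i"] M.basis_fil[of i] that
      by (intro tensor_add_fil' tensor_fil_gen[where i = "d i" and j = "k - d i"] Y) (auto simp: N.fil_pts)
    moreover have "Poly_Mapping.single (M.basis i, ?Y) 1 - (\<Sum>j\<in>?J. Poly_Mapping.single (M.basis i, N.basis j) (c' y j)) \<in> tensor_fil M N k"
      by (rule tensor_sum_right) (simp_all add: N.finite_deg_less)
    ultimately have "Poly_Mapping.single (M.basis i, y) 1 - (\<Sum>j\<in>?J. Poly_Mapping.single (M.basis i, N.basis j) (c' y j)) \<in> tensor_fil M N k"
      using tf_add by fastforce
    from tf_scale[OF this, of "c x i"] show ?thesis
      by (simp add: pm.scale_right_diff_distrib pm.scale_sum_right map_times_single)
  qed
  have "(\<Sum>i\<in>?I. Poly_Mapping.single (M.basis i, y) (c x i)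
      - (\<Sum>j | e j < k - d i. Poly_Mapping.single (M.basis i, N.basis j) (c x i * c' y j))) \<in> tensor_fil M N k"
    by (rule tf_sum) (rule 2)
  from tf_add[OF 1 this] show ?thesis
    by (simp add: sum_subtractf sum.Sigma M.finite_deg_less N.finite_deg_less)
qed

lemma normal_form:
  assumes "Poly_Mapping.keys z \<subseteq> pts M \<times> pts N"
  shows "z - (\<Sum>(i, j)\<in>D k. Poly_Mapping.single (M.basis i, N.basis j) (\<phi> (i, j) z)) \<in> tensor_fil M N k"
proof (induction z rule: poly_mapping_induct_add)
  case zero
  show ?case by (simp add: tf_0 case_prod_unfold)
next
  case (add p r z')
  hence p: "fst p \<in> pts M" "snd p \<in> pts N" using assms by auto
  from tf_add[OF tf_scale[OF single_normal_form[OF p, of k], of r] add(1)] show ?case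
    by (simp add: pm.scale_right_diff_distrib pm.scale_sum_right map_times_single case_prod_unfold lin_ext_add
        single_add sum.distrib algebra_simps)
qed

text \<open>Modulo level \<open>k\<close> a tensor is determined by its finitely many coordinates in
  \<open>D k\<close>. This yields injectivity on the quotients, and prescribing these coordinates
  yields surjectivity.\<close>

theorem completed_tensor: "is_completed_tensor M N T b"
  unfolding is_completed_tensor_def
proof (intro conjI allI impI ballI)
  show "complete_module T" by (rule T.complete)
  show "bilinear_on M N T b"
    unfolding bilinear_on_def
    by (intro conjI ballI allI; (rule T.coord_eqI)?)
      (auto simp: b_pts c_b M.c_add N.c_add T.c_add M.c_scl N.c_scl T.c_scl M.pts_add N.pts_add T.pts_add
        M.pts_scl N.pts_scl T.pts_scl algebra_simps)
next
  fix k and z :: "'h \<times> 'k \<Rightarrow>\<^sub>0 'a" assume z: "Poly_Mapping.keys z \<subseteq> pts M \<times> pts N"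
  show "free_ext T b z \<in> fil T k \<longleftrightarrow> z \<in> tensor_fil M N k"
  proof
    assume "free_ext T b z \<in> fil T k"
    hence "\<phi> (i, j) z = 0" if "(i, j) \<in> D k" for i j
      using that free_ext_fil_iff[OF z] by auto
    hence "(\<Sum>(i, j)\<in>D k. Poly_Mapping.single (M.basis i, N.basis j) (\<phi> (i, j) z)) = 0"
      by (intro sum.neutral) auto
    thus "z \<in> tensor_fil M N k" using normal_form[OF z, of k] by simp
  next
    assume "z \<in> tensor_fil M N k"
    thus "free_ext T b z \<in> fil T k" using free_ext_fil_iff[OF z] tensor_fil_imp by blast
  qed
next
  fix k t assume t: "t \<in> pts T"
  define z where "z = (\<Sum>(i, j)\<in>D k. Poly_Mapping.single (M.basis i, N.basis j) (cT t (i, j)))"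
  have keys: "Poly_Mapping.keys z \<subseteq> pts M \<times> pts N"
    unfolding z_def using Poly_Mapping.keys_sum by (fastforce split: if_splits)
  have "\<phi> (i, j) z = cT t (i, j)" if "d i + e j < k" for i j
  proof -
    have "\<phi> (i, j) z = (\<Sum>p\<in>D k. if p = (i, j) then cT t p else 0)"
      unfolding z_def lin_ext_sum by (intro sum.cong) (auto simp: M.c_basis N.c_basis split: if_splits)
    moreover have "e j < k - d i" using that by linarith
    ultimately show ?thesis using that finite_D[of k] by simp
  qed
  hence "t - free_ext T b z \<in> fil T k"
    by (intro T.filI[OF T.pts_diff[OF t free_ext_pts[OF keys]]]) (auto simp: T.c_diff[OF t free_ext_pts[OF keys]] c_free_ext[OF keys])
  with keys show "\<exists>z. Poly_Mapping.keys z \<subseteq> pts M \<times> pts N \<and> t - free_ext T b z \<in> fil T k" by blast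
qed

end


section \<open>Isomorphisms of filtered modules and transport of Hopf algebra structures\<close>

text \<open>Closure of \<open>pts M\<close> is bundled in, so that transport arguments can rewrite
  along \<open>f\<close> without invoking the module laws.\<close>

definition filt_iso ::
  "('a::comm_ring_1, 'h::ab_group_add) filtered_module \<Rightarrow> ('a, 'k::ab_group_add) filtered_module \<Rightarrow> ('h \<Rightarrow> 'k) \<Rightarrow> bool" where
  "filt_iso M N f \<longleftrightarrow> bij_betw f (pts M) (pts N) \<and>
     (\<forall>x\<in>pts M. \<forall>y\<in>pts M. x + y \<in> pts M \<and> f (x + y) = f x + f y) \<and>
     (\<forall>r. \<forall>x\<in>pts M. scl M r x \<in> pts M \<and> f (scl M r x) = scl N r (f x)) \<and>
     (\<forall>k. fil M k \<subseteq> pts M \<and> fil N k = f ` fil M k)"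

lemma
  assumes "filt_iso M N f"
  shows filt_iso_bij: "bij_betw f (pts M) (pts N)"
    and filt_iso_add: "x \<in> pts M \<Longrightarrow> y \<in> pts M \<Longrightarrow> f (x + y) = f x + f y"
    and filt_iso_add_pts: "x \<in> pts M \<Longrightarrow> y \<in> pts M \<Longrightarrow> x + y \<in> pts M"
    and filt_iso_scl: "x \<in> pts M \<Longrightarrow> f (scl M r x) = scl N r (f x)"
    and filt_iso_scl_pts: "x \<in> pts M \<Longrightarrow> scl M r x \<in> pts M"
    and filt_iso_sub: "fil M k \<subseteq> pts M"
    and filt_iso_img: "fil N k = f ` fil M k"
  using assms unfolding filt_iso_def by blast+

lemma filt_iso_pts: "filt_iso M N f \<Longrightarrow> x \<in> pts M \<Longrightarrow> f x \<in> pts N"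
  using filt_iso_bij bij_betwE by blast

lemma filt_iso_ball:
  assumes "filt_iso M N f"
  shows "(\<forall>y\<in>pts N. P y) \<longleftrightarrow> (\<forall>x\<in>pts M. P (f x))"
  unfolding filt_iso_img[OF assms, of 0] by blast

lemma filt_iso_inv_left: "filt_iso M N f \<Longrightarrow> x \<in> pts M \<Longrightarrow> inv_into (pts M) f (f x) = x"
  by (rule bij_betw_inv_into_left[OF filt_iso_bij])

lemma filt_iso_inv:
  assumes "filt_iso M N f"
  shows "filt_iso N M (inv_into (pts M) f)"
proof -
  let ?g = "inv_into (pts M) f"
  note bij = filt_iso_bij[OF assms] and sub = filt_iso_sub[OF assms] and img = filt_iso_img[OF assms]
  note left = filt_iso_inv_left[OF assms]
  have add: "f x + f y = f (x + y)" "x + y \<in> pts M" if "x \<in> pts M" "y \<in> pts M" for x y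
    using that by (simp_all only: filt_iso_add[OF assms] filt_iso_add_pts[OF assms])
  have scl: "scl N r (f x) = f (scl M r x)" "scl M r x \<in> pts M" if "x \<in> pts M" for r x
    using that by (simp_all only: filt_iso_scl[OF assms] filt_iso_scl_pts[OF assms])
  show ?thesis
    unfolding filt_iso_def filt_iso_ball[OF assms]
  proof (intro conjI allI ballI)
    show "bij_betw ?g (pts N) (pts M)" by (rule bij_betw_inv_into[OF bij])
    show "fil N k \<subseteq> pts N" for k unfolding img[of k] using sub[of k] filt_iso_pts[OF assms] by blast
    have "?g ` f ` fil M k = (\<lambda>x. x) ` fil M k" for k
      unfolding image_image by (intro image_cong refl left) (use sub in blast)
    thus "fil M k = ?g ` fil N k" for k unfolding img by simp
  qed (simp_all add: add scl left filt_iso_pts[OF assms])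
qed

lemma cont_linear_filt_iso:
  assumes "filt_iso M N f"
  shows "cont_linear M N f"
proof -
  have "\<exists>l. f ` fil M l \<subseteq> fil N k" for k
    unfolding filt_iso_img[OF assms, of k] by blast
  thus ?thesis
    unfolding cont_linear_def using filt_iso_pts[OF assms] filt_iso_add[OF assms] filt_iso_scl[OF assms] by blast
qed

lemma cont_linear_comp:
  assumes "cont_linear M N f" "cont_linear N P g"
  shows "cont_linear M P (\<lambda>x. g (f x))"
proof -
  have "\<exists>l. (\<lambda>x. g (f x)) ` fil M l \<subseteq> fil P k" for k
  proof -
    obtain l where l: "g ` fil N l \<subseteq> fil P k" using assms(2) unfolding cont_linear_def by blast
    obtain l' where "f ` fil M l' \<subseteq> fil N l" using assms(1) unfolding cont_linear_def by blast
    with l show ?thesis by blast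
  qed
  thus ?thesis using assms unfolding cont_linear_def by simp
qed

lemma cont_linear_cong:
  assumes "cont_linear M N f" "\<And>x. x \<in> pts M \<Longrightarrow> f x = g x"
    and "\<And>k. fil M k \<subseteq> pts M" "\<And>x y. x \<in> pts M \<Longrightarrow> y \<in> pts M \<Longrightarrow> x + y \<in> pts M" "\<And>r x. x \<in> pts M \<Longrightarrow> scl M r x \<in> pts M"
  shows "cont_linear M N g"
proof -
  have "g x = f x" if "x \<in> fil M l" for x l
    by (rule assms(2)[symmetric, OF subsetD[OF assms(3) that]])
  hence img: "g ` fil M l = f ` fil M l" for l by (rule image_cong[OF refl])
  note f = assms(1)[unfolded cont_linear_def]
  show ?thesis
    unfolding cont_linear_def img
  proof (intro conjI ballI allI)
    show "\<exists>l. f ` fil M l \<subseteq> fil N k" for k using f by blast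
    fix x assume x: "x \<in> pts M"
    show "g x \<in> pts N" using f x assms(2)[OF x] by metis
    show "g (scl M r x) = scl N r (g x)" for r using f x assms(2)[OF x] assms(2)[OF assms(5)[OF x]] by metis
    fix y assume y: "y \<in> pts M"
    show "g (x + y) = g x + g y" using f x y assms(2)[OF x] assms(2)[OF y] assms(2)[OF assms(4)[OF x y]] by metis
  qed
qed

lemma cont_bilinear_transport:
  assumes f: "filt_iso M M' f" and g: "filt_iso N N' g" and h: "filt_iso T T' h" and b: "cont_bilinear M N T b"
  shows "cont_bilinear M' N' T' (\<lambda>x y. h (b (inv_into (pts M) f x) (inv_into (pts N) g y)))"
proof -
  let ?b = "\<lambda>x y. h (b (inv_into (pts M) f x) (inv_into (pts N) g y))"
  note inv = filt_iso_inv_left[OF f] filt_iso_inv_left[OF g]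
  note sub = filt_iso_sub[OF f] filt_iso_sub[OF g]
  have b': "bilinear_on M N T b" using b by (simp add: cont_bilinear_def)
  have add: "f x + f x' = f (x + x')" "x + x' \<in> pts M" if "x \<in> pts M" "x' \<in> pts M" for x x'
    using that by (simp_all only: filt_iso_add[OF f] filt_iso_add_pts[OF f] filt_iso_scl[OF f] filt_iso_scl_pts[OF f])
  have add': "g x + g x' = g (x + x')" "x + x' \<in> pts N" if "x \<in> pts N" "x' \<in> pts N" for x x'
    using that by (simp_all only: filt_iso_add[OF g] filt_iso_add_pts[OF g] filt_iso_scl[OF g] filt_iso_scl_pts[OF g])
  have addh: "h (x + x') = h x + h x'" if "x \<in> pts T" "x' \<in> pts T" for x x'
    using that by (simp_all only: filt_iso_add[OF h] filt_iso_add_pts[OF h] filt_iso_scl[OF h] filt_iso_scl_pts[OF h])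
  have scl: "scl M' r (f x) = f (scl M r x)" "scl M r x \<in> pts M" if "x \<in> pts M" for r x
    using that by (simp_all only: filt_iso_add[OF f] filt_iso_add_pts[OF f] filt_iso_scl[OF f] filt_iso_scl_pts[OF f])
  have scl': "scl N' r (g x) = g (scl N r x)" "scl N r x \<in> pts N" if "x \<in> pts N" for r x
    using that by (simp_all only: filt_iso_add[OF g] filt_iso_add_pts[OF g] filt_iso_scl[OF g] filt_iso_scl_pts[OF g])
  have sclh: "h (scl T r x) = scl T' r (h x)" if "x \<in> pts T" for r x
    using that by (simp_all only: filt_iso_add[OF h] filt_iso_add_pts[OF h] filt_iso_scl[OF h] filt_iso_scl_pts[OF h])
  have bp: "b x y \<in> pts T" if "x \<in> pts M" "y \<in> pts N" for x y
    using b' that by (simp add: bilinear_on_def)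
  have bl: "b (x + x') y = b x y + b x' y" "b (scl M r x) y = scl T r (b x y)" if "x \<in> pts M" "x' \<in> pts M" "y \<in> pts N" for x x' y r
    using b' that by (simp_all add: bilinear_on_def)
  have br: "b x (y + y') = b x y + b x y'" "b x (scl N r y) = scl T r (b x y)" if "x \<in> pts M" "y \<in> pts N" "y' \<in> pts N" for x y y' r
    using b' that by (simp_all add: bilinear_on_def)
  have "bilinear_on M' N' T' ?b"
    unfolding bilinear_on_def filt_iso_ball[OF f] filt_iso_ball[OF g]
    by (intro conjI allI ballI)
      (simp_all add: inv add add' scl scl' addh sclh bp bl br filt_iso_pts[OF h])
  moreover have "\<exists>l. \<forall>i j. i + j = l \<longrightarrow> (\<forall>x\<in>fil M' i. \<forall>y\<in>fil N' j. ?b x y \<in> fil T' k)" for k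
  proof -
    obtain l where l: "\<forall>i j. i + j = l \<longrightarrow> (\<forall>x\<in>fil M i. \<forall>y\<in>fil N j. b x y \<in> fil T k)"
      using b unfolding cont_bilinear_def by blast
    have "?b x y \<in> fil T' k" if ij: "i + j = l" "x \<in> fil M' i" "y \<in> fil N' j" for i j x y
    proof -
      obtain x0 where x0: "x = f x0" "x0 \<in> fil M i" using ij(2) unfolding filt_iso_img[OF f, of i] by (rule imageE)
      obtain y0 where y0: "y = g y0" "y0 \<in> fil N j" using ij(3) unfolding filt_iso_img[OF g, of j] by (rule imageE)
      have "b x0 y0 \<in> fil T k" using l ij(1) x0(2) y0(2) by blast
      hence "h (b x0 y0) \<in> fil T' k" unfolding filt_iso_img[OF h, of k] by (rule imageI)
      thus ?thesis unfolding x0(1) y0(1) inv(1)[OF subsetD[OF sub(1) x0(2)]] inv(2)[OF subsetD[OF sub(2) y0(2)]] .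
    qed
    thus ?thesis by blast
  qed
  ultimately show ?thesis by (simp add: cont_bilinear_def)
qed

text \<open>The maps on completed tensor products of \<open>K\<close> whose existence is demanded
  are those of \<open>H\<close>, conjugated by \<open>f\<close>, \<open>f2\<close> and
  \<open>f3\<close>. That the given models for \<open>K\<close> are completed tensor products is a
  separate input, obtained from coordinates.\<close>

lemma hopf_transport:
  assumes H: "complete_hopf_algebra H"
    and K: "complete_module (mdl K)" "is_completed_tensor (mdl K) (mdl K) (sq K) (ten K)"
      "is_completed_tensor (sq K) (mdl K) (cube K) (tenl K)" "is_completed_tensor (mdl K) (sq K) (cube K) (tenr K)"
    and f: "filt_iso (mdl H) (mdl K) f" and f2: "filt_iso (sq H) (sq K) f2" and f3: "filt_iso (cube H) (cube K) f3"
    and ten: "\<And>x y. x \<in> pts (mdl H) \<Longrightarrow> y \<in> pts (mdl H) \<Longrightarrow> ten K (f x) (f y) = f2 (ten H x y)"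
    and tenl: "\<And>p x. p \<in> pts (sq H) \<Longrightarrow> x \<in> pts (mdl H) \<Longrightarrow> tenl K (f2 p) (f x) = f3 (tenl H p x)"
    and tenr: "\<And>x p. x \<in> pts (mdl H) \<Longrightarrow> p \<in> pts (sq H) \<Longrightarrow> tenr K (f x) (f2 p) = f3 (tenr H x p)"
    and mul: "\<And>x y. x \<in> pts (mdl H) \<Longrightarrow> y \<in> pts (mdl H) \<Longrightarrow> mul K (f x) (f y) = f (mul H x y)"
    and unt: "unt K = f (unt H)"
    and comul: "\<And>x. x \<in> pts (mdl H) \<Longrightarrow> comul K (f x) = f2 (comul H x)"
    and counit: "\<And>x. x \<in> pts (mdl H) \<Longrightarrow> counit K (f x) = counit H x"
    and antipode: "\<And>x. x \<in> pts (mdl H) \<Longrightarrow> antipode K (f x) = f (antipode H x)"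
  shows "complete_hopf_iso H K f"
proof -
  let ?g = "inv_into (pts (mdl H)) f" and ?g2 = "inv_into (pts (sq H)) f2"
  note inv = filt_iso_inv_left[OF f] filt_iso_inv_left[OF f2]
  note g = filt_iso_inv[OF f] and g2 = filt_iso_inv[OF f2]
  note ball = filt_iso_ball[OF f]
  note fp = filt_iso_pts[OF f] filt_iso_pts[OF f2]
  have H1: "is_completed_tensor (mdl H) (mdl H) (sq H) (ten H)"
    "is_completed_tensor (sq H) (mdl H) (cube H) (tenl H)" "is_completed_tensor (mdl H) (sq H) (cube H) (tenr H)"
    "cont_bilinear (mdl H) (mdl H) (mdl H) (mul H)" "unt H \<in> pts (mdl H)" "cont_linear (mdl H) (sq H) (comul H)"
    "cont_linear (mdl H) \<lparr>scl = (*), fil = (\<lambda>i. if i = 0 then UNIV else {0})\<rparr> (counit H)"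
    "cont_linear (mdl H) (mdl H) (antipode H)"
    and Hid: "\<forall>x\<in>pts (mdl H). \<forall>y\<in>pts (mdl H). \<forall>z\<in>pts (mdl H). tenl H (ten H x y) z = tenr H x (ten H y z)"
      "\<forall>x\<in>pts (mdl H). \<forall>y\<in>pts (mdl H). \<forall>z\<in>pts (mdl H). mul H (mul H x y) z = mul H x (mul H y z)"
      "\<forall>x\<in>pts (mdl H). mul H (unt H) x = x \<and> mul H x (unt H) = x"
      "comul H (unt H) = ten H (unt H) (unt H)"
      "\<forall>x\<in>pts (mdl H). \<forall>y\<in>pts (mdl H). counit H (mul H x y) = counit H x * counit H y"
      "counit H (unt H) = 1"
    using H unfolding complete_hopf_algebra_def by - ((elim conjE, assumption)+)
  \<comment> \<open>The clauses that assert existence of a map are picked out of this conjunction by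
    their position further down.\<close>
  note Hc = H[unfolded complete_hopf_algebra_def]
  have p: "ten H x y \<in> pts (sq H)" "mul H x y \<in> pts (mdl H)" "comul H x \<in> pts (sq H)" "antipode H x \<in> pts (mdl H)"
    if "x \<in> pts (mdl H)" "y \<in> pts (mdl H)" for x y
    using that H1 by (simp_all add: is_completed_tensor_def bilinear_on_def cont_bilinear_def cont_linear_def)
  have scl: "scl (mdl K) r (f x) = f (scl (mdl H) r x)" "scl (mdl H) r x \<in> pts (mdl H)" if "x \<in> pts (mdl H)" for r x
    using that by (simp_all only: filt_iso_add[OF f] filt_iso_add_pts[OF f] filt_iso_scl[OF f] filt_iso_scl_pts[OF f])
  have Kpts: "fil (mdl K) k \<subseteq> pts (mdl K)" "x \<in> pts (mdl K) \<Longrightarrow> y \<in> pts (mdl K) \<Longrightarrow> x + y \<in> pts (mdl K)"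
      "x \<in> pts (mdl K) \<Longrightarrow> scl (mdl K) r x \<in> pts (mdl K)" for k r x y
    using filt_iso_sub[OF g] filt_iso_add_pts[OF g] filt_iso_scl_pts[OF g] by blast+
  note tr = cont_linear_comp[OF cont_linear_comp[OF cont_linear_filt_iso[OF _] _] cont_linear_filt_iso]
  have hopfK: "complete_hopf_algebra K"
    unfolding complete_hopf_algebra_def ball
  proof (intro conjI)
    show "cont_bilinear (mdl K) (mdl K) (mdl K) (mul K)"
    proof -
      have "cont_bilinear (mdl K) (mdl K) (mdl K) (\<lambda>x y. f (mul H (?g x) (?g y)))"
        by (rule cont_bilinear_transport[OF f f f H1(4)])
      moreover have "\<forall>x\<in>pts (mdl K). \<forall>y\<in>pts (mdl K). f (mul H (?g x) (?g y)) = mul K x y"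
        unfolding ball by (simp add: inv mul)
      ultimately show ?thesis
        using Kpts(1) unfolding cont_bilinear_def bilinear_on_def by (simp add: Kpts subset_iff)
    qed
    show "cont_linear (mdl K) (sq K) (comul K)"
      by (rule cont_linear_cong[OF tr[OF g H1(6) f2] _ Kpts])
        (use ball[of "\<lambda>x. f2 (comul H (?g x)) = comul K x"] in \<open>auto simp: inv comul\<close>)
    show "cont_linear (mdl K) (mdl K) (antipode K)"
      by (rule cont_linear_cong[OF tr[OF g H1(8) f] _ Kpts])
        (use ball[of "\<lambda>x. f (antipode H (?g x)) = antipode K x"] in \<open>auto simp: inv antipode\<close>)
    show "cont_linear (mdl K) \<lparr>scl = (*), fil = (\<lambda>i. if i = 0 then UNIV else {0})\<rparr> (counit K)"
      by (rule cont_linear_cong[OF cont_linear_comp[OF cont_linear_filt_iso[OF g] H1(7)] _ Kpts])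
        (use ball[of "\<lambda>x. counit H (?g x) = counit K x"] in \<open>auto simp: inv counit\<close>)
    obtain L R where LR: "cont_linear (sq H) (cube H) L" "cont_linear (sq H) (cube H) R"
      "\<forall>x\<in>pts (mdl H). \<forall>y\<in>pts (mdl H). L (ten H x y) = tenl H (comul H x) y \<and> R (ten H x y) = tenr H x (comul H y)"
      "\<forall>x\<in>pts (mdl H). L (comul H x) = R (comul H x)"
      using Hc[THEN conjunct2, THEN conjunct2, THEN conjunct2, THEN conjunct2, THEN conjunct2, THEN conjunct2, THEN conjunct2, THEN conjunct2, THEN conjunct2, THEN conjunct2, THEN conjunct1] by (elim exE conjE) (rule that)
    show "\<exists>L R. cont_linear (sq K) (cube K) L \<and> cont_linear (sq K) (cube K) R \<and>
       (\<forall>x\<in>pts (mdl H). \<forall>y\<in>pts (mdl H).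
          L (ten K (f x) (f y)) = tenl K (comul K (f x)) (f y) \<and> R (ten K (f x) (f y)) = tenr K (f x) (comul K (f y))) \<and>
       (\<forall>x\<in>pts (mdl H). L (comul K (f x)) = R (comul K (f x)))"
      by (intro exI conjI, rule tr[OF g2 LR(1) f3], rule tr[OF g2 LR(2) f3])
        (simp_all add: ten comul inv p tenl tenr LR(3,4))
    obtain L R where LR: "cont_linear (sq H) (mdl H) L" "cont_linear (sq H) (mdl H) R"
      "\<forall>x\<in>pts (mdl H). \<forall>y\<in>pts (mdl H). L (ten H x y) = scl (mdl H) (counit H x) y \<and> R (ten H x y) = scl (mdl H) (counit H y) x"
      "\<forall>x\<in>pts (mdl H). L (comul H x) = x \<and> R (comul H x) = x"
      using Hc[THEN conjunct2, THEN conjunct2, THEN conjunct2, THEN conjunct2, THEN conjunct2, THEN conjunct2, THEN conjunct2, THEN conjunct2, THEN conjunct2, THEN conjunct2, THEN conjunct2, THEN conjunct2, THEN conjunct1] by (elim exE conjE) (rule that)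
    show "\<exists>L R. cont_linear (sq K) (mdl K) L \<and> cont_linear (sq K) (mdl K) R \<and>
       (\<forall>x\<in>pts (mdl H). \<forall>y\<in>pts (mdl H).
          L (ten K (f x) (f y)) = scl (mdl K) (counit K (f x)) (f y) \<and>
          R (ten K (f x) (f y)) = scl (mdl K) (counit K (f y)) (f x)) \<and>
       (\<forall>x\<in>pts (mdl H). L (comul K (f x)) = f x \<and> R (comul K (f x)) = f x)"
      by (intro exI conjI, rule tr[OF g2 LR(1) f], rule tr[OF g2 LR(2) f])
        (simp_all add: ten comul counit inv p scl LR(3,4))
    obtain L R where LR: "cont_linear (sq H) (mdl H) L" "cont_linear (sq H) (mdl H) R"
      "\<forall>x\<in>pts (mdl H). \<forall>y\<in>pts (mdl H). L (ten H x y) = mul H (antipode H x) y \<and> R (ten H x y) = mul H x (antipode H y)"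
      "\<forall>x\<in>pts (mdl H). L (comul H x) = scl (mdl H) (counit H x) (unt H) \<and> R (comul H x) = scl (mdl H) (counit H x) (unt H)"
      using Hc[THEN conjunct2, THEN conjunct2, THEN conjunct2, THEN conjunct2, THEN conjunct2, THEN conjunct2, THEN conjunct2, THEN conjunct2, THEN conjunct2, THEN conjunct2, THEN conjunct2, THEN conjunct2, THEN conjunct2, THEN conjunct2, THEN conjunct2, THEN conjunct2, THEN conjunct2, THEN conjunct2] by (elim exE conjE) (rule that)
    show "\<exists>L R. cont_linear (sq K) (mdl K) L \<and> cont_linear (sq K) (mdl K) R \<and>
       (\<forall>x\<in>pts (mdl H). \<forall>y\<in>pts (mdl H).
          L (ten K (f x) (f y)) = mul K (antipode K (f x)) (f y) \<and> R (ten K (f x) (f y)) = mul K (f x) (antipode K (f y))) \<and>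
       (\<forall>x\<in>pts (mdl H).
          L (comul K (f x)) = scl (mdl K) (counit K (f x)) (unt K) \<and>
          R (comul K (f x)) = scl (mdl K) (counit K (f x)) (unt K))"
      by (intro exI conjI, rule tr[OF g2 LR(1) f], rule tr[OF g2 LR(2) f])
        (simp_all add: ten comul counit antipode mul unt inv p scl H1(5) LR(3,4))
    obtain M where M: "cont_bilinear (sq H) (sq H) (sq H) M"
       "\<forall>x\<in>pts (mdl H). \<forall>y\<in>pts (mdl H). \<forall>x'\<in>pts (mdl H). \<forall>y'\<in>pts (mdl H).
          M (ten H x y) (ten H x' y') = ten H (mul H x x') (mul H y y')"
       "\<forall>x\<in>pts (mdl H). \<forall>y\<in>pts (mdl H). comul H (mul H x y) = M (comul H x) (comul H y)"
      using Hc[THEN conjunct2, THEN conjunct2, THEN conjunct2, THEN conjunct2, THEN conjunct2, THEN conjunct2, THEN conjunct2, THEN conjunct2, THEN conjunct2, THEN conjunct2, THEN conjunct2, THEN conjunct2, THEN conjunct2, THEN conjunct1] by (elim exE conjE) (rule that)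
    show "\<exists>M. cont_bilinear (sq K) (sq K) (sq K) M \<and>
       (\<forall>x\<in>pts (mdl H). \<forall>y\<in>pts (mdl H). \<forall>x'\<in>pts (mdl H). \<forall>y'\<in>pts (mdl H).
          M (ten K (f x) (f y)) (ten K (f x') (f y')) = ten K (mul K (f x) (f x')) (mul K (f y) (f y'))) \<and>
       (\<forall>x\<in>pts (mdl H). \<forall>y\<in>pts (mdl H). comul K (mul K (f x) (f y)) = M (comul K (f x)) (comul K (f y)))"
      by (intro exI conjI, rule cont_bilinear_transport[OF f2 f2 f2 M(1)])
        (simp_all add: ten comul mul inv p M(2,3))
  qed (use K Hid in \<open>simp_all add: ten tenl tenr mul unt comul counit p H1(5) fp\<close>)
  have 1: "complete_hopf_hom H K f"
    unfolding complete_hopf_hom_def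
    using cont_linear_filt_iso[OF f] cont_linear_filt_iso[OF f2] by (auto simp: mul unt ten comul counit antipode)
  have 2: "complete_hopf_hom K H ?g"
    unfolding complete_hopf_hom_def ball
  proof (intro conjI exI)
    show "cont_linear (mdl K) (mdl H) ?g" by (rule cont_linear_filt_iso[OF g])
    show "cont_linear (sq K) (sq H) ?g2" by (rule cont_linear_filt_iso[OF g2])
  qed (simp_all add: mul unt ten comul counit antipode inv p H1(5))
  show ?thesis
    unfolding complete_hopf_iso_def using H hopfK 1 2 filt_iso_bij[OF f] by blast
qed

lemma coord_filt_iso:
  assumes "coord_module M d c" "coord_module N d c'"
  shows "filt_iso M N (\<lambda>x. coord_module.of_coord N c' (c x))"
proof -
  interpret M: coord_module M d c by fact
  interpret N: coord_module N d c' by fact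
  let ?f = "\<lambda>x. N.of_coord (c x)"
  have inv: "N.of_coord (c' y) = y" if "y \<in> pts N" for y
    by (rule N.coord_eqI) (simp_all add: that)
  have inv': "M.of_coord (c x) = x" if "x \<in> pts M" for x
    by (rule M.coord_eqI) (simp_all add: that)
  show ?thesis
    unfolding filt_iso_def
  proof (intro conjI allI ballI)
    show "bij_betw ?f (pts M) (pts N)"
      by (rule bij_betw_byWitness[where f' = "\<lambda>y. M.of_coord (c' y)"]) (auto simp: inv inv')
    show "fil M k \<subseteq> pts M" for k using M.fil_pts by blast
    show "fil N k = ?f ` fil M k" for k
    proof (intro equalityI subsetI)
      fix y assume y: "y \<in> fil N k"
      hence "y = ?f (M.of_coord (c' y))" using N.fil_pts by (simp add: inv)
      moreover have "M.of_coord (c' y) \<in> fil M k" by (rule M.filI) (use N.filD[OF y] in auto)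
      ultimately show "y \<in> ?f ` fil M k" by blast
    next
      fix y assume "y \<in> ?f ` fil M k"
      then obtain x where x: "x \<in> fil M k" "y = ?f x" by blast
      show "y \<in> fil N k" unfolding x(2) by (rule N.filI) (use M.filD[OF x(1)] in auto)
    qed
    fix x assume x: "x \<in> pts M"
    show "scl M r x \<in> pts M" for r by (rule M.pts_scl[OF x])
    show "?f (scl M r x) = scl N r (?f x)" for r
      by (rule N.coord_eqI) (simp_all add: N.pts_scl N.c_scl M.c_scl x)
    fix y assume y: "y \<in> pts M"
    show "x + y \<in> pts M" by (rule M.pts_add[OF x y])
    show "?f (x + y) = ?f x + ?f y"
      by (rule N.coord_eqI) (simp_all add: N.pts_add N.c_add M.c_add x y)
  qed
qed

text \<open>Serves two purposes: exponents on a sum of blocks are replaced by pairs of exponents,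
  and the indices of a triple tensor product are rebracketed.\<close>

lemma coord_module_reindex:
  assumes "coord_module M d c" "bij h"
  shows "coord_module M (\<lambda>i. d (h i)) (\<lambda>x i. c x (h i))"
proof -
  interpret coord_module M d c by fact
  have surj: "\<exists>i. j = h i" for j using assms(2) by (meson bij_pointE)
  show ?thesis
  proof
    show "bij_betw (\<lambda>x i. c x (h i)) (pts M) UNIV"
    proof (rule bij_betw_byWitness[where f' = "\<lambda>x. of_coord (\<lambda>j. x (inv h j))"])
      show "\<forall>x\<in>pts M. of_coord (\<lambda>j. c x (h (inv h j))) = x"
        using assms(2) by (auto simp: surj_f_inv_f bij_is_surj intro!: coord_eqI)
      show "\<forall>x\<in>UNIV. (\<lambda>i. c (of_coord (\<lambda>j. x (inv h j))) (h i)) = x"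
        using assms(2) by (simp add: bij_is_inj)
    qed auto
    show "x \<in> fil M k \<longleftrightarrow> x \<in> pts M \<and> (\<forall>i. d (h i) < k \<longrightarrow> c x (h i) = 0)" for x k
      using fil_iff[of x k] surj by metis
    have "{i. d (h i) \<le> n} = h -` {j. d j \<le> n}" for n by auto
    thus "finite {i. d (h i) \<le> n}" for n
      using finite_vimageI[OF finite_deg bij_is_inj[OF assms(2)]] by simp
  qed (use subspace_pts c_add c_scl in auto)
qed


section \<open>Quotients of monoid algebras\<close>

lemma two_sided_ideal_gen: "two_sided_ideal (ideal_gen S)"
  unfolding two_sided_ideal_def ideal_gen_def by blast

lemma ideal_gen_base: "x \<in> S \<Longrightarrow> x \<in> ideal_gen S"
  unfolding ideal_gen_def by blast

lemma ideal_gen_minimal: "two_sided_ideal I \<Longrightarrow> S \<subseteq> I \<Longrightarrow> ideal_gen S \<subseteq> I"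
  unfolding ideal_gen_def by blast

lemma ideal_gen_0: "0 \<in> ideal_gen S"
  and ideal_gen_add: "x \<in> ideal_gen S \<Longrightarrow> y \<in> ideal_gen S \<Longrightarrow> x + y \<in> ideal_gen S"
  and ideal_gen_mult_left: "x \<in> ideal_gen S \<Longrightarrow> a * x \<in> ideal_gen S"
  and ideal_gen_mult_right: "x \<in> ideal_gen S \<Longrightarrow> x * a \<in> ideal_gen S"
  using two_sided_ideal_gen[of S] unfolding two_sided_ideal_def by blast+

lemma ideal_gen_uminus: "x \<in> ideal_gen S \<Longrightarrow> - x \<in> ideal_gen S"
  using ideal_gen_mult_left[of x S "- 1"] by simp

lemma ideal_gen_diff: "x \<in> ideal_gen S \<Longrightarrow> y \<in> ideal_gen S \<Longrightarrow> x - y \<in> ideal_gen S"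
  using ideal_gen_add[OF _ ideal_gen_uminus, of x S y] by simp

lemma cls_eq_iff: "cls S x = cls S y \<longleftrightarrow> x - y \<in> ideal_gen S"
proof
  assume "cls S x = cls S y"
  moreover have "x \<in> cls S x" by (simp add: cls_def ideal_gen_0)
  ultimately show "x - y \<in> ideal_gen S" by (simp add: cls_def)
next
  assume xy: "x - y \<in> ideal_gen S"
  show "cls S x = cls S y"
    unfolding cls_def
    using ideal_gen_add[OF _ xy] ideal_gen_diff[OF _ xy] by force
qed

lemma cls_self: "x \<in> cls S x"
  by (simp add: cls_def ideal_gen_0)

lemma quot_carrier_cls [simp]: "cls S x \<in> quot_carrier S"
  by (simp add: quot_carrier_def)

lemma on_cls_cls:
  assumes "\<And>y. y - x \<in> ideal_gen S \<Longrightarrow> f y = f x"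
  shows "on_cls f (cls S x) = f x"
proof -
  have "f y = f x" if "y \<in> cls S x" for y
    by (rule assms) (use that in \<open>simp add: cls_def\<close>)
  hence "f ` cls S x = {f x}" using cls_self[of x S] by blast
  thus ?thesis by (simp add: on_cls_def)
qed

lemma functional_cls [simp]: "functional S f (cls S x) = f (cls S x)"
  by (simp add: functional_def)

lemma quot_dual_eqI:
  assumes "\<phi> \<in> quot_dual S" "\<psi> \<in> quot_dual S" "\<And>x. \<phi> (cls S x) = \<psi> (cls S x)"
  shows "\<phi> = \<psi>"
proof
  fix C show "\<phi> C = \<psi> C"
    using assms by (cases "C \<in> quot_carrier S") (auto simp: quot_dual_def quot_carrier_def)
qed

lemma ideal_gen_subspace: "pm.subspace (ideal_gen S)" for S :: "('w::monoid_add \<Rightarrow>\<^sub>0 'a::comm_ring_1) set"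
  by (rule pm.subspaceI)
    (auto simp: ideal_gen_0 ideal_gen_add mult_map_scale_conv_mult ideal_gen_mult_left)

lemma quot_dual_linear:
  assumes "\<phi> \<in> quot_dual S"
  shows "\<phi> (cls S z) = lin_ext (\<lambda>w. \<phi> (cls S (gen w))) z"
proof (induction z rule: poly_mapping_induct_add)
  case zero
  have "\<phi> (cls S (Poly_Mapping.single 0 0 * 0)) = 0 * \<phi> (cls S 0)"
    using assms unfolding quot_dual_def by blast
  thus ?case by simp
next
  case (add w r z)
  have "\<phi> (cls S (Poly_Mapping.single w r + z)) = \<phi> (cls S (Poly_Mapping.single w r)) + \<phi> (cls S z)"
    using assms unfolding quot_dual_def by blast
  moreover have "\<phi> (cls S (Poly_Mapping.single 0 r * gen w)) = r * \<phi> (cls S (gen w))"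
    using assms unfolding quot_dual_def by blast
  ultimately show ?case by (simp add: add lin_ext_add mult_single)
qed

lemma functional_in_quot_dual:
  assumes "\<And>z. z \<in> ideal_gen S \<Longrightarrow> lin_ext c z = 0"
  shows "functional S (on_cls (lin_ext c)) \<in> quot_dual S"
    and "functional S (on_cls (lin_ext c)) (cls S z) = lin_ext c z"
proof -
  have on: "on_cls (lin_ext c) (cls S z) = lin_ext c z" for z
  proof (rule on_cls_cls)
    fix y assume "y - z \<in> ideal_gen S"
    from assms[OF this] show "lin_ext c y = lin_ext c z" by (simp add: lin_ext_diff)
  qed
  show "functional S (on_cls (lin_ext c)) \<in> quot_dual S"
    by (auto simp: quot_dual_def on lin_ext_add lin_ext_scale functional_def simp flip: mult_map_scale_conv_mult)
  show "functional S (on_cls (lin_ext c)) (cls S z) = lin_ext c z" by (simp add: on)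
qed

text \<open>
  The matrix \<open>E\<close> describes a map from the monoid algebra onto the free module on \<open>'i\<close> with kernel the
  ideal generated by \<open>S\<close>; the elements \<open>b i\<close> span the quotient, and \<open>E\<close> is unitriangular on them.
\<close>
locale dist_basis =
  fixes S :: "('w::monoid_add \<Rightarrow>\<^sub>0 'a::comm_ring_1) set" and E :: "'w \<Rightarrow> 'i \<Rightarrow> 'a"
    and d :: "'i \<Rightarrow> nat" and b :: "'i \<Rightarrow> 'w \<Rightarrow>\<^sub>0 'a"
  assumes finite_E: "finite {i. E w i \<noteq> 0}"
    and E_ideal: "z \<in> ideal_gen S \<Longrightarrow> lin_ext (\<lambda>w. E w i) z = 0"
    and E_b: "lin_ext (\<lambda>w. E w i) (b i) = 1"
    and E_b_0: "j \<noteq> i \<Longrightarrow> d i \<le> d j \<Longrightarrow> lin_ext (\<lambda>w. E w j) (b i) = 0"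
    and span: "gen w \<in> pm.span (range b \<union> ideal_gen S)"
    and finite_d: "finite {i. d i \<le> n}"
begin

abbreviation EE :: "('w \<Rightarrow>\<^sub>0 'a) \<Rightarrow> 'i \<Rightarrow> 'a" where
  "EE z i \<equiv> lin_ext (\<lambda>w. E w i) z"

lemma finite_EE: "finite {i. EE z i \<noteq> 0}"
proof (rule finite_subset)
  show "{i. EE z i \<noteq> 0} \<subseteq> (\<Union>w\<in>Poly_Mapping.keys z. {i. E w i \<noteq> 0})"
    by (auto simp: lin_ext_def intro: ccontr sum.neutral)
qed (simp add: finite_E)

lemma EE_b_nonzero: "EE (b i) j \<noteq> 0 \<Longrightarrow> j = i \<or> d j < d i"
  using E_b_0[of j i] by force

lemma inj_b: "inj b"
proof (rule injI, rule ccontr)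
  fix i j assume "b i = b j" "i \<noteq> j"
  thus False using E_b[of i] E_b[of j] E_b_0[of i j] E_b_0[of j i] by (cases "d i \<le> d j") auto
qed

lemma span_all: "z \<in> pm.span (range b \<union> ideal_gen S)"
proof (induction z rule: poly_mapping_induct_add)
  case (add w r z)
  have "Poly_Mapping.map ((*) r) (gen w) \<in> pm.span (range b \<union> ideal_gen S)"
    by (rule pm.span_scale[OF span])
  thus ?case using add by (auto simp: map_times_single intro: pm.span_add)
qed (rule pm.span_zero)

text \<open>Modulo the ideal the element is a finite combination of the \<open>b i\<close>. Were
  some coefficient nonzero, testing at an index \<open>k\<close> of maximal degree among these would
  isolate the coefficient of \<open>b k\<close>, by unitriangularity.\<close>

lemma kernel:
  assumes z: "\<And>i. EE z i = 0"
  shows "z \<in> ideal_gen S"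
proof -
  have "z \<in> {x + y |x y. x \<in> pm.span (range b) \<and> y \<in> pm.span (ideal_gen S)}"
    using span_all[of z] unfolding pm.span_Un .
  then obtain x y where xy: "z = x + y" "x \<in> pm.span (range b)" "y \<in> ideal_gen S"
    by (auto simp: pm.span_eq_iff[THEN iffD2, OF ideal_gen_subspace])
  obtain t r where t: "finite t" "t \<subseteq> range b" "x = (\<Sum>a\<in>t. Poly_Mapping.map ((*) (r a)) a)"
    using xy(2) unfolding pm.span_explicit by blast
  obtain A where A: "finite A" "t = b ` A" using t(1,2) by (meson finite_subset_image)
  have x: "x = (\<Sum>i\<in>A. Poly_Mapping.map ((*) (r (b i))) (b i))"
    unfolding t(3) A(2) by (rule sum.reindex[unfolded o_def]) (rule inj_on_subset[OF inj_b subset_UNIV])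
  have Ex: "(\<Sum>i\<in>A. r (b i) * EE (b i) j) = 0" for j
    using z[of j] E_ideal[OF xy(3), of j] by (simp add: xy(1) x lin_ext_add lin_ext_sum lin_ext_scale)
  have "r (b i) = 0" if "i \<in> A" for i
  proof (rule ccontr)
    assume nz: "r (b i) \<noteq> 0"
    let ?A = "{i \<in> A. r (b i) \<noteq> 0}"
    have "finite ?A" "?A \<noteq> {}" using A(1) that nz by auto
    hence "Max (d ` ?A) \<in> d ` ?A" by (intro Max_in) auto
    then obtain k where k': "k \<in> ?A" "Max (d ` ?A) = d k" by (rule imageE)
    have k: "k \<in> A" "r (b k) \<noteq> 0" "\<And>i. i \<in> ?A \<Longrightarrow> d i \<le> d k"
      using k'(1) Max_ge[OF finite_imageI[OF \<open>finite ?A\<close>] imageI, of _ d] unfolding k'(2) by auto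
    have "(\<Sum>i\<in>A. r (b i) * EE (b i) k) = (\<Sum>i\<in>A. if i = k then r (b k) else 0)"
    proof (intro sum.cong refl)
      fix i assume "i \<in> A"
      thus "r (b i) * EE (b i) k = (if i = k then r (b k) else 0)"
        using k(3)[of i] E_b_0[of k i] by (cases "r (b i) = 0") (auto simp: E_b)
    qed
    thus False using Ex[of k] k(1,2) A(1) by simp
  qed
  hence "x = 0" unfolding x by (intro sum.neutral ballI) (simp add: mult_map_scale_conv_mult)
  thus ?thesis using xy by simp
qed

text \<open>Elimination by induction on the degree: apart from \<open>i\<close>, the row of
  \<open>b i\<close> meets only indices of strictly smaller degree, which have been treated
  already.\<close>

lemma ex_dual_basis: "\<exists>q. \<forall>j. EE q j = (if j = i then 1 else 0)"
proof (induction "d i" arbitrary: i rule: less_induct)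
  case less
  hence "\<exists>q. \<forall>j. EE q j = (if j = k then 1 else 0)" if "d k < d i" for k using that by blast
  then obtain q where q: "EE (q k) j = (if j = k then 1 else 0)" if "d k < d i" for k j by metis
  let ?A = "{j. EE (b i) j \<noteq> 0} - {i}"
  have A: "finite ?A" "\<And>k. k \<in> ?A \<Longrightarrow> d k < d i" using finite_EE EE_b_nonzero by auto
  let ?q = "b i - (\<Sum>k\<in>?A. Poly_Mapping.map ((*) (EE (b i) k)) (q k))"
  have "EE ?q j = (if j = i then 1 else 0)" for j
  proof -
    have "(\<Sum>k\<in>?A. EE (b i) k * EE (q k) j) = (\<Sum>k\<in>?A. if k = j then EE (b i) j else 0)"
    proof (intro sum.cong refl)
      fix k assume "k \<in> ?A"
      from q[OF A(2)[OF this], of j] show "EE (b i) k * EE (q k) j = (if k = j then EE (b i) j else 0)" by simp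
    qed
    hence "EE ?q j = EE (b i) j - (\<Sum>k\<in>?A. if k = j then EE (b i) j else 0)"
      by (simp only: lin_ext_diff lin_ext_sum lin_ext_scale)
    also have "(\<Sum>k\<in>?A. if k = j then EE (b i) j else 0) = (if j \<in> ?A then EE (b i) j else 0)"
      using A(1) by simp
    finally show ?thesis by (auto simp: E_b)
  qed
  thus ?case by blast
qed

text \<open>Only the class modulo the ideal is determined, by \<open>kernel\<close>; functionals on
  the quotient see nothing else.\<close>

definition dual :: "'i \<Rightarrow> 'w \<Rightarrow>\<^sub>0 'a" where
  "dual i = (SOME q. \<forall>j. EE q j = (if j = i then 1 else 0))"

lemma EE_dual: "EE (dual i) j = (if j = i then 1 else 0)"
  using someI_ex[OF ex_dual_basis[of i]] unfolding dual_def by blast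

lemma expand: "z - (\<Sum>i | EE z i \<noteq> 0. Poly_Mapping.map ((*) (EE z i)) (dual i)) \<in> ideal_gen S"
proof (rule kernel)
  fix j
  have "(\<Sum>i | EE z i \<noteq> 0. EE z i * EE (dual i) j) = (\<Sum>i | EE z i \<noteq> 0. if i = j then EE z j else 0)"
    by (intro sum.cong refl) (auto simp: EE_dual)
  also have "\<dots> = EE z j" by (simp add: finite_EE)
  finally show "EE (z - (\<Sum>i | EE z i \<noteq> 0. Poly_Mapping.map ((*) (EE z i)) (dual i))) j = 0"
    by (simp add: lin_ext_diff lin_ext_sum lin_ext_scale)
qed

lemma quot_dual_expand:
  assumes "\<phi> \<in> quot_dual S"
  shows "\<phi> (cls S z) = (\<Sum>i | EE z i \<noteq> 0. EE z i * \<phi> (cls S (dual i)))"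
proof -
  have "cls S z = cls S (\<Sum>i | EE z i \<noteq> 0. Poly_Mapping.map ((*) (EE z i)) (dual i))"
    unfolding cls_eq_iff by (rule expand)
  hence "\<phi> (cls S z) = \<phi> (cls S (\<Sum>i | EE z i \<noteq> 0. Poly_Mapping.map ((*) (EE z i)) (dual i)))"
    by (simp only:)
  also have "\<dots> = lin_ext (\<lambda>w. \<phi> (cls S (gen w))) (\<Sum>i | EE z i \<noteq> 0. Poly_Mapping.map ((*) (EE z i)) (dual i))"
    by (rule quot_dual_linear[OF assms])
  also have "\<dots> = (\<Sum>i | EE z i \<noteq> 0. EE z i * lin_ext (\<lambda>w. \<phi> (cls S (gen w))) (dual i))"
    by (simp only: lin_ext_sum lin_ext_scale)
  also have "\<dots> = (\<Sum>i | EE z i \<noteq> 0. EE z i * \<phi> (cls S (dual i)))"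
    by (intro sum.cong refl arg_cong2[of _ _ _ _ "(*)"] quot_dual_linear[OF assms, symmetric])
  finally show ?thesis .
qed

text \<open>The value on the basis element \<open>w\<close> of the functional whose coordinates on
  the dual basis are \<open>x\<close>.\<close>

definition ev :: "('i \<Rightarrow> 'a) \<Rightarrow> 'w \<Rightarrow> 'a" where
  "ev x w = (\<Sum>i | E w i \<noteq> 0. x i * E w i)"

lemma lin_ext_ev: "lin_ext (ev x) z = (\<Sum>i | EE z i \<noteq> 0. x i * EE z i)"
proof -
  let ?A = "(\<Union>w\<in>Poly_Mapping.keys z. {i. E w i \<noteq> 0})"
  have A: "finite ?A" by (simp add: finite_E)
  have "lin_ext (ev x) z = (\<Sum>w\<in>Poly_Mapping.keys z. \<Sum>i\<in>?A. Poly_Mapping.lookup z w * (x i * E w i))"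
    unfolding lin_ext_def ev_def sum_distrib_left
    by (intro sum.cong refl sum.mono_neutral_left A) auto
  also have "\<dots> = (\<Sum>i\<in>?A. x i * EE z i)"
    by (subst sum.swap) (simp add: lin_ext_def sum_distrib_left mult.left_commute)
  also have "\<dots> = (\<Sum>i | EE z i \<noteq> 0. x i * EE z i)"
    using A by (intro sum.mono_neutral_right) (auto simp: lin_ext_def intro: ccontr sum.neutral)
  finally show ?thesis .
qed

definition of_coords :: "('i \<Rightarrow> 'a) \<Rightarrow> ('w \<Rightarrow>\<^sub>0 'a) set \<Rightarrow> 'a" where
  "of_coords x = functional S (on_cls (lin_ext (ev x)))"

lemma of_coords: "of_coords x \<in> quot_dual S" "of_coords x (cls S z) = lin_ext (ev x) z"
proof -
  have "lin_ext (ev x) z = 0" if "z \<in> ideal_gen S" for z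
    unfolding lin_ext_ev using E_ideal[OF that] by simp
  from functional_in_quot_dual[OF this]
  show "of_coords x \<in> quot_dual S" "of_coords x (cls S z) = lin_ext (ev x) z"
    unfolding of_coords_def by blast+
qed

lemma of_coords_dual: "of_coords x (cls S (dual i)) = x i"
proof -
  have "{j. EE (dual i) j \<noteq> 0} \<subseteq> {i}" by (auto simp: EE_dual)
  hence "lin_ext (ev x) (dual i) = (\<Sum>j\<in>{i}. x j * EE (dual i) j)"
    unfolding lin_ext_ev by (intro sum.mono_neutral_left) auto
  thus ?thesis by (simp add: of_coords EE_dual)
qed

abbreviation coord :: "(('w \<Rightarrow>\<^sub>0 'a) set \<Rightarrow> 'a) \<Rightarrow> 'i \<Rightarrow> 'a" where
  "coord \<phi> i \<equiv> \<phi> (cls S (dual i))"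

lemma of_coords_coord:
  assumes "\<phi> \<in> quot_dual S"
  shows "of_coords (coord \<phi>) = \<phi>"
proof (rule quot_dual_eqI[OF of_coords(1) assms])
  fix z
  show "of_coords (coord \<phi>) (cls S z) = \<phi> (cls S z)"
    unfolding of_coords(2) lin_ext_ev quot_dual_expand[OF assms, of z] by (simp only: mult.commute)
qed

text \<open>The filtration is defined on the \<open>b i\<close>, the coordinates on the dual basis.
  The change between them is unitriangular for the degree and so respects vanishing below degree
  \<open>k\<close>.\<close>

lemma vanish_iff:
  assumes "\<phi> \<in> quot_dual S"
  shows "(\<forall>i. d i < k \<longrightarrow> \<phi> (cls S (b i)) = 0) \<longleftrightarrow> (\<forall>i. d i < k \<longrightarrow> coord \<phi> i = 0)"
proof
  assume "\<forall>i. d i < k \<longrightarrow> coord \<phi> i = 0"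
  thus "\<forall>i. d i < k \<longrightarrow> \<phi> (cls S (b i)) = 0"
    using EE_b_nonzero by (fastforce simp: quot_dual_expand[OF assms, of "b _"] intro!: sum.neutral)
next
  assume b: "\<forall>i. d i < k \<longrightarrow> \<phi> (cls S (b i)) = 0"
  have "coord \<phi> i = 0" if "d i < k" for i
    using that
  proof (induction "d i" arbitrary: i rule: less_induct)
    case less
    have i: "i \<in> {j. EE (b i) j \<noteq> 0} \<or> coord \<phi> i = 0"
    proof (cases "(1 :: 'a) = 0")
      case True
      thus ?thesis by (metis mult.left_neutral mult_zero_left)
    qed (simp add: E_b)
    have "0 = (\<Sum>j | EE (b i) j \<noteq> 0. EE (b i) j * coord \<phi> j)"
      using b less.prems quot_dual_expand[OF assms, of "b i"] by simp
    also have "\<dots> = (\<Sum>j | EE (b i) j \<noteq> 0. if j = i then coord \<phi> i else 0)"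
    proof (intro sum.cong refl)
      fix j assume "j \<in> {j. EE (b i) j \<noteq> 0}"
      hence "j = i \<or> d j < d i" using EE_b_nonzero by blast
      thus "EE (b i) j * coord \<phi> j = (if j = i then coord \<phi> i else 0)"
        using less by (auto simp: E_b)
    qed
    also have "\<dots> = coord \<phi> i" using i by (auto simp: finite_EE)
    finally show ?case by simp
  qed
  thus "\<forall>i. d i < k \<longrightarrow> coord \<phi> i = 0" by blast
qed

lemma coord_module_dual:
  fixes M :: "('a, ('w \<Rightarrow>\<^sub>0 'a) set \<Rightarrow> 'a) filtered_module"
  assumes scl: "scl M = (\<lambda>r \<phi> C. r * \<phi> C)"
    and fil: "\<And>k. fil M k = {\<phi> \<in> quot_dual S. \<forall>i. d i < k \<longrightarrow> \<phi> (cls S (b i)) = 0}"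
  shows "coord_module M d coord" and "pts M = quot_dual S"
proof -
  show pts: "pts M = quot_dual S" by (simp add: fil)
  have mod: "module (scl M)" unfolding scl by unfold_locales (auto simp: algebra_simps fun_eq_iff)
  show "coord_module M d coord"
  proof (intro coord_module.intro mod coord_module_axioms.intro)
    show "module.subspace (scl M) (pts M)"
      unfolding pts scl by (rule module.subspaceI[OF mod[unfolded scl]]) (auto simp: quot_dual_def algebra_simps)
    show "bij_betw coord (pts M) UNIV"
      unfolding pts
      by (rule bij_betw_byWitness[where f' = of_coords]) (auto simp: of_coords_coord of_coords_dual of_coords(1))
    show "x \<in> fil M k \<longleftrightarrow> x \<in> pts M \<and> (\<forall>i. d i < k \<longrightarrow> coord x i = 0)" for x k
      unfolding pts fil using vanish_iff by blast
  qed (simp_all add: scl finite_d)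
qed

end


section \<open>Tensor products of monoid algebras\<close>

lemma lookup_outer: "Poly_Mapping.lookup (outer x y) (v, w) = Poly_Mapping.lookup x v * Poly_Mapping.lookup y w"
proof -
  have "Poly_Mapping.lookup (outer x y) (v, w) = (\<Sum>v'\<in>Poly_Mapping.keys x. \<Sum>w'\<in>Poly_Mapping.keys y.
      if v' = v then if w' = w then Poly_Mapping.lookup x v * Poly_Mapping.lookup y w else 0 else 0)"
    unfolding outer_def lookup_sum by (intro sum.cong refl) (auto simp: lookup_single when_def)
  also have "\<dots> = (\<Sum>v'\<in>Poly_Mapping.keys x. if v' = v then \<Sum>w'\<in>Poly_Mapping.keys y.
      if w' = w then Poly_Mapping.lookup x v * Poly_Mapping.lookup y w else 0 else 0)"
    by (intro sum.cong) auto
  also have "\<dots> = Poly_Mapping.lookup x v * Poly_Mapping.lookup y w"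
    by (simp add: in_keys_iff)
  finally show ?thesis .
qed

lemma outer_add_left: "outer (x + x') y = outer x y + outer x' y"
  and outer_add_right: "outer x (y + y') = outer x y + outer x y'"
  and outer_scale_left: "outer (Poly_Mapping.map ((*) r) x) y = Poly_Mapping.map ((*) r) (outer x y)"
  and outer_scale_right: "outer x (Poly_Mapping.map ((*) r) y) = Poly_Mapping.map ((*) r) (outer x y)"
  and outer_single: "outer (Poly_Mapping.single v r) (Poly_Mapping.single w s) = Poly_Mapping.single (v, w) (r * s)"
  and outer_0 [simp]: "outer 0 y = 0" "outer x 0 = 0"
  by (rule poly_mapping_eqI;
      clarsimp simp: lookup_outer lookup_add lookup_map_times lookup_single when_def algebra_simps)+

lemma outer_mult: "outer x y * outer x' y' = outer (x * x') (y * y')"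
  for x x' :: "'v::monoid_add \<Rightarrow>\<^sub>0 'a::comm_ring_1" and y y' :: "'w::monoid_add \<Rightarrow>\<^sub>0 'a"
proof (induction x rule: poly_mapping_induct_add)
  case (add u r z)
  have "outer (Poly_Mapping.single u r) y * outer x' y' = outer (Poly_Mapping.single u r * x') (y * y')"
  proof (induction y rule: poly_mapping_induct_add)
    case (add v s z)
    have "outer (Poly_Mapping.single u r) (Poly_Mapping.single v s) * outer x' y' =
        outer (Poly_Mapping.single u r * x') (Poly_Mapping.single v s * y')"
    proof (induction x' rule: poly_mapping_induct_add)
      case (add u' r' z)
      have "outer (Poly_Mapping.single u r) (Poly_Mapping.single v s) * outer (Poly_Mapping.single u' r') y' =
          outer (Poly_Mapping.single u r * Poly_Mapping.single u' r') (Poly_Mapping.single v s * y')"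
        by (induction y' rule: poly_mapping_induct_add)
          (simp_all add: outer_add_right distrib_left outer_single mult_single mult_ac)
      with add show ?case by (simp add: outer_add_left distrib_left)
    qed simp
    with add show ?case by (simp add: outer_add_right distrib_right)
  qed simp
  with add show ?case by (simp add: outer_add_left distrib_right)
qed simp

lemma lin_ext_outer:
  "lin_ext (\<lambda>(v, w). f v * g w) (outer x y) = lin_ext f x * lin_ext g y"
proof (induction x rule: poly_mapping_induct_add)
  case (add u r z)
  have "lin_ext (\<lambda>(v, w). f v * g w) (outer (Poly_Mapping.single u r) y) = r * f u * lin_ext g y"
    by (induction y rule: poly_mapping_induct_add)
      (simp_all add: outer_add_right outer_single lin_ext_add algebra_simps)
  with add show ?case by (simp add: outer_add_left lin_ext_add algebra_simps)
qed simp

lemma single_outer: "Poly_Mapping.single (v, w) r = outer (Poly_Mapping.single v r) (gen w)"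
  by (simp add: outer_single)

lemma tensor_ideal_left: "x \<in> ideal_gen S \<Longrightarrow> outer x y \<in> ideal_gen (tensor_ideal S S')"
proof -
  assume "x \<in> ideal_gen S"
  hence "outer x 1 \<in> ideal_gen (tensor_ideal S S')" by (intro ideal_gen_base) (simp add: tensor_ideal_def)
  from ideal_gen_mult_right[OF this, of "outer 1 y"] show ?thesis by (simp add: outer_mult)
qed

lemma tensor_ideal_right: "y \<in> ideal_gen S' \<Longrightarrow> outer x y \<in> ideal_gen (tensor_ideal S S')"
proof -
  assume "y \<in> ideal_gen S'"
  hence "outer 1 y \<in> ideal_gen (tensor_ideal S S')" by (intro ideal_gen_base) (simp add: tensor_ideal_def)
  from ideal_gen_mult_left[OF this, of "outer x 1"] show ?thesis by (simp add: outer_mult)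
qed

text \<open>The kernel of the product functional need not be an ideal. The set of \<open>z\<close>
  all of whose multiples \<open>a * z * b\<close> are killed is one, and multiples of a generator by
  basis elements are pure tensors with a factor in one of the two ideals.\<close>

lemma tensor_ideal_vanish:
  fixes f :: "'v::monoid_add \<Rightarrow> 'a::comm_ring_1" and g :: "'w::monoid_add \<Rightarrow> 'a"
  assumes f: "\<And>x. x \<in> ideal_gen S \<Longrightarrow> lin_ext f x = 0" and g: "\<And>y. y \<in> ideal_gen S' \<Longrightarrow> lin_ext g y = 0"
    and z: "z \<in> ideal_gen (tensor_ideal S S')"
  shows "lin_ext (\<lambda>(v, w). f v * g w) z = 0"
proof -
  let ?L = "lin_ext (\<lambda>(v, w). f v * g w)"
  let ?Z = "{z. \<forall>a b. ?L (a * z * b) = 0}"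
  have "two_sided_ideal ?Z"
    unfolding two_sided_ideal_def
    by (auto simp: distrib_left distrib_right lin_ext_add mult.assoc) (simp flip: mult.assoc)
  moreover have "tensor_ideal S S' \<subseteq> ?Z"
  proof
    fix z assume "z \<in> tensor_ideal S S'"
    then consider x where "x \<in> ideal_gen S" "z = outer x 1" | y where "y \<in> ideal_gen S'" "z = outer 1 y"
      by (auto simp: tensor_ideal_def)
    hence gen: "?L (Poly_Mapping.single (u, v) r * z * Poly_Mapping.single (u', v') r') = 0" for u v r u' v' r'
    proof cases
      case 1
      hence "lin_ext f (Poly_Mapping.single u r * x * Poly_Mapping.single u' r') = 0"
        by (intro f ideal_gen_mult_left ideal_gen_mult_right)
      thus ?thesis by (simp add: 1 single_outer outer_mult lin_ext_outer)
    next
      case 2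
      hence "lin_ext g (gen v * y * gen v') = 0"
        by (intro g ideal_gen_mult_left ideal_gen_mult_right)
      thus ?thesis by (simp add: 2 single_outer outer_mult lin_ext_outer)
    qed
    have "?L (a * z * b) = 0" for a b
    proof (induction a rule: poly_mapping_induct_add)
      case (add p r a)
      have "?L (Poly_Mapping.single p r * z * b) = 0"
      proof (induction b rule: poly_mapping_induct_add)
        case (add p' r' b)
        thus ?case using gen[of "fst p" "snd p" r "fst p'" "snd p'" r'] by (simp add: distrib_left lin_ext_add)
      qed simp
      with add show ?case by (simp add: distrib_right lin_ext_add)
    qed simp
    thus "z \<in> ?Z" by blast
  qed
  ultimately have "z \<in> ?Z" using ideal_gen_minimal z by blast
  from this[unfolded mem_Collect_eq, rule_format, of 1 1] show ?thesis by simp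
qed

text \<open>A nonzero entry off the diagonal has both components equal to or of lower degree than
  those of the row, at least one of them lower, so the total degree drops and unitriangularity
  persists.\<close>

lemma dist_basis_tensor:
  fixes S :: "('v::monoid_add \<Rightarrow>\<^sub>0 'a::comm_ring_1) set" and S' :: "('w::monoid_add \<Rightarrow>\<^sub>0 'a) set"
  assumes "dist_basis S E d b" "dist_basis S' E' d' b'"
  shows "dist_basis (tensor_ideal S S') (\<lambda>(v, w) (i, j). E v i * E' w j) (\<lambda>(i, j). d i + d' j) (\<lambda>(i, j). outer (b i) (b' j))"
proof -
  interpret A: dist_basis S E d b by fact
  interpret B: dist_basis S' E' d' b' by fact
  let ?b = "\<lambda>(i, j). outer (b i) (b' j)"
  have lin: "lin_ext (\<lambda>vw. (case vw of (v, w) \<Rightarrow> \<lambda>(i, j). E v i * E' w j) (i, j)) = lin_ext (\<lambda>(v, w). E v i * E' w j)" for i j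
    by (simp add: case_prod_unfold)
  have sub: "outer x y \<in> pm.span (range ?b \<union> ideal_gen (tensor_ideal S S'))" for x y
    using A.span_all[of x]
  proof (induction x rule: pm.span_induct)
    case base
    show ?case
      by (rule pm.subspaceI) (auto simp: outer_add_left outer_scale_left intro: pm.span_add pm.span_scale pm.span_zero)
  next
    case (step x)
    show ?case
    proof (cases "x \<in> ideal_gen S")
      case True
      thus ?thesis by (auto intro: pm.span_base tensor_ideal_left)
    next
      case False
      with step obtain i where x: "x = b i" by auto
      show ?thesis
        using B.span_all[of y]
      proof (induction y rule: pm.span_induct)
        case base
        show ?case
          by (rule pm.subspaceI) (auto simp: outer_add_right outer_scale_right intro: pm.span_add pm.span_scale pm.span_zero)
      next
        case (step y)
        have "outer (b i) (b' k) \<in> range ?b" for k by (rule range_eqI[of _ _ "(i, k)"]) simp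
        with step show ?case by (auto simp: x intro: pm.span_base tensor_ideal_right)
      qed
    qed
  qed
  show ?thesis
  proof
    fix p :: "'v \<times> 'w" and ij :: "'b \<times> 'c" and n
    obtain v w where p: "p = (v, w)" by force
    have "{ij. (case p of (v, w) \<Rightarrow> \<lambda>(i, j). E v i * E' w j) ij \<noteq> 0} \<subseteq> {i. E v i \<noteq> 0} \<times> {j. E' w j \<noteq> 0}"
      by (auto simp: p)
    thus "finite {ij. (case p of (v, w) \<Rightarrow> \<lambda>(i, j). E v i * E' w j) ij \<noteq> 0}"
      by (rule finite_subset) (simp add: A.finite_E B.finite_E)
    show "gen p \<in> pm.span (range ?b \<union> ideal_gen (tensor_ideal S S'))"
      using sub[of "gen v" "gen w"] by (simp add: p outer_single)
    have "{ij. (case ij of (i, j) \<Rightarrow> d i + d' j) \<le> n} \<subseteq> {i. d i \<le> n} \<times> {j. d' j \<le> n}" by auto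
    thus "finite {ij. (case ij of (i, j) \<Rightarrow> d i + d' j) \<le> n}"
      by (rule finite_subset) (simp add: A.finite_d B.finite_d)
    obtain i j where ij: "ij = (i, j)" by force
    show "lin_ext (\<lambda>vw. (case vw of (v, w) \<Rightarrow> \<lambda>(i, j). E v i * E' w j) ij) z = 0"
      if "z \<in> ideal_gen (tensor_ideal S S')" for z
      unfolding ij lin by (rule tensor_ideal_vanish[OF A.E_ideal B.E_ideal that])
    show "lin_ext (\<lambda>vw. (case vw of (v, w) \<Rightarrow> \<lambda>(i, j). E v i * E' w j) ij) (?b ij) = 1"
      unfolding ij lin by (simp add: lin_ext_outer A.E_b B.E_b)
    fix kl :: "'b \<times> 'c"
    obtain k l where kl: "kl = (k, l)" by force
    assume ne: "ij \<noteq> kl" and le: "(case kl of (i, j) \<Rightarrow> d i + d' j) \<le> (case ij of (i, j) \<Rightarrow> d i + d' j)"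
    have "A.EE (b k) i = 0 \<or> B.EE (b' l) j = 0"
    proof (rule ccontr)
      assume "\<not> (A.EE (b k) i = 0 \<or> B.EE (b' l) j = 0)"
      hence "i = k \<or> d i < d k" "j = l \<or> d' j < d' l"
        using A.EE_b_nonzero B.EE_b_nonzero by blast+
      thus False using ne le by (auto simp: ij kl)
    qed
    thus "lin_ext (\<lambda>vw. (case vw of (v, w) \<Rightarrow> \<lambda>(i, j). E v i * E' w j) ij) (?b kl) = 0"
      unfolding ij kl lin by (auto simp: lin_ext_outer)
  qed
qed


section \<open>The universal enveloping algebra\<close>

lemma mult_map_times_right:
  fixes x y :: "'w::monoid_add \<Rightarrow>\<^sub>0 'a::comm_ring_1"
  shows "x * Poly_Mapping.map ((*) r) y = Poly_Mapping.map ((*) r) (x * y)"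
proof -
  have "x * Poly_Mapping.single 0 r = Poly_Mapping.single 0 r * x"
    by (induction x rule: poly_mapping_induct_add) (simp_all add: distrib_left distrib_right mult_single mult.commute)
  thus ?thesis by (simp add: mult_map_scale_conv_mult flip: mult.assoc)
qed

lemma gen_fword_mult: "gen (FWord u) * gen (FWord v) = (gen (FWord (u @ v)) :: 'n fword \<Rightarrow>\<^sub>0 'a::comm_ring_1)"
  by (simp add: mult_single plus_fword_def)

lemma gen_fword_Nil: "gen (FWord []) = (1 :: 'n fword \<Rightarrow>\<^sub>0 'a::comm_ring_1)"
  by (simp flip: zero_fword_def)

lemma gen_fword_prod_list:
  "prod_list (map (\<lambda>i. gen (FWord (f i))) xs) = (gen (FWord (concat (map f xs))) :: 'n fword \<Rightarrow>\<^sub>0 'a::comm_ring_1)"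
  by (induction xs) (simp_all add: gen_fword_mult gen_fword_Nil)

lemma gen_fword_power: "gen (FWord [i]) ^ k = (gen (FWord (replicate k i)) :: 'n fword \<Rightarrow>\<^sub>0 'a::comm_ring_1)"
  by (induction k) (simp_all add: gen_fword_mult gen_fword_Nil)

definition pbw_word :: "('n::{finite,linorder} \<Rightarrow> nat) \<Rightarrow> 'n list" where
  "pbw_word j = concat (map (\<lambda>i. replicate (j i) i) (sorted_list_of_set UNIV))"

lemma pbw_gen: "pbw j = gen (FWord (pbw_word j))"
  by (simp add: pbw_def pbw_word_def gen_fword_power gen_fword_prod_list)

lemma wmono_append: "wmono (u @ v) = wmono u + wmono v"
  by (simp add: wmono_def)

lemma wmono_replicate: "wmono (replicate k i) = Poly_Mapping.single i k"
  by (induction k) (simp_all flip: single_add)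

lemma wmono_pbw_word: "wmono (pbw_word (Poly_Mapping.lookup j)) = j"
proof -
  have c: "wmono (concat (map (\<lambda>i. replicate (f i) i) xs)) = (\<Sum>i\<leftarrow>xs. Poly_Mapping.single i (f i))" for f :: "'a \<Rightarrow> nat" and xs
    by (induction xs) (simp_all add: wmono_append wmono_replicate)
  have "wmono (pbw_word (Poly_Mapping.lookup j)) = (\<Sum>i\<in>UNIV. Poly_Mapping.single i (Poly_Mapping.lookup j i))"
    unfolding pbw_word_def c by (subst sum_list_distinct_conv_sum_set) simp_all
  also have "\<dots> = j"
    by (rule poly_mapping_eqI) (simp add: lookup_sum lookup_single when_def)
  finally show ?thesis .
qed

lemma length_pbw_word: "length (pbw_word (Poly_Mapping.lookup j)) = mono_deg j"
  using mono_deg_wmono[of "pbw_word (Poly_Mapping.lookup j)"] by (simp add: wmono_pbw_word)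

lemma lookup_wmono: "Poly_Mapping.lookup (wmono w) i = count (mset w) i"
  by (induction w) (simp_all add: lookup_add lookup_single when_def)

lemma mset_eq_wmono: "wmono u = wmono v \<Longrightarrow> mset u = mset v"
  by (rule multiset_eqI) (simp flip: lookup_wmono)

lemma lie_incl_unit: "lie_incl (\<lambda>j. if j = a then 1 else 0) = gen (FWord [a])"
proof -
  have "lie_incl (\<lambda>j. if j = a then 1 else 0) = (\<Sum>j\<in>UNIV. if j = a then gen (FWord [j]) else 0)"
    unfolding lie_incl_def by (intro sum.cong) auto
  thus ?thesis by simp
qed

section \<open>Reordering of words and spanning by PBW monomials\<close>

context
  fixes G :: "('n::{finite,linorder}, 'a::comm_ring_1) fgl"
begin

abbreviation short_span :: "nat \<Rightarrow> ('n fword \<Rightarrow>\<^sub>0 'a) set" where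
  "short_span n \<equiv> pm.span ({gen (FWord v) |v. length v < n} \<union> ideal_gen (uea_rels G))"

lemma short_span_Cons:
  assumes "z \<in> short_span n"
  shows "gen (FWord [a]) * z \<in> short_span (Suc n)"
  using assms
proof (induction z rule: pm.span_induct)
  case base
  show ?case
    by (rule pm.subspaceI)
      (auto simp: distrib_left mult_map_times_right intro: pm.span_zero pm.span_add pm.span_scale)
next
  case (step z)
  show ?case
  proof (cases "z \<in> ideal_gen (uea_rels G)")
    case True
    thus ?thesis by (intro pm.span_base UnI2 ideal_gen_mult_left)
  next
    case False
    with step obtain v where "z = gen (FWord v)" "length v < n" by auto
    thus ?thesis by (auto intro!: pm.span_base exI[of _ "a # v"] simp: gen_fword_mult)
  qed
qed

text \<open>The defining relation for \<open>a\<close> and \<open>b\<close>, multiplied by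
  \<open>u\<close> and \<open>v\<close>. The bracket is linear in the generators, so it contributes
  words one letter shorter.\<close>

lemma swap_adjacent:
  "gen (FWord (u @ [a, b] @ v)) - gen (FWord (u @ [b, a] @ v)) \<in> short_span (length (u @ [a, b] @ v))"
proof -
  let ?x = "\<lambda>j. if j = a then 1 else 0 :: 'a" and ?y = "\<lambda>j. if j = b then 1 else 0 :: 'a"
  define c where "c = lie_bracket G ?x ?y"
  have "lie_incl ?x * lie_incl ?y - lie_incl ?y * lie_incl ?x - lie_incl c \<in> uea_rels G"
    unfolding uea_rels_def c_def by blast
  hence "gen (FWord [a, b]) - gen (FWord [b, a]) - lie_incl c \<in> ideal_gen (uea_rels G)"
    by (intro ideal_gen_base) (simp only: lie_incl_unit gen_fword_mult append.simps)
  hence "gen (FWord u) * (gen (FWord [a, b]) - gen (FWord [b, a]) - lie_incl c) * gen (FWord v) \<in> ideal_gen (uea_rels G)"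
    by (intro ideal_gen_mult_left ideal_gen_mult_right)
  also have "gen (FWord u) * (gen (FWord [a, b]) - gen (FWord [b, a]) - lie_incl c) * gen (FWord v) =
      gen (FWord (u @ [a, b] @ v)) - gen (FWord (u @ [b, a] @ v)) - (\<Sum>j\<in>UNIV. Poly_Mapping.single (FWord (u @ [j] @ v)) (c j))"
    by (simp add: lie_incl_def algebra_simps sum_distrib_left sum_distrib_right mult_single plus_fword_def)
  finally have 1: "gen (FWord (u @ [a, b] @ v)) - gen (FWord (u @ [b, a] @ v)) - (\<Sum>j\<in>UNIV. Poly_Mapping.single (FWord (u @ [j] @ v)) (c j))
      \<in> ideal_gen (uea_rels G)" .
  have "(\<Sum>j\<in>UNIV. Poly_Mapping.single (FWord (u @ [j] @ v)) (c j)) \<in> short_span (length (u @ [a, b] @ v))"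
  proof (intro pm.span_sum)
    fix j
    have "Poly_Mapping.map ((*) (c j)) (gen (FWord (u @ [j] @ v))) \<in> short_span (length (u @ [a, b] @ v))"
      by (intro pm.span_scale pm.span_base) auto
    thus "Poly_Mapping.single (FWord (u @ [j] @ v)) (c j) \<in> short_span (length (u @ [a, b] @ v))"
      by (simp only: map_times_single mult_1_right)
  qed
  from pm.span_add[OF pm.span_base[OF UnI2[OF 1]] this] show ?thesis by simp
qed

lemma move_letter:
  "gen (FWord (p @ a # x @ y)) - gen (FWord (p @ x @ a # y)) \<in> short_span (length (p @ a # x @ y))"
proof (induction x arbitrary: p)
  case (Cons c x)
  have "gen (FWord (p @ [a, c] @ (x @ y))) - gen (FWord (p @ [c, a] @ (x @ y))) \<in> short_span (length (p @ [a, c] @ (x @ y)))"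
    by (rule swap_adjacent)
  from pm.span_add[OF this] Cons[of "p @ [c]"] show ?case by force
qed (simp add: pm.span_zero)

lemma permute_word:
  "mset w = mset w' \<Longrightarrow> gen (FWord w) - gen (FWord w') \<in> short_span (length w)"
proof (induction w arbitrary: w')
  case (Cons a w)
  have "a \<in> set w'" using Cons.prems by (metis list.set_intros(1) set_mset_mset)
  then obtain x y where w': "w' = x @ a # y" by (meson split_list)
  have "gen (FWord w) - gen (FWord (x @ y)) \<in> short_span (length w)"
    using Cons.prems by (intro Cons.IH) (simp add: w')
  from short_span_Cons[OF this, of a]
  have "gen (FWord (a # w)) - gen (FWord (a # x @ y)) \<in> short_span (length (a # w))"
    by (simp add: right_diff_distrib gen_fword_mult)
  moreover have "gen (FWord (a # x @ y)) - gen (FWord (x @ a # y)) \<in> short_span (length (a # w))"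
    using move_letter[of "[]" a x y] Cons.prems[THEN mset_eq_length] by (simp add: w')
  ultimately have "(gen (FWord (a # w)) - gen (FWord (a # x @ y))) + (gen (FWord (a # x @ y)) - gen (FWord (x @ a # y))) \<in> short_span (length (a # w))"
    by (rule pm.span_add)
  thus ?case by (simp add: w')
qed (simp add: pm.span_zero)

text \<open>The PBW word with the same letters as \<open>u\<close> differs from \<open>u\<close> by
  shorter words modulo the ideal, and these are covered by induction on the length.\<close>

lemma pbw_span:
  "gen w \<in> pm.span (range (\<lambda>j :: 'n mono. pbw (Poly_Mapping.lookup j)) \<union> ideal_gen (uea_rels G))"
proof (cases w)
  case (FWord u)
  let ?B = "pm.span (range (\<lambda>j :: 'n mono. pbw (Poly_Mapping.lookup j)) \<union> ideal_gen (uea_rels G))"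
  have "gen (FWord u) \<in> ?B"
  proof (induction "length u" arbitrary: u rule: less_induct)
    case less
    let ?v = "pbw_word (Poly_Mapping.lookup (wmono u))"
    have "gen (FWord u) - gen (FWord ?v) \<in> short_span (length u)"
      by (intro permute_word mset_eq_wmono) (simp add: wmono_pbw_word)
    moreover have "short_span (length u) \<subseteq> ?B"
      by (rule pm.span_minimal) (use less in \<open>auto intro: pm.span_base\<close>)
    moreover have "gen (FWord ?v) \<in> ?B"
      by (intro pm.span_base UnI1 range_eqI[of _ _ "wmono u"]) (simp add: pbw_gen)
    ultimately have "(gen (FWord u) - gen (FWord ?v)) + gen (FWord ?v) \<in> ?B"
      by (intro pm.span_add) auto
    thus ?case by simp
  qed
  thus ?thesis by (simp add: FWord)
qed

end

section \<open>The pairing of words with modified functions\<close>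

locale domain_group =
  fixes G :: "('n::{finite,linorder}, 'a::{idom,ring_char_0}) fgl"
  assumes is_fgl: "is_fgl G"
begin

abbreviation GQ :: "('n, 'a fract) fgl" where
  "GQ \<equiv> \<lambda>j. mapq (G j)"

text \<open>Two copies of the theory: the inverse and the iterated law are constructed over the
  ground ring, whereas the operators act on series over the quotient field, where divided powers
  exist.\<close>

sublocale R: formal_group G
  by (rule formal_group_is_fgl[OF is_fgl])

sublocale Q: formal_group GQ
  by (rule formal_group_mapq) (rule R.formal_group_axioms)

abbreviation D :: "'n list \<Rightarrow> ('n, 'a fract) mps \<Rightarrow> ('n, 'a fract) mps" where
  "D \<equiv> Q.ldiffs (\<lambda>j. j)"

abbreviation P :: "('n, 'a fract) mps \<Rightarrow> 'n fword \<Rightarrow> 'a fract" where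
  "P f w \<equiv> mcoeff (D (letters w) f) 0"

text \<open>The form in which characteristic zero enters: factorials become invertible in the
  quotient field.\<close>

lemma of_nat_fract_eq_0 [simp]: "(of_nat k :: 'a fract) = 0 \<longleftrightarrow> k = 0"
  by (metis of_nat_eq_0_iff to_quot_eq_0 to_quot_simps(7))

lemma modfun_ldiffs: "f \<in> mod_functions \<Longrightarrow> D w f \<in> mod_functions"
proof (induction w)
  case (Cons i w)
  have "Q.frame i j \<in> mod_functions" for j
    unfolding Q.frame_def by (rule modfun_subst) (auto simp: modfun_deriv split: sum.split)
  with Cons show ?case by (simp add: Q.ldiff_def modfun_sum modfun_mult modfun_rename modfun_deriv)
qed simp

lemma integral_P: "f \<in> mod_functions \<Longrightarrow> integral (P f w)"
  using mod_functionsD[OF modfun_ldiffs[of f "letters w"], of 0] by simp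

text \<open>Divided power monomials, the topological basis of the modified functions over the ground
  ring.\<close>

definition dpow :: "'v mono \<Rightarrow> ('v, 'a fract) mps" where
  "dpow i = mps_const (1 / of_nat (mono_fact i)) * mmono i"

lemma mcoeff_dpow: "mcoeff (dpow i) m = (if m = i then 1 / of_nat (mono_fact i) else 0)"
  by (simp add: dpow_def mcoeff_mmono)

lemma modfun_dpow: "dpow i \<in> mod_functions"
  by (rule mod_functionsI) (simp add: mcoeff_dpow)

lemma mmono_dpow: "mps_const c * mmono i = mps_const (c * of_nat (mono_fact i)) * dpow i"
  by (rule mps_eqI) (simp add: mcoeff_dpow mcoeff_mmono)

lemma mord_dpow: "mord (mono_deg i) (dpow i)"
  by (auto simp: mord_def mcoeff_dpow)

text \<open>The pairing matrix of words with divided powers. Its entries are integral because the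
  operators preserve modified functions, so \<open>the_inv\<close> returns a genuine value.\<close>

definition E :: "'n fword \<Rightarrow> 'n mono \<Rightarrow> 'a" where
  "E w i = the_inv to_quot (P (dpow i) w)"

lemma to_quot_E: "to_quot (E w i) = P (dpow i) w"
  unfolding E_def by (intro to_quot_inv integral_P modfun_dpow)

lemma E_high_0:
  assumes "length (letters w) < mono_deg i"
  shows "E w i = 0"
proof -
  have "to_quot (E w i) = 0"
    unfolding to_quot_E by (rule Q.mcoeff_ldiffs_eq_0, rule mord_mono[OF mord_dpow]) (use assms in simp)
  thus ?thesis by simp
qed

lemma finite_E: "finite {i. E w i \<noteq> 0}"
  by (rule finite_subset[OF _ finite_mono_deg_le[of "length (letters w)"]])
    (use E_high_0 not_le_imp_less in blast)

definition cf :: "('v, 'a fract) mps \<Rightarrow> 'v mono \<Rightarrow> 'a" where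
  "cf f i = the_inv to_quot (of_nat (mono_fact i) * mcoeff f i)"

lemma to_quot_cf: "f \<in> mod_functions \<Longrightarrow> to_quot (cf f i) = of_nat (mono_fact i) * mcoeff f i"
  unfolding cf_def by (intro to_quot_inv mod_functionsD)

lemma mcont_P: "mcont (\<lambda>f. P f w)"
  by (rule mcont_coeff_comp[where k = "length (letters w)"]) (auto simp: Q.ldiffs_add Q.mord_ldiffs)

lemma P_const_mult: "P (mps_const c * f) w = c * P f w"
  by (simp add: Q.ldiffs_const_mult del: mcoeff_mult_0)

text \<open>A word of length \<open>n\<close> only sees terms of degree at most \<open>n\<close>.
  Both sides are therefore continuous in \<open>f\<close>, and monomials suffice.\<close>

lemma P_expand: "P f w = (\<Sum>i | E w i \<noteq> 0. of_nat (mono_fact i) * mcoeff f i * to_quot (E w i))"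
proof (rule mcont_eq[where f = f and S = "\<lambda>f. P f w"])
  show "mcont (\<lambda>f. \<Sum>i | E w i \<noteq> 0. of_nat (mono_fact i) * mcoeff f i * to_quot (E w i))"
    unfolding mcont_def
  proof (intro conjI allI exI impI)
    fix f :: "('n, 'a fract) mps" assume f: "mord (Suc (length (letters w))) f"
    have "mcoeff f i = 0" if "E w i \<noteq> 0" for i
      by (rule mordD[OF f]) (use E_high_0[of w i] that in linarith)
    thus "(\<Sum>i | E w i \<noteq> 0. of_nat (mono_fact i) * mcoeff f i * to_quot (E w i)) = 0"
      by (intro sum.neutral) simp
  qed (simp add: algebra_simps sum.distrib)
  fix c j
  have "(\<Sum>i | E w i \<noteq> 0. of_nat (mono_fact i) * mcoeff (mps_const c * mmono j) i * to_quot (E w i)) =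
      (\<Sum>i | E w i \<noteq> 0. if i = j then of_nat (mono_fact j) * c * to_quot (E w j) else 0)"
    by (intro sum.cong refl) (auto simp: mcoeff_mmono)
  also have "\<dots> = of_nat (mono_fact j) * c * to_quot (E w j)"
    by (simp add: finite_E)
  also have "\<dots> = P (mps_const c * mmono j) w"
    unfolding mmono_dpow P_const_mult to_quot_E by (simp only: mult_ac)
  finally show "P (mps_const c * mmono j) w =
      (\<Sum>i | E w i \<noteq> 0. of_nat (mono_fact i) * mcoeff (mps_const c * mmono j) i * to_quot (E w i))" by (rule sym)
qed (rule mcont_P)

text \<open>The action of the free algebra by left invariant differential operators.\<close>
definition Op :: "('n, 'a) tensor_alg \<Rightarrow> ('n, 'a fract) mps \<Rightarrow> ('n, 'a fract) mps" where
  "Op z f = (\<Sum>w\<in>Poly_Mapping.keys z. mps_const (to_quot (Poly_Mapping.lookup z w)) * D (letters w) f)"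

lemma Op_superset:
  assumes "finite A" "Poly_Mapping.keys z \<subseteq> A"
  shows "Op z f = (\<Sum>w\<in>A. mps_const (to_quot (Poly_Mapping.lookup z w)) * D (letters w) f)"
  unfolding Op_def using assms by (intro sum.mono_neutral_left) (auto simp: in_keys_iff)

lemma Op_add: "Op (y + z) f = Op y f + Op z f"
proof -
  let ?A = "Poly_Mapping.keys y \<union> Poly_Mapping.keys z"
  have "Op x f = (\<Sum>w\<in>?A. mps_const (to_quot (Poly_Mapping.lookup x w)) * D (letters w) f)" if "Poly_Mapping.keys x \<subseteq> ?A" for x
    by (rule Op_superset) (use that in auto)
  thus ?thesis using Poly_Mapping.keys_add[of y z]
    by (simp add: lookup_add mps_const_add algebra_simps sum.distrib)
qed

lemma Op_0 [simp]: "Op 0 f = 0" by (simp add: Op_def)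

lemma Op_single: "Op (Poly_Mapping.single w r) f = mps_const (to_quot r) * D (letters w) f"
  by (cases "r = 0") (simp_all add: Op_def)

lemma Op_sum: "Op (sum z A) f = (\<Sum>x\<in>A. Op (z x) f)"
  by (induction A rule: infinite_finite_induct) (auto simp: Op_add)

lemma Op_diff: "Op (y - z) f = Op y f - Op z f"
  using Op_add[of "y - z" z f] by simp

lemma Op_arg_add: "Op z (f + g) = Op z f + Op z g"
  by (simp add: Op_def Q.ldiffs_add algebra_simps sum.distrib)

lemma Op_mult: "Op (y * z) f = Op y (Op z f)"
proof (induction y rule: poly_mapping_induct_add)
  case (add u r y)
  have "Op (Poly_Mapping.single u r * z) f = mps_const (to_quot r) * D (letters u) (Op z f)"
  proof (induction z rule: poly_mapping_induct_add)
    case (add v s z)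
    thus ?case
      by (simp add: distrib_left Op_add Op_single mult_single plus_fword_def mps_const_mult Q.ldiffs_add
          Q.ldiffs_const_mult mult.assoc)
  qed simp
  with add show ?case by (simp add: distrib_right Op_add Op_single)
qed simp

lemma Op_lie_incl: "Op (lie_incl x) f = (\<Sum>l\<in>UNIV. mps_const (to_quot (x l)) * Q.ldiff (\<lambda>j. j) l f)"
  by (simp add: lie_incl_def Op_sum Op_single)

lemma gamma_GQ: "fgl_gamma GQ j l k = to_quot (fgl_gamma G j l k)"
  by (simp add: fgl_gamma_def)

lemma mps_const_sum: "mps_const (\<Sum>x\<in>A. h x) = (\<Sum>x\<in>A. mps_const (h x :: 'b::comm_ring_1))"
  by (induction A rule: infinite_finite_induct) (auto simp: mps_const_add)

lemma Op_rels:
  assumes "z \<in> uea_rels G"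
  shows "Op z f = 0"
proof -
  obtain x y where z: "z = lie_incl x * lie_incl y - lie_incl y * lie_incl x - lie_incl (lie_bracket G x y)"
    using assms unfolding uea_rels_def by blast
  let ?D = "\<lambda>l f. Q.ldiff (\<lambda>j. j) l f"
  have prod: "Op (lie_incl x * lie_incl y) f =
      (\<Sum>l\<in>UNIV. \<Sum>k\<in>UNIV. mps_const (to_quot (x l * y k)) * ?D l (?D k f))" for x y
    by (simp add: Op_mult Op_lie_incl Q.ldiff_sum Q.ldiff_const_mult sum_distrib_left mps_const_mult mult.assoc)
  have prod': "Op (lie_incl y * lie_incl x) f =
      (\<Sum>l\<in>UNIV. \<Sum>k\<in>UNIV. mps_const (to_quot (x l * y k)) * ?D k (?D l f))"
    unfolding prod by (subst sum.swap) (simp add: mult.commute)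
  have "Op (lie_incl (lie_bracket G x y)) f =
      (\<Sum>j\<in>UNIV. \<Sum>l\<in>UNIV. \<Sum>k\<in>UNIV. mps_const (to_quot (x l * y k)) *
        (mps_const (fgl_gamma GQ j l k - fgl_gamma GQ j k l) * ?D j f))"
    unfolding Op_lie_incl lie_bracket_def
    by (simp add: mps_const_sum sum_distrib_right gamma_GQ flip: mps_const_mult mult.assoc) (simp add: mult_ac)
  also have "\<dots> = (\<Sum>l\<in>UNIV. \<Sum>k\<in>UNIV. \<Sum>j\<in>UNIV. mps_const (to_quot (x l * y k)) *
        (mps_const (fgl_gamma GQ j l k - fgl_gamma GQ j k l) * ?D j f))"
    by (subst sum.swap, rule sum.cong[OF refl], rule sum.swap)
  also have "\<dots> = (\<Sum>l\<in>UNIV. \<Sum>k\<in>UNIV. mps_const (to_quot (x l * y k)) * (?D l (?D k f) - ?D k (?D l f)))"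
    by (simp only: Q.ldiff_bracket sum_distrib_left)
  also have "\<dots> = Op (lie_incl x * lie_incl y) f - Op (lie_incl y * lie_incl x) f"
    unfolding prod[of x y] prod' by (simp only: right_diff_distrib sum_subtractf)
  finally show ?thesis by (simp add: z Op_diff)
qed

text \<open>The elements acting as zero on every series form a two-sided ideal. Testing values at
  the origin alone would not visibly be stable under multiplication, hence the detour through
  operators.\<close>

lemma Op_ideal:
  assumes "z \<in> ideal_gen (uea_rels G)"
  shows "Op z f = 0"
proof -
  have Op0: "Op x 0 = 0" for x using Op_arg_add[of x 0 0] by simp
  have "two_sided_ideal {z. \<forall>f. Op z f = 0}"
    by (auto simp: two_sided_ideal_def Op_add Op_mult Op0)
  hence "ideal_gen (uea_rels G) \<subseteq> {z. \<forall>f. Op z f = 0}"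
    by (rule ideal_gen_minimal) (auto simp: Op_rels)
  thus ?thesis using assms by blast
qed

lemma mcoeff_Op: "mcoeff (Op z (dpow i)) 0 = to_quot (lin_ext (\<lambda>w. E w i) z)"
  by (simp add: Op_def lin_ext_def to_quot_E del: mcoeff_mult_0)

text \<open>For reasons of degree only the leading derivatives count, and the factorial they produce
  cancels the denominator in \<open>dpow\<close>.\<close>

lemma E_lead: "mono_deg j \<le> mono_deg i \<Longrightarrow> E (FWord (pbw_word (Poly_Mapping.lookup j))) i = (if i = j then 1 else 0)"
proof -
  assume "mono_deg j \<le> mono_deg i"
  hence "mord (length (pbw_word (Poly_Mapping.lookup j))) (dpow i)"
    using mord_mono[OF mord_dpow] by (simp add: length_pbw_word)
  from Q.mcoeff_ldiffs_lead[OF this]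
  have "to_quot (E (FWord (pbw_word (Poly_Mapping.lookup j))) i) = to_quot (if i = j then 1 else 0)"
    by (simp add: to_quot_E wmono_pbw_word mcoeff_dpow)
  thus ?thesis by simp
qed

text \<open>Makes \<open>kernel\<close> available: the ideal of the relations is the common kernel
  of the pairings with divided powers, which is how later identities in the enveloping algebra are
  tested.\<close>

lemma dist_basis_uea: "dist_basis (uea_rels G) E mono_deg (\<lambda>j. pbw (Poly_Mapping.lookup j))"
proof
  show "lin_ext (\<lambda>w. E w i) z = 0" if "z \<in> ideal_gen (uea_rels G)" for z i
    using Op_ideal[OF that, of "dpow i"] mcoeff_Op[of z i] by simp
  show "gen w \<in> pm.span (range (\<lambda>j :: 'n mono. pbw (Poly_Mapping.lookup j)) \<union> ideal_gen (uea_rels G))" for w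
    by (rule pbw_span)
qed (simp_all add: finite_E pbw_gen E_lead finite_mono_deg_le)

end


section \<open>The Hopf algebra of modified functions\<close>

abbreviation MF :: "('a::idom, ('v, 'a fract) mps) filtered_module" where
  "MF \<equiv> mod_functions_module"

lemma pts_MF [simp]: "pts MF = mod_functions"
  by (simp add: mod_functions_module_def)

lemma scl_MF: "scl MF r f = mps_const (to_quot r) * f"
  by (simp add: mod_functions_module_def)

lemma fil_MF: "f \<in> fil MF k \<longleftrightarrow> f \<in> mod_functions \<and> mord k f"
  by (auto simp: mod_functions_module_def mord_def) (meson not_le)

lemma scl_MF_mod: "f \<in> mod_functions \<Longrightarrow> mps_const (to_quot r) * f \<in> mod_functions"
  by (intro modfun_mult modfun_const) simp_all

lemma cont_linear_MF:
  assumes "\<And>f. f \<in> mod_functions \<Longrightarrow> T f \<in> mod_functions" "\<And>f g. T (f + g) = T f + T g"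
    "\<And>c f. T (mps_const c * f) = mps_const c * T f" "\<And>k f. mord k f \<Longrightarrow> mord k (T f)"
  shows "cont_linear MF MF T"
proof -
  have "T ` fil MF k \<subseteq> fil MF k" for k using assms by (auto simp: fil_MF)
  thus ?thesis unfolding cont_linear_def using assms by (auto simp: scl_MF)
qed

lemma cont_linear_subst:
  fixes \<sigma> :: "'v::finite \<Rightarrow> ('w, 'a::idom fract) mps"
  assumes "cfree \<sigma>" "\<And>v. \<sigma> v \<in> mod_functions"
  shows "cont_linear MF MF (\<lambda>F. mps_subst F \<sigma>)"
proof -
  have adm: "adm \<sigma>" using assms by simp
  show ?thesis
    by (rule cont_linear_MF) (simp_all add: assms modfun_subst subst_add[OF adm] subst_const_mult[OF adm] mord_subst[OF _ adm])
qed

lemma cont_bilinear_mult: "cont_bilinear MF MF (MF :: ('a::idom, ('v, 'a fract) mps) filtered_module) (*)"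
proof -
  have "f * g \<in> fil MF k" if "i + j = k" "f \<in> fil MF i" "g \<in> fil MF j" for i j k and f g :: "('v, 'a::idom fract) mps"
    using that by (auto simp: fil_MF modfun_mult mord_mult)
  hence "\<exists>l. \<forall>i j. i + j = l \<longrightarrow> (\<forall>f\<in>fil MF i. \<forall>g\<in>fil MF j. f * g \<in> fil (MF :: ('a, ('v, 'a fract) mps) filtered_module) k)" for k
    by blast
  thus ?thesis
    unfolding cont_bilinear_def bilinear_on_def by (simp add: modfun_mult distrib_left distrib_right scl_MF mult_ac)
qed

lemma subst_mten:
  "adm \<sigma> \<Longrightarrow> mps_subst (mten f g) \<sigma> = mps_subst f (\<lambda>v. \<sigma> (Inl v)) * mps_subst g (\<lambda>w. \<sigma> (Inr w))"
  for f :: "('v::finite, 'a::comm_ring_1) mps" and g :: "('w::finite, 'a) mps"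
  by (simp only: subst_mult subst_rename)

lemma modfun_mten: "f \<in> mod_functions \<Longrightarrow> g \<in> mod_functions \<Longrightarrow> mten f g \<in> mod_functions"
  for f :: "('v::finite, 'a::idom fract) mps" and g :: "('w::finite, 'a fract) mps"
  by (intro modfun_mult modfun_rename)

lemma bij_mjoin: "bij (\<lambda>(i, j). mjoin i j)"
proof (rule bijI)
  show "surj (\<lambda>(i, j). mjoin i j)"
    by (rule surjI[of _ "\<lambda>m. (mpull Inl m, mpull Inr m)"]) simp
qed (auto simp: inj_def)

context domain_group
begin

lemma coord_MF: "coord_module (MF :: ('a, ('v::finite, 'a fract) mps) filtered_module) mono_deg cf"
proof -
  have mod: "module (scl (MF :: ('a, ('v, 'a fract) mps) filtered_module))"
    by unfold_locales (simp_all add: scl_MF algebra_simps mps_const_add mps_const_mult)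
  show ?thesis
  proof (intro coord_module.intro mod coord_module_axioms.intro)
    show "module.subspace (scl MF) (pts (MF :: ('a, ('v, 'a fract) mps) filtered_module))"
      by (rule module.subspaceI[OF mod]) (auto simp: modfun_add scl_MF scl_MF_mod)
    fix x y :: "('v, 'a fract) mps" and i k r n
    show "cf (x + y) i = cf x i + cf y i" if "x \<in> pts MF" "y \<in> pts MF"
    proof -
      have "to_quot (cf (x + y) i) = to_quot (cf x i + cf y i)"
        using that by (simp add: to_quot_cf modfun_add algebra_simps)
      thus ?thesis by (simp only: to_quot_inject)
    qed
    show "cf (scl MF r x) i = r * cf x i" if "x \<in> pts MF"
    proof -
      have "to_quot (cf (scl MF r x) i) = to_quot (r * cf x i)"
        using that by (simp add: to_quot_cf scl_MF scl_MF_mod)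
      thus ?thesis by (simp only: to_quot_inject)
    qed
    have cf0: "cf x m = 0 \<longleftrightarrow> mcoeff x m = 0" if "x \<in> mod_functions" for x :: "('v, 'a fract) mps" and m
      using to_quot_cf[OF that, of m] by (metis mono_fact_nonzero mult_eq_0_iff of_nat_fract_eq_0 to_quot_eq_0)
    show "x \<in> fil MF k \<longleftrightarrow> x \<in> pts MF \<and> (\<forall>i. mono_deg i < k \<longrightarrow> cf x i = 0)"
      by (auto simp: fil_MF mord_def cf0)
    show "finite {i :: 'v mono. mono_deg i \<le> n}" by (rule finite_mono_deg_le)
    let ?g = "\<lambda>x :: 'v mono \<Rightarrow> 'a. Abs_mps (\<lambda>m. to_quot (x m) / of_nat (mono_fact m)) :: ('v, 'a fract) mps"
    have g: "?g x \<in> mod_functions" for x by (rule mod_functionsI) simp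
    show "bij_betw cf (pts MF) (UNIV :: ('v mono \<Rightarrow> 'a) set)"
    proof (rule bij_betw_byWitness[where f' = ?g])
      show "\<forall>f\<in>pts MF. ?g (cf f) = f"
        by (auto simp: to_quot_cf intro: mps_eqI)
      show "\<forall>x\<in>UNIV. cf (?g x) = x"
      proof (intro ballI ext)
        fix x :: "'v mono \<Rightarrow> 'a" and m
        have "to_quot (cf (?g x) m) = to_quot (x m)" by (simp only: to_quot_cf[OF g]) simp
        thus "cf (?g x) m = x m" by (simp only: to_quot_inject)
      qed
    qed (use g in auto)
  qed
qed

lemma cf_mult:
  assumes "F \<in> mod_functions" "f \<in> mod_functions" "g \<in> mod_functions"
    "mcoeff F m = mcoeff f i * mcoeff g j" "mono_fact m = mono_fact i * mono_fact j"
  shows "cf F m = cf f i * cf g j"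
proof -
  have "to_quot (cf F m) = to_quot (cf f i * cf g j)"
    unfolding to_quot_simps to_quot_cf[OF assms(1)] to_quot_cf[OF assms(2)] to_quot_cf[OF assms(3)] assms(4,5)
    by simp
  thus ?thesis by (simp only: to_quot_inject)
qed

definition cf2 :: "('v::finite + 'w::finite, 'a fract) mps \<Rightarrow> 'v mono \<times> 'w mono \<Rightarrow> 'a" where
  "cf2 F = (\<lambda>(i, j). cf F (mjoin i j))"

lemma coord_MF2: "coord_module (MF :: ('a, ('v::finite + 'w::finite, 'a fract) mps) filtered_module)
    (\<lambda>(i, j). mono_deg i + mono_deg j) cf2"
proof -
  have c: "cf2 = (\<lambda>F ij. cf F (case ij of (i :: 'v mono, j :: 'w mono) \<Rightarrow> mjoin i j))"
    by (simp add: fun_eq_iff cf2_def)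
  have d: "(\<lambda>(i, j). mono_deg i + mono_deg j) = (\<lambda>ij. mono_deg (case ij of (i :: 'v mono, j :: 'w mono) \<Rightarrow> mjoin i j))"
    by (simp add: fun_eq_iff)
  show ?thesis unfolding c d by (rule coord_module_reindex[OF coord_MF bij_mjoin])
qed

lemma cf2_mten:
  assumes "f \<in> mod_functions" "g \<in> mod_functions"
  shows "cf2 (mten f g) (i, j) = cf f i * cf g j"
  unfolding cf2_def prod.case by (rule cf_mult) (simp_all add: assms modfun_mten mcoeff_mten)

lemma completed_MF:
  "is_completed_tensor MF MF (MF :: ('a, ('v::finite + 'w::finite, 'a fract) mps) filtered_module) mten"
proof -
  interpret t: coord_tensor MF mono_deg cf MF mono_deg cf "MF :: ('a, ('v + 'w, 'a fract) mps) filtered_module" cf2 mten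
    by (intro coord_tensor.intro coord_MF coord_MF2 coord_tensor_axioms.intro) (simp_all add: modfun_mten cf2_mten)
  show ?thesis by (rule t.completed_tensor)
qed

abbreviation mten3 :: "('n + 'n, 'a fract) mps \<Rightarrow> ('n, 'a fract) mps \<Rightarrow> ('n + ('n + 'n), 'a fract) mps" where
  "mten3 p h \<equiv> mps_rename (case_sum Inl (Inr \<circ> Inl)) p * mps_rename (Inr \<circ> Inr) h"

definition cf3 :: "('n + ('n + 'n), 'a fract) mps \<Rightarrow> 'n mono \<times> 'n mono \<times> 'n mono \<Rightarrow> 'a" where
  "cf3 F = (\<lambda>(i, j, k). cf F (mjoin i (mjoin j k)))"

lemma coord_MF3: "coord_module MF (\<lambda>(i, jk). mono_deg i + (case jk of (j, k) \<Rightarrow> mono_deg j + mono_deg k)) cf3"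
proof -
  have "bij (\<lambda>(i, j, k). mjoin i (mjoin j k) :: ('n + ('n + 'n)) mono)"
  proof (rule bijI)
    show "surj (\<lambda>(i, j, k). mjoin i (mjoin j k) :: ('n + ('n + 'n)) mono)"
      by (rule surjI[of _ "\<lambda>m. (mpull Inl m, mpull Inl (mpull Inr m), mpull Inr (mpull Inr m))"]) simp
  qed (auto simp: inj_def)
  note reindex = coord_module_reindex[OF coord_MF this]
  have c: "cf3 = (\<lambda>F ijk. cf F (case ijk of (i, j, k) \<Rightarrow> mjoin i (mjoin j k)))"
    by (simp add: fun_eq_iff cf3_def)
  have d: "(\<lambda>(i, jk). mono_deg i + (case jk of (j, k) \<Rightarrow> mono_deg j + mono_deg k)) =
      (\<lambda>ijk. mono_deg (case ijk of (i :: 'n mono, j :: 'n mono, k :: 'n mono) \<Rightarrow> mjoin i (mjoin j k)))"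
    by (simp add: fun_eq_iff)
  show ?thesis unfolding c d by (rule reindex)
qed

lemma cf3_tenr:
  assumes "f \<in> mod_functions" "p \<in> mod_functions"
  shows "cf3 (mten f p) (i, jk) = cf f i * cf2 p jk"
proof -
  obtain j k where jk: "jk = (j, k)" by force
  show ?thesis unfolding cf3_def cf2_def jk prod.case by (rule cf_mult) (simp_all add: assms modfun_mten mcoeff_mten)
qed

lemma cf3_tenl:
  assumes "p \<in> mod_functions" "h \<in> mod_functions"
  shows "cf3 (mten3 p h) (i, j, k) = cf2 p (i, j) * cf h k"
proof -
  have inj: "inj (case_sum Inl (Inr \<circ> Inl) :: 'n + 'n \<Rightarrow> 'n + ('n + 'n))"
    by (auto simp: inj_def split: sum.splits)
  have disj: "range (case_sum Inl (Inr \<circ> Inl) :: 'n + 'n \<Rightarrow> 'n + ('n + 'n)) \<inter> range (Inr \<circ> Inr) = {}"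
    by (auto split: sum.splits)
  have "u \<in> range (case_sum Inl (Inr \<circ> Inl)) \<union> range (Inr \<circ> Inr)" for u :: "'n + ('n + 'n)"
  proof (cases u)
    case (Inl i)
    thus ?thesis by (intro UnI1 range_eqI[of _ _ "Inl i"]) simp
  next
    case (Inr v)
    show ?thesis
    proof (cases v)
      case (Inl j)
      thus ?thesis by (intro UnI1 range_eqI[of _ _ "Inr j"]) (simp add: \<open>u = Inr v\<close>)
    next
      case (Inr k)
      thus ?thesis by (intro UnI2 range_eqI[of _ _ k]) (simp add: \<open>u = Inr v\<close>)
    qed
  qed
  hence cover: "range (case_sum Inl (Inr \<circ> Inl)) \<union> range (Inr \<circ> Inr) = (UNIV :: ('n + ('n + 'n)) set)"
    by blast
  have "mcoeff (mten3 p h) m = mcoeff p (mpull (case_sum Inl (Inr \<circ> Inl)) m) * mcoeff h (mpull (Inr \<circ> Inr) m)" for m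
    by (rule mcoeff_rename_mult[OF inj _ disj cover]) (simp add: inj_def)
  moreover have "mpull (case_sum Inl (Inr \<circ> Inl)) (mjoin i (mjoin j k)) = mjoin i j"
    "mpull (Inr \<circ> Inr) (mjoin i (mjoin j k)) = k"
    by (rule poly_mapping_eqI; simp split: sum.split)+
  ultimately show ?thesis
    unfolding cf3_def cf2_def prod.case
    by (intro cf_mult) (simp_all add: assms modfun_mult modfun_rename)
qed

text \<open>Cubes are indexed by triples nested to the right; this relabelling serves the other
  bracketing.\<close>

lemma bij_assoc: "bij (\<lambda>((i, j), k). (i, j, k))"
  by (rule bij_betw_byWitness[where f' = "\<lambda>(i, j, k). ((i, j), k)"]) auto

lemma completed_MF3: "is_completed_tensor MF MF MF mten3"
proof -
  have "coord_module MF (\<lambda>(ij, k). (case ij of (i, j) \<Rightarrow> mono_deg i + mono_deg j) + mono_deg k)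
      (\<lambda>F ((i, j), k). cf3 F (i, j, k))"
    using coord_module_reindex[OF coord_MF3 bij_assoc] by (simp add: case_prod_unfold add.assoc)
  then interpret t: coord_tensor MF "\<lambda>(i, j). mono_deg i + mono_deg j" cf2 MF mono_deg cf
      MF "\<lambda>F ((i, j), k). cf3 F (i, j, k)" mten3
    by (intro coord_tensor.intro coord_MF coord_MF2 coord_tensor_axioms.intro)
      (auto simp: cf3_tenl modfun_mult modfun_rename)
  show ?thesis by (rule t.completed_tensor)
qed

abbreviation s :: "'n \<Rightarrow> ('n, 'a fract) mps" where
  "s \<equiv> \<lambda>j. mapq (fgl_inverse G j)"

lemma cfree_s: "cfree s"
  using R.cfree_inverse by simp

lemma app_s: "fgl_app GQ mps_var s = (\<lambda>_. 0)" "fgl_app GQ s mps_var = (\<lambda>_. 0)"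
proof -
  have v: "(\<lambda>j. mapq (mps_var j)) = (mps_var :: 'n \<Rightarrow> ('n, 'a fract) mps)" by simp
  show "fgl_app GQ mps_var s = (\<lambda>_. 0)"
    using arg_cong[OF R.inverse_right, of "\<lambda>F j. mapq (F j)"] R.cfree_inverse by (simp add: mapq_fgl_app fun_eq_iff)
  show "fgl_app GQ s mps_var = (\<lambda>_. 0)"
    using arg_cong[OF R.inverse_left, of "\<lambda>F j. mapq (F j)"] R.cfree_inverse by (simp add: mapq_fgl_app fun_eq_iff)
qed

lemma subst_comult:
  assumes "cfree A" "cfree B"
  shows "mps_subst (mps_subst f GQ) (case_sum A B) = mps_subst f (fgl_app GQ A B)"
  using assms Q.cfree_G cfree_case_sum[OF assms] unfolding fgl_app_def by (simp add: subst_subst)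

lemma modfun_subst_GQ: "x \<in> mod_functions \<Longrightarrow> mps_subst x GQ \<in> mod_functions"
  by (rule modfun_subst) (use Q.cfree_G in simp_all)

lemma inv_counit: "x \<in> mod_functions \<Longrightarrow> to_quot (the_inv to_quot (mcoeff x 0)) = mcoeff x 0"
  using mod_functionsD[of x 0] by (simp add: to_quot_inv)

lemma MF_sel:
  "mdl (mod_functions_hopf G) = MF" "sq (mod_functions_hopf G) = MF" "cube (mod_functions_hopf G) = MF"
  "ten (mod_functions_hopf G) = mten" "tenl (mod_functions_hopf G) = mten3" "tenr (mod_functions_hopf G) = mten"
  "mul (mod_functions_hopf G) = (*)" "unt (mod_functions_hopf G) = 1"
  "comul (mod_functions_hopf G) = (\<lambda>f. mps_subst f GQ)"
  "counit (mod_functions_hopf G) = (\<lambda>f. the_inv to_quot (mcoeff f 0))"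
  "antipode (mod_functions_hopf G) = (\<lambda>f. mps_subst f s)"
  by (simp_all add: mod_functions_hopf_def)

text \<open>Except for the product on the square, which is multiplication of series, the required
  maps on tensor products are substitutions: \<open>G(A, B)\<close> and \<open>C\<close>, or
  \<open>A\<close> and \<open>G(B, C)\<close>, for coassociativity, 0 in one block for the counit,
  \<open>s\<close> in one block for the antipode. The axioms then reduce to the laws of the formal
  group.\<close>

theorem hopf_MF: "complete_hopf_algebra (mod_functions_hopf G)"
  unfolding complete_hopf_algebra_def MF_sel pts_MF
proof (intro conjI)
  show "complete_module (MF :: ('a, ('n, 'a fract) mps) filtered_module)"
    by (rule coord_module.complete[OF coord_MF])
  show "is_completed_tensor MF MF MF (mten :: ('n, 'a fract) mps \<Rightarrow> ('n, 'a fract) mps \<Rightarrow> _)"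
    "is_completed_tensor MF MF MF (mten :: ('n, 'a fract) mps \<Rightarrow> ('n + 'n, 'a fract) mps \<Rightarrow> _)"
    by (rule completed_MF)+
  show "is_completed_tensor MF MF MF mten3" by (rule completed_MF3)
  have c1: "Inr \<circ> Inl = (\<lambda>x. Inr (Inl x))" "Inr \<circ> Inr = (\<lambda>x. Inr (Inr x))" by auto
  have c2: "case_sum Inl (Inr \<circ> Inl) \<circ> Inl = Inl" "case_sum Inl (Inr \<circ> Inl) \<circ> Inr = Inr \<circ> Inl"
    by (simp_all add: fun_eq_iff)
  show "\<forall>x\<in>mod_functions. \<forall>y\<in>mod_functions. \<forall>z\<in>mod_functions. mten3 (mten x y) z = mten x (mten y z)"
    by (simp add: rename_hom rename_rename c2 mult.assoc)
  show "cont_linear MF MF (\<lambda>f. mps_subst f GQ)"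
    by (rule cont_linear_subst) (use Q.cfree_G in simp_all)
  show "cont_linear MF MF (\<lambda>f. mps_subst f s)"
    by (rule cont_linear_subst) (use cfree_s in simp_all)
  \<comment> \<open>The generic points of the three blocks of the cube.\<close>
  let ?A = "\<lambda>j. mps_var (Inl j) :: ('n + ('n + 'n), 'a fract) mps"
    and ?B = "\<lambda>j. mps_var (Inr (Inl j)) :: ('n + ('n + 'n), 'a fract) mps"
    and ?C = "\<lambda>j. mps_var (Inr (Inr j)) :: ('n + ('n + 'n), 'a fract) mps"
  have ABC: "cfree ?A" "cfree ?B" "cfree ?C" by simp_all
  have AB: "mps_rename (case_sum Inl (Inr \<circ> Inl)) (GQ j) = fgl_app GQ ?A ?B j" for j
    by (simp add: mps_rename_def fgl_app_def case_sum_o[of mps_var] c1 flip: case_sum_o)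
  have BC: "mps_rename Inr (GQ j) = fgl_app GQ ?B ?C j" for j
  proof -
    have "(\<lambda>v. mps_var (Inr v)) = case_sum ?B ?C" by (auto split: sum.split)
    thus ?thesis by (simp add: mps_rename_def fgl_app_def)
  qed
  have cG: "cfree GQ" by (rule Q.cfree_G)
  show "\<exists>L R. cont_linear MF MF L \<and> cont_linear MF MF R \<and>
       (\<forall>x\<in>mod_functions. \<forall>y\<in>mod_functions.
          L (mten x y) = mten3 (mps_subst x GQ) y \<and> R (mten x y) = mten x (mps_subst y GQ)) \<and>
       (\<forall>x\<in>mod_functions. L (mps_subst x GQ) = R (mps_subst x GQ))"
  proof (intro exI conjI ballI)
    let ?L = "\<lambda>F. mps_subst F (case_sum (fgl_app GQ ?A ?B) ?C)" and ?R = "\<lambda>F. mps_subst F (case_sum ?A (fgl_app GQ ?B ?C))"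
    have cL: "cfree (case_sum (fgl_app GQ ?A ?B) ?C)" "cfree (case_sum ?A (fgl_app GQ ?B ?C))"
      by (intro cfree_case_sum Q.cfree_app ABC)+
    have m: "fgl_app GQ ?A ?B j \<in> mod_functions" "fgl_app GQ ?B ?C j \<in> mod_functions" for j
      unfolding AB[symmetric] BC[symmetric] by (rule modfun_rename, simp)+
    show "cont_linear MF MF ?L" "cont_linear MF MF ?R"
      by (rule cont_linear_subst[OF cL(1)], simp add: m split: sum.split, rule cont_linear_subst[OF cL(2)], simp add: m split: sum.split)
    fix x :: "('n, 'a fract) mps"
    show "?L (mps_subst x GQ) = ?R (mps_subst x GQ)"
      unfolding subst_comult[OF Q.cfree_app[OF ABC(1,2)] ABC(3)] subst_comult[OF ABC(1) Q.cfree_app[OF ABC(2,3)]] Q.app_assoc[OF ABC] ..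
    fix y :: "('n, 'a fract) mps"
    have adm: "adm (case_sum (fgl_app GQ ?A ?B) ?C)" "adm (case_sum ?A (fgl_app GQ ?B ?C))" using cL by simp_all
    show "?L (mten x y) = mten3 (mps_subst x GQ) y"
      unfolding subst_mten[OF adm(1)] by (simp add: rename_subst[OF cG] AB) (simp add: mps_rename_def)
    show "?R (mten x y) = mten x (mps_subst y GQ)"
      unfolding subst_mten[OF adm(2)] by (simp add: rename_subst[OF cG] BC) (simp add: mps_rename_def)
  qed
  show "cont_linear MF \<lparr>scl = (*), fil = (\<lambda>i. if i = 0 then UNIV else {0})\<rparr> (\<lambda>f :: ('n, 'a fract) mps. the_inv to_quot (mcoeff f 0))"
  proof -
    \<comment> \<open>The counit is the coordinate at exponent 0, hence linear and zero on the first
      filtration step.\<close>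
    have eq: "the_inv to_quot (mcoeff f 0) = cf f 0" for f :: "('n, 'a fract) mps" by (simp add: cf_def)
    interpret coord_module "MF :: ('a, ('n, 'a fract) mps) filtered_module" mono_deg cf by (rule coord_MF)
    have "(\<lambda>f. cf f 0) ` fil (MF :: ('a, ('n, 'a fract) mps) filtered_module) 1 \<subseteq> {0}"
      using filD[of _ 1 0] by auto
    thus ?thesis unfolding cont_linear_def eq using c_add c_scl by fastforce
  qed
  have cv: "cfree (mps_var :: 'n \<Rightarrow> ('n, 'a fract) mps)" and c0: "cfree (\<lambda>_ :: 'n. 0 :: ('n, 'a fract) mps)" by simp_all
  show "\<exists>L R. cont_linear MF MF L \<and> cont_linear MF MF R \<and>
       (\<forall>x\<in>mod_functions. \<forall>y\<in>mod_functions.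
          L (mten x y) = scl MF (the_inv to_quot (mcoeff x 0)) y \<and> R (mten x y) = scl MF (the_inv to_quot (mcoeff y 0)) x) \<and>
       (\<forall>x\<in>mod_functions. L (mps_subst x GQ) = x \<and> R (mps_subst x GQ) = x)"
  proof (intro exI conjI ballI)
    let ?l = "case_sum (\<lambda>_. 0) mps_var :: 'n + 'n \<Rightarrow> ('n, 'a fract) mps" and ?r = "case_sum mps_var (\<lambda>_. 0) :: 'n + 'n \<Rightarrow> ('n, 'a fract) mps"
    show "cont_linear MF MF (\<lambda>F. mps_subst F ?l)" "cont_linear MF MF (\<lambda>F. mps_subst F ?r)"
      by (rule cont_linear_subst, simp, simp split: sum.split)+
    fix x :: "('n, 'a fract) mps" assume x: "x \<in> mod_functions"
    show "mps_subst (mps_subst x GQ) ?l = x" "mps_subst (mps_subst x GQ) ?r = x"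
      unfolding subst_comult[OF c0 cv] subst_comult[OF cv c0] Q.app_0_left[OF cv] Q.app_0_right[OF cv] by (rule subst_id)+
    fix y :: "('n, 'a fract) mps" assume y: "y \<in> mod_functions"
    have adm: "adm ?l" "adm ?r" by simp_all
    show "mps_subst (mten x y) ?l = scl MF (the_inv to_quot (mcoeff x 0)) y" "mps_subst (mten x y) ?r = scl MF (the_inv to_quot (mcoeff y 0)) x"
      unfolding subst_mten[OF adm(1)] subst_mten[OF adm(2)] scl_MF inv_counit[OF x] inv_counit[OF y]
      by (simp_all add: subst_zero subst_id mult.commute)
  qed
  show "\<exists>M. cont_bilinear MF MF MF M \<and>
       (\<forall>x\<in>mod_functions. \<forall>y\<in>mod_functions. \<forall>x'\<in>mod_functions. \<forall>y'\<in>mod_functions.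
          M (mten x y) (mten x' y') = mten (x * x') (y * y')) \<and>
       (\<forall>x\<in>mod_functions. \<forall>y\<in>mod_functions. mps_subst (x * y) GQ = M (mps_subst x GQ) (mps_subst y GQ))"
    using cG by (intro exI[of _ "(*)"] conjI cont_bilinear_mult) (simp_all add: rename_hom subst_mult mult_ac)
  show "\<exists>L R. cont_linear MF MF L \<and> cont_linear MF MF R \<and>
       (\<forall>x\<in>mod_functions. \<forall>y\<in>mod_functions.
          L (mten x y) = mps_subst x s * y \<and> R (mten x y) = x * mps_subst y s) \<and>
       (\<forall>x\<in>mod_functions.
          L (mps_subst x GQ) = scl MF (the_inv to_quot (mcoeff x 0)) 1 \<and>
          R (mps_subst x GQ) = scl MF (the_inv to_quot (mcoeff x 0)) 1)"
  proof (intro exI conjI ballI)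
    let ?l = "case_sum s mps_var :: 'n + 'n \<Rightarrow> ('n, 'a fract) mps" and ?r = "case_sum mps_var s :: 'n + 'n \<Rightarrow> ('n, 'a fract) mps"
    have c: "cfree ?l" "cfree ?r" by (intro cfree_case_sum cv cfree_s)+
    show "cont_linear MF MF (\<lambda>F. mps_subst F ?l)" "cont_linear MF MF (\<lambda>F. mps_subst F ?r)"
      by (rule cont_linear_subst[OF c(1)], simp split: sum.split, rule cont_linear_subst[OF c(2)], simp split: sum.split)
    fix x :: "('n, 'a fract) mps" assume x: "x \<in> mod_functions"
    show "mps_subst (mps_subst x GQ) ?l = scl MF (the_inv to_quot (mcoeff x 0)) 1" "mps_subst (mps_subst x GQ) ?r = scl MF (the_inv to_quot (mcoeff x 0)) 1"
      unfolding subst_comult[OF cfree_s cv] subst_comult[OF cv cfree_s] app_s scl_MF inv_counit[OF x] by (simp_all add: subst_zero)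
    fix y :: "('n, 'a fract) mps"
    have adm: "adm ?l" "adm ?r" using c by simp_all
    show "mps_subst (mten x y) ?l = mps_subst x s * y" "mps_subst (mten x y) ?r = x * mps_subst y s"
      unfolding subst_mten[OF adm(1)] subst_mten[OF adm(2)] by (simp_all add: subst_id)
  qed
  show "\<forall>x\<in>mod_functions. \<forall>y\<in>mod_functions. the_inv to_quot (mcoeff (x * y :: ('n, 'a fract) mps) 0) =
      (the_inv to_quot (mcoeff x 0) * the_inv to_quot (mcoeff y 0) :: 'a)"
  proof (intro ballI)
    fix x y :: "('n, 'a fract) mps" assume xy: "x \<in> mod_functions" "y \<in> mod_functions"
    have "to_quot (the_inv to_quot (mcoeff (x * y) 0)) = to_quot (the_inv to_quot (mcoeff x 0) * the_inv to_quot (mcoeff y 0))"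
      by (simp only: to_quot_simps inv_counit modfun_mult xy) simp
    thus "the_inv to_quot (mcoeff (x * y) 0) = (the_inv to_quot (mcoeff x 0) * the_inv to_quot (mcoeff y 0) :: 'a)"
      by (simp only: to_quot_inject)
  qed
  show "the_inv to_quot (mcoeff (1 :: ('n, 'a fract) mps) 0) = (1 :: 'a)"
    using inv_to_quot[of 1] by (simp add: mcoeff_1)
qed (use Q.cfree_G in \<open>simp_all add: cont_bilinear_mult mult.assoc subst_1 rename_hom\<close>)

end


section \<open>The dual of the universal enveloping algebra\<close>

context dist_basis
begin

text \<open>Presents a coordinate as the functional of an indicator family, which will be the
  coefficient family of a divided power; elements can then be tested by identities for
  functions.\<close>

lemma EE_ev: "EE z i = lin_ext (ev (\<lambda>j. if j = i then 1 else 0)) z"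
proof -
  have "E w i = ev (\<lambda>j. if j = i then 1 else 0) w" for w
  proof -
    have "ev (\<lambda>j. if j = i then 1 else 0) w = (\<Sum>j | E w j \<noteq> 0. if j = i then E w i else 0)"
      unfolding ev_def by (intro sum.cong) auto
    thus ?thesis by (simp add: finite_E)
  qed
  thus ?thesis by simp
qed

lemma ev_ideal: "z \<in> ideal_gen S \<Longrightarrow> lin_ext (ev x) z = 0"
  by (simp add: lin_ext_ev E_ideal)

lemma functional_eq_of_coords:
  assumes "\<And>z. h (cls S z) = lin_ext (ev x) z"
  shows "functional S h = of_coords x"
proof
  fix C show "functional S h C = of_coords x C"
  proof (cases "C \<in> quot_carrier S")
    case True
    then obtain z where "C = cls S z" by (auto simp: quot_carrier_def)
    thus ?thesis by (simp add: assms of_coords(2))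
  next
    case False
    thus ?thesis by (simp add: functional_def of_coords_def)
  qed
qed

end

lemma lin_ext_alg_ext: "lin_ext g (alg_ext c z) = lin_ext (\<lambda>w. lin_ext g (c w)) z"
  unfolding alg_ext_def lin_ext_sum mult_map_scale_conv_mult[symmetric] lin_ext_scale
  by (simp add: lin_ext_def)

text \<open>A linear map whose transpose preserves coordinate functionals descends to the quotients.\<close>
lemma on_cls_alg_ext:
  assumes "dist_basis S E d b" "dist_basis S' E' d' b'"
    and c: "\<And>i w. lin_ext (\<lambda>v. E' v i) (c w) = dist_basis.ev E (T i) w"
  shows "on_cls (\<lambda>x. cls S' (alg_ext c x)) (cls S z) = cls S' (alg_ext c z)"
proof (rule on_cls_cls)
  interpret A: dist_basis S E d b by fact
  interpret B: dist_basis S' E' d' b' by fact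
  fix y assume y: "y - z \<in> ideal_gen S"
  show "cls S' (alg_ext c y) = cls S' (alg_ext c z)"
    unfolding cls_eq_iff
  proof (rule B.kernel)
    fix i
    have "B.EE (alg_ext c y - alg_ext c z) i = lin_ext (A.ev (T i)) (y - z)"
      unfolding lin_ext_diff lin_ext_alg_ext c ..
    thus "B.EE (alg_ext c y - alg_ext c z) i = 0" by (simp add: A.ev_ideal[OF y])
  qed
qed

lemma ev_pair:
  assumes "dist_basis S E d b" "dist_basis S' E' d' b'"
  shows "dist_basis.ev (\<lambda>(v, w) (i, j). E v i * E' w j) x (v, w) =
    (\<Sum>i | E v i \<noteq> 0. \<Sum>j | E' w j \<noteq> 0. x (i, j) * (E v i * E' w j))"
proof -
  interpret A: dist_basis S E d b by fact
  interpret B: dist_basis S' E' d' b' by fact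
  interpret T: dist_basis "tensor_ideal S S'" "\<lambda>(v, w) (i, j). E v i * E' w j" "\<lambda>(i, j). d i + d' j" "\<lambda>(i, j). outer (b i) (b' j)"
    by (rule dist_basis_tensor) fact+
  have "T.ev x (v, w) = (\<Sum>ij\<in>{i. E v i \<noteq> 0} \<times> {j. E' w j \<noteq> 0}. x ij * (E v (fst ij) * E' w (snd ij)))"
    unfolding T.ev_def by (rule sum.mono_neutral_cong_left) (auto simp: A.finite_E B.finite_E)
  thus ?thesis by (simp add: sum.cartesian_product')
qed

lemma ev_tensor:
  assumes "dist_basis S E d b" "dist_basis S' E' d' b'"
  shows "dist_basis.ev (\<lambda>(v, w) (i, j). E v i * E' w j) (\<lambda>(i, j). a i * a' j) (v, w) =
    dist_basis.ev E a v * dist_basis.ev E' a' w"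
proof -
  interpret A: dist_basis S E d b by fact
  interpret B: dist_basis S' E' d' b' by fact
  show ?thesis
    unfolding ev_pair[OF assms] A.ev_def B.ev_def sum_product by (simp add: mult_ac)
qed

lemma coord_filt_iso':
  assumes M: "coord_module M d c" and N: "coord_module N d c'"
    and f: "\<And>x. x \<in> pts M \<Longrightarrow> f x \<in> pts N" "\<And>x i. x \<in> pts M \<Longrightarrow> c' (f x) i = c x i"
  shows "filt_iso M N f"
proof -
  interpret M: coord_module M d c by fact
  interpret N: coord_module N d c' by fact
  have eq: "N.of_coord (c x) = f x" if "x \<in> pts M" for x
    by (rule N.coord_eqI) (simp_all add: f that)
  note iso = coord_filt_iso[OF M N]
  have img: "(\<lambda>x. N.of_coord (c x)) ` fil M k = f ` fil M k" for k
    by (rule image_cong[OF refl eq[OF M.fil_pts]])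
  have bij: "bij_betw f (pts M) (pts N)"
    using filt_iso_bij[OF iso] bij_betw_cong[of "pts M" "\<lambda>x. N.of_coord (c x)" f "pts N"] eq by blast
  show ?thesis
    unfolding filt_iso_def
  proof (intro conjI allI ballI bij)
    show "fil M k \<subseteq> pts M" for k by (rule filt_iso_sub[OF iso])
    show "fil N k = f ` fil M k" for k unfolding img[symmetric] by (rule filt_iso_img[OF iso])
    fix x assume x: "x \<in> pts M"
    show "scl M r x \<in> pts M" for r by (rule M.pts_scl[OF x])
    show "f (scl M r x) = scl N r (f x)" for r
      unfolding eq[OF x, symmetric] eq[OF M.pts_scl[OF x], symmetric] by (rule filt_iso_scl[OF iso x])
    fix y assume y: "y \<in> pts M"
    show "x + y \<in> pts M" by (rule M.pts_add[OF x y])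
    show "f (x + y) = f x + f y"
      unfolding eq[OF x, symmetric] eq[OF y, symmetric] eq[OF M.pts_add[OF x y], symmetric]
      by (rule filt_iso_add[OF iso x y])
  qed
qed

lemma all_lookup: "(\<forall>j :: 'n::finite \<Rightarrow> nat. Q j) \<longleftrightarrow> (\<forall>i :: 'n mono. Q (Poly_Mapping.lookup i))"
  by (metis lookup_Abs_finite)

lemma expo_deg_lookup: "expo_deg (Poly_Mapping.lookup i) = mono_deg i"
  by (simp add: expo_deg_def mono_deg_finite)

section \<open>Structure maps of the enveloping algebra, transposed to modified functions\<close>

context domain_group
begin

sublocale U: dist_basis "uea_rels G" E mono_deg "\<lambda>j. pbw (Poly_Mapping.lookup j)"
  by (rule dist_basis_uea)

abbreviation E2 :: "'n fword \<times> 'n fword \<Rightarrow> 'n mono \<times> 'n mono \<Rightarrow> 'a" where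
  "E2 \<equiv> \<lambda>(v, w) (i, j). E v i * E w j"

abbreviation d2 :: "'n mono \<times> 'n mono \<Rightarrow> nat" where
  "d2 \<equiv> \<lambda>(i, j). mono_deg i + mono_deg j"

abbreviation b2 :: "'n mono \<times> 'n mono \<Rightarrow> 'n fword \<times> 'n fword \<Rightarrow>\<^sub>0 'a" where
  "b2 \<equiv> \<lambda>(i, j). outer (pbw (Poly_Mapping.lookup i)) (pbw (Poly_Mapping.lookup j))"

sublocale U2: dist_basis "uea_rels2 G" E2 d2 b2
  unfolding uea_rels2_def by (rule dist_basis_tensor[OF dist_basis_uea dist_basis_uea])

abbreviation E3 :: "'n fword \<times> ('n fword \<times> 'n fword) \<Rightarrow> 'n mono \<times> ('n mono \<times> 'n mono) \<Rightarrow> 'a" where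
  "E3 \<equiv> \<lambda>(v, w) (i, j). E v i * E2 w j"

sublocale U3: dist_basis "uea_rels3 G" E3 "\<lambda>(i, j). mono_deg i + d2 j" "\<lambda>(i, j). outer (pbw (Poly_Mapping.lookup i)) (b2 j)"
  unfolding uea_rels3_def by (rule dist_basis_tensor[OF dist_basis_uea U2.dist_basis_axioms])

lemma coord_U: "coord_module (uea_dual_module G) mono_deg U.coord"
  and pts_U: "pts (uea_dual_module G) = quot_dual (uea_rels G)"
  by (rule U.coord_module_dual; simp add: uea_dual_module_def all_lookup expo_deg_lookup)+

lemma coord_U2: "coord_module (uea_dual2_module G) d2 U2.coord"
  and pts_U2: "pts (uea_dual2_module G) = quot_dual (uea_rels2 G)"
  by (rule U2.coord_module_dual; simp add: uea_dual2_module_def all_lookup expo_deg_lookup)+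

lemma coord_U3: "coord_module (uea_dual3_module G) (\<lambda>(i, j). mono_deg i + d2 j) U3.coord"
  and pts_U3: "pts (uea_dual3_module G) = quot_dual (uea_rels3 G)"
  by (rule U3.coord_module_dual; simp add: uea_dual3_module_def all_lookup expo_deg_lookup add.assoc)+

text \<open>The comparison isomorphism described by coordinates; \<open>f1\<close> agrees with
  \<open>beta_star G\<close> on modified functions, while \<open>f2\<close> and \<open>f3\<close>
  are its counterparts on the tensor square and cube.\<close>

definition f1 :: "('n, 'a fract) mps \<Rightarrow> ('n fword \<Rightarrow>\<^sub>0 'a) set \<Rightarrow> 'a" where
  "f1 x = U.of_coords (cf x)"
definition f2 :: "('n + 'n, 'a fract) mps \<Rightarrow> ('n fword \<times> 'n fword \<Rightarrow>\<^sub>0 'a) set \<Rightarrow> 'a" where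
  "f2 x = U2.of_coords (cf2 x)"
definition f3 :: "('n + ('n + 'n), 'a fract) mps \<Rightarrow> ('n fword \<times> ('n fword \<times> 'n fword) \<Rightarrow>\<^sub>0 'a) set \<Rightarrow> 'a" where
  "f3 x = U3.of_coords (cf3 x)"

lemma iso_f1: "filt_iso MF (uea_dual_module G) f1"
  by (rule coord_filt_iso'[OF coord_MF coord_U]) (simp_all add: f1_def pts_U U.of_coords(1) U.of_coords_dual)

lemma iso_f2: "filt_iso MF (uea_dual2_module G) f2"
  by (rule coord_filt_iso'[OF coord_MF2 coord_U2]) (simp_all add: f2_def pts_U2 U2.of_coords(1) U2.of_coords_dual)

lemma iso_f3: "filt_iso MF (uea_dual3_module G) f3"
  by (rule coord_filt_iso'[OF coord_MF3 coord_U3]) (simp_all add: f3_def pts_U3 U3.of_coords(1) U3.of_coords_dual)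

abbreviation ev1 :: "('n, 'a fract) mps \<Rightarrow> 'n fword \<Rightarrow> 'a" where
  "ev1 x \<equiv> U.ev (cf x)"

lemma to_quot_ev1: "x \<in> mod_functions \<Longrightarrow> to_quot (ev1 x w) = P x w"
  by (simp add: U.ev_def P_expand[of w x] to_quot_cf)

lemma ev1_eqI: "x \<in> mod_functions \<Longrightarrow> to_quot a = P x w \<Longrightarrow> a = ev1 x w"
  using to_quot_ev1[of x w] to_quot_inject by metis

lemma ev2_mten:
  assumes "x \<in> mod_functions" "y \<in> mod_functions"
  shows "U2.ev (cf2 (mten x y)) (v, w) = ev1 x v * ev1 y w"
proof -
  have "cf2 (mten x y) = (\<lambda>(i, j). cf x i * cf y j)"
    by (rule ext) (auto simp: cf2_mten[OF assms])
  thus ?thesis by (simp only: ev_tensor[OF dist_basis_uea dist_basis_uea])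
qed

lemma ev2_mten_fun:
  assumes "x \<in> mod_functions" "y \<in> mod_functions"
  shows "U2.ev (cf2 (mten x y)) = (\<lambda>(u, v). ev1 x u * ev1 y v)"
proof
  fix uv :: "'n fword \<times> 'n fword"
  obtain u v where uv: "uv = (u, v)" by force
  show "U2.ev (cf2 (mten x y)) uv = (case uv of (u, v) \<Rightarrow> ev1 x u * ev1 y v)"
    unfolding uv prod.case by (rule ev2_mten[OF assms])
qed

lemma cf_dpow: "cf (dpow i) = (\<lambda>j. if j = i then 1 else 0)"
proof
  fix j
  have "to_quot (cf (dpow i) j) = to_quot (if j = i then 1 else 0)"
    by (simp add: to_quot_cf modfun_dpow mcoeff_dpow)
  thus "cf (dpow i) j = (if j = i then 1 else 0)" by (simp only: to_quot_inject)
qed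

lemma cf2_dpow: "cf2 (mten (dpow i) (dpow j)) = (\<lambda>kl. if kl = (i, j) then 1 else 0)"
  by (rule ext) (auto simp: cf2_mten modfun_dpow cf_dpow split: if_splits)

abbreviation P2 :: "('n + 'n, 'a fract) mps \<Rightarrow> 'n fword \<Rightarrow> 'n fword \<Rightarrow> 'a fract" where
  "P2 F u v \<equiv> mcoeff (Q.ldiffs Inl (letters u) (Q.ldiffs Inr (letters v) F)) 0"

lemma mpull_0 [simp]: "mpull \<rho> 0 = 0"
  by (rule poly_mapping_eqI) simp

lemma P2_mten: "P2 (mten f g) u v = P f u * P g v"
  by (simp only: Q.ldiffs_mten_Inr Q.ldiffs_mten_Inl mcoeff_mten mpull_0)

text \<open>Both sides are additive and continuous in \<open>F\<close>, so scalar multiples of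
  products of divided powers suffice; on those the pairing splits by \<open>P2_mten\<close>.\<close>

lemma to_quot_ev2:
  assumes "F \<in> mod_functions"
  shows "to_quot (U2.ev (cf2 F) (u, v)) = P2 F u v"
proof -
  let ?A = "{i. E u i \<noteq> 0}" and ?B = "{j. E v j \<noteq> 0}"
  let ?T = "\<lambda>F :: ('n + 'n, 'a fract) mps. \<Sum>i\<in>?A. \<Sum>j\<in>?B.
      of_nat (mono_fact (mjoin i j)) * mcoeff F (mjoin i j) * to_quot (E u i * E v j)"
  have "P2 F u v = ?T F"
  proof (rule mcont_eq[where f = F and S = "\<lambda>F. P2 F u v"])
    show "mcont (\<lambda>F. P2 F u v)"
      by (rule mcont_coeff_comp[where k = "length (letters u) + length (letters v)"])
        (auto simp: Q.ldiffs_add Q.mord_ldiffs add.assoc[symmetric])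
    show "mcont ?T"
      unfolding mcont_def
    proof (intro conjI allI exI impI)
      fix F :: "('n + 'n, 'a fract) mps" assume F: "mord (Suc (length (letters u) + length (letters v))) F"
      have "mcoeff F (mjoin i j) = 0" if "E u i \<noteq> 0" "E v j \<noteq> 0" for i j
        by (rule mordD[OF F]) (use E_high_0[of u i] E_high_0[of v j] that in \<open>simp, linarith\<close>)
      thus "?T F = 0" by (intro sum.neutral ballI) simp
    qed (simp add: algebra_simps sum.distrib)
    fix c and m :: "('n + 'n) mono"
    define i j where "i = mpull Inl m" and "j = mpull Inr m"
    have m: "m = mjoin i j" by (simp add: i_def j_def)
    have mm: "mps_const c * mmono m = mps_const (c * of_nat (mono_fact m)) * mten (dpow i) (dpow j)"
    proof (rule mps_eqI)
      fix k :: "('n + 'n) mono"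
      have "k = m \<longleftrightarrow> mpull Inl k = i \<and> mpull Inr k = j"
        using mjoin_mpull[of k] m by (metis mpull_mjoin)
      thus "mcoeff (mps_const c * mmono m) k = mcoeff (mps_const (c * of_nat (mono_fact m)) * mten (dpow i) (dpow j)) k"
        unfolding mcoeff_const_mult mcoeff_mten mcoeff_dpow mcoeff_mmono by (auto simp: m)
    qed
    define C where "C = c * of_nat (mono_fact m) * to_quot (E u i * E v j)"
    have "P2 (mps_const c * mmono m) u v = C"
      unfolding mm Q.ldiffs_const_mult mcoeff_const_mult P2_mten C_def by (simp add: to_quot_E)
    also have "C = (\<Sum>k\<in>?A. if k = i then \<Sum>l\<in>?B. if l = j then C else 0 else 0)"
      by (auto simp: finite_E C_def)
    also have "\<dots> = (\<Sum>k\<in>?A. \<Sum>l\<in>?B. if k = i then if l = j then C else 0 else 0)"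
      by (intro sum.cong) auto
    also have "\<dots> = ?T (mps_const c * mmono m)"
      unfolding C_def by (intro sum.cong refl) (auto simp: mcoeff_mmono m)
    finally show "P2 (mps_const c * mmono m) u v = ?T (mps_const c * mmono m)" .
  qed
  also have "?T F = to_quot (U2.ev (cf2 F) (u, v))"
    unfolding ev_pair[OF dist_basis_uea dist_basis_uea] cf2_def prod.case to_quot_sum to_quot_simps(2) to_quot_cf[OF assms] ..
  finally show ?thesis by (rule sym)
qed

lemma P_append: "P x (u + FWord [i]) = P (Q.ldiff (\<lambda>j. j) i x) u"
  by (simp add: plus_fword_def)

lemma modfun_ldiff: "x \<in> mod_functions \<Longrightarrow> Q.ldiff (\<lambda>j. j) i x \<in> mod_functions"
  using modfun_ldiffs[of x "[i]"] by simp

lemma ev1_append: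
  assumes "x \<in> mod_functions"
  shows "ev1 x (u + FWord [i]) = ev1 (Q.ldiff (\<lambda>j. j) i x) u"
  by (rule ev1_eqI) (simp_all only: modfun_ldiff assms to_quot_ev1 P_append)

lemma ev1_0: "x \<in> mod_functions \<Longrightarrow> to_quot (ev1 x 0) = mcoeff x 0"
  by (simp add: to_quot_ev1 zero_fword_def)

text \<open>The Leibniz rule in dual form. The last letter acts on the functions first and is
  distributed over the two factors, hence the induction from the end of the word with
  \<open>x\<close> and \<open>y\<close> varying.\<close>

lemma ev1_comul:
  assumes "x \<in> mod_functions" "y \<in> mod_functions"
  shows "lin_ext (\<lambda>(u, v). ev1 x u * ev1 y v)
      (prod_list (map (\<lambda>i. outer (gen (FWord [i])) 1 + outer 1 (gen (FWord [i]))) w)) = ev1 (x * y) (FWord w)"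
  using assms
proof (induction w arbitrary: x y rule: rev_induct)
  case Nil
  have "lin_ext (\<lambda>(u, v). ev1 x u * ev1 y v) 1 = ev1 x 0 * ev1 y 0"
    by (simp add: zero_prod_def flip: single_one)
  also have "\<dots> = ev1 (x * y) 0"
    by (rule ev1_eqI) (simp_all add: modfun_mult Nil ev1_0 zero_fword_def[symmetric], simp add: zero_fword_def)
  finally show ?case by (simp add: zero_fword_def)
next
  case (snoc i w)
  let ?D = "Q.ldiff (\<lambda>j. j) i"
  have left: "lin_ext (\<lambda>(u, v). ev1 x u * ev1 y v) (z * outer (gen (FWord [i])) 1) = lin_ext (\<lambda>(u, v). ev1 (?D x) u * ev1 y v) z" for z
  proof (induction z rule: poly_mapping_induct_add)
    case (add p r z)
    have "Poly_Mapping.single p r * outer (gen (FWord [i])) 1 = Poly_Mapping.single (fst p + FWord [i], snd p) r"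
      by (cases p) (simp add: outer_single mult_single flip: single_one)
    with add show ?case by (simp add: distrib_right lin_ext_add ev1_append snoc.prems case_prod_unfold)
  qed simp
  have right: "lin_ext (\<lambda>(u, v). ev1 x u * ev1 y v) (z * outer 1 (gen (FWord [i]))) = lin_ext (\<lambda>(u, v). ev1 x u * ev1 (?D y) v) z" for z
  proof (induction z rule: poly_mapping_induct_add)
    case (add p r z)
    have "Poly_Mapping.single p r * outer 1 (gen (FWord [i])) = Poly_Mapping.single (fst p, snd p + FWord [i]) r"
      by (cases p) (simp add: outer_single mult_single flip: single_one)
    with add show ?case by (simp add: distrib_right lin_ext_add ev1_append snoc.prems case_prod_unfold)
  qed simp
  have "ev1 (?D x * y) (FWord w) + ev1 (x * ?D y) (FWord w) = ev1 (x * y) (FWord (w @ [i]))"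
    by (rule ev1_eqI)
      (simp_all add: modfun_mult modfun_ldiff snoc.prems to_quot_ev1 Q.ldiff_mult Q.ldiffs_add)
  thus ?case
    by (simp add: distrib_left lin_ext_add left right snoc.IH modfun_ldiff snoc.prems)
qed

text \<open>The map descends to cosets because its transpose sends the coordinate
  \<open>(i, j)\<close> to the function \<open>dpow i * dpow j\<close>.\<close>

lemma uea_comul_cls:
  "uea_comul G (cls (uea_rels G) z) = cls (uea_rels2 G) (alg_ext (\<lambda>w.
     prod_list (map (\<lambda>i. outer (gen (FWord [i])) 1 + outer 1 (gen (FWord [i]))) (letters w))) z)"
  unfolding uea_comul_def
proof (rule on_cls_alg_ext[OF dist_basis_uea U2.dist_basis_axioms])
  fix ij :: "'n mono \<times> 'n mono" and w :: "'n fword"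
  obtain i j where ij: "ij = (i, j)" by force
  show "U2.EE (prod_list (map (\<lambda>i. outer (gen (FWord [i])) 1 + outer 1 (gen (FWord [i]))) (letters w))) ij =
      U.ev (case ij of (i, j) \<Rightarrow> cf (dpow i * dpow j)) w"
    unfolding U2.EE_ev ij prod.case cf2_dpow[symmetric] ev2_mten_fun[OF modfun_dpow modfun_dpow]
      ev1_comul[OF modfun_dpow modfun_dpow] fword.collapse ..
qed

lemma f1_cls: "f1 x (cls (uea_rels G) z) = lin_ext (ev1 x) z"
  by (simp add: f1_def U.of_coords(2))

lemma f2_cls: "f2 F (cls (uea_rels2 G) z) = lin_ext (U2.ev (cf2 F)) z"
  by (simp add: f2_def U2.of_coords(2))

lemma ev1_mul:
  assumes "x \<in> mod_functions"
  shows "lin_ext (ev1 x) (gen u * gen v) = U2.ev (cf2 (mps_subst x GQ)) (u, v)"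
proof -
  have "to_quot (ev1 x (u + v)) = to_quot (U2.ev (cf2 (mps_subst x GQ)) (u, v))"
    unfolding to_quot_ev1[OF assms] to_quot_ev2[OF modfun_subst_GQ[OF assms]] plus_fword_def fword.sel
    by (rule Q.mcoeff_ldiffs_append)
  thus ?thesis by (simp add: mult_single)
qed

text \<open>Here the transpose sends the coordinate \<open>i\<close> to \<open>dpow i\<close>
  composed with the group law, by left invariance.\<close>

lemma uea_mul_cls:
  "uea_mul G (cls (uea_rels2 G) z) = cls (uea_rels G) (alg_ext (\<lambda>(u, v). gen u * gen v) z)"
  unfolding uea_mul_def
proof (rule on_cls_alg_ext[OF U2.dist_basis_axioms dist_basis_uea])
  fix i and p :: "'n fword \<times> 'n fword"
  show "U.EE (case p of (u, v) \<Rightarrow> gen u * gen v) i = U2.ev (cf2 (mps_subst (dpow i) GQ)) p"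
    unfolding U.EE_ev cf_dpow[symmetric] by (cases p) (simp only: prod.case ev1_mul modfun_dpow)
qed

lemma antipode_word:
  "prod_list (map (\<lambda>i. - gen (FWord [i])) w) = (Poly_Mapping.single (FWord w) ((- 1) ^ length w) :: 'n fword \<Rightarrow>\<^sub>0 'a)"
proof (induction w)
  case (Cons i w)
  have "- gen (FWord [i]) * Poly_Mapping.single (FWord w) ((- 1) ^ length w) =
      (Poly_Mapping.single (FWord (i # w)) (- 1 * (- 1) ^ length w) :: 'n fword \<Rightarrow>\<^sub>0 'a)"
    by (simp add: mult_single plus_fword_def flip: single_uminus)
  thus ?case by (simp add: Cons)
qed (simp add: gen_fword_Nil)

lemma modfun_subst_s: "x \<in> mod_functions \<Longrightarrow> mps_subst x s \<in> mod_functions"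
  by (rule modfun_subst) (use cfree_s in simp_all)

lemma ev1_antipode:
  assumes "x \<in> mod_functions"
  shows "lin_ext (ev1 x) (prod_list (map (\<lambda>i. - gen (FWord [i])) (rev (letters w)))) = ev1 (mps_subst x s) w"
proof (rule ev1_eqI)
  have "to_quot ((- 1) ^ k :: 'a) = (- 1) ^ k" for k by (induction k) simp_all
  thus "to_quot (lin_ext (ev1 x) (prod_list (map (\<lambda>i. - gen (FWord [i])) (rev (letters w))))) = P (mps_subst x s) w"
    unfolding antipode_word lin_ext_single Q.mcoeff_ldiffs_inverse[OF cfree_s app_s(2)]
    by (simp add: to_quot_ev1 assms)
qed (rule modfun_subst_s[OF assms])

text \<open>The signed reversed words are transposed to composition with \<open>s\<close>, so
  coordinates again go to modified functions.\<close>

lemma uea_antipode_cls: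
  "uea_antipode G (cls (uea_rels G) z) = cls (uea_rels G) (alg_ext (\<lambda>w.
     prod_list (map (\<lambda>i. - gen (FWord [i])) (rev (letters w)))) z)"
  unfolding uea_antipode_def
proof (rule on_cls_alg_ext[OF dist_basis_uea dist_basis_uea])
  fix i w
  show "U.EE (prod_list (map (\<lambda>i. - gen (FWord [i])) (rev (letters w)))) i = U.ev (cf (mps_subst (dpow i) s)) w"
    unfolding U.EE_ev cf_dpow[symmetric] by (rule ev1_antipode[OF modfun_dpow])
qed

lemma ev1_unit: "ev1 1 w = prod_list (map (\<lambda>_. 0) (letters w))"
proof -
  have "Q.ldiffs (\<lambda>j. j) u 1 = (if u = [] then 1 else 0)" for u
    by (induction u rule: rev_induct) simp_all
  moreover have "prod_list (map (\<lambda>_. 0) u) = (if u = [] then 1 else 0 :: 'a)" for u :: "'n list"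
    by (cases u) simp_all
  ultimately have "to_quot (prod_list (map (\<lambda>_. 0) (letters w)) :: 'a) = P 1 w" by (simp add: mcoeff_1)
  from ev1_eqI[OF modfun_1 this] show ?thesis by simp
qed

text \<open>The functional defining the comparison map is unique because words span the free algebra.\<close>
lemma beta_star_eq:
  assumes "x \<in> mod_functions"
  shows "beta_star G x = f1 x"
proof -
  have word: "prod_list (map (\<lambda>i. gen (FWord [i])) w) = (gen (FWord w) :: 'n fword \<Rightarrow>\<^sub>0 'a)" for w :: "'n list"
    using gen_fword_prod_list[of "\<lambda>i. [i]" w] by simp
  have iter: "(\<lambda>j. mapq (fgl_iter G k j)) = fgl_iter GQ k" for k
  proof (induction k)
    case (Suc k)
    show ?case
    proof
      fix j
      show "mapq (fgl_iter G (Suc k) j) = fgl_iter GQ (Suc k) j"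
        unfolding R.fgl_iter_Suc Q.fgl_iter_Suc mapq_fgl_app[OF R.cfree_iter cfree_var_block] Suc mapq_var_block ..
    qed
  qed simp
  have formula: "mcoeff (foldr mps_deriv (List.enumerate 0 w) (mps_subst x (\<lambda>j. mapq (fgl_iter G (length w) j)))) 0 = P x (FWord w)" for w
    unfolding iter by (simp add: Q.mcoeff_derivs_iter)
  have f1: "to_quot (f1 x (cls (uea_rels G) (gen w))) = P x w" for w
    by (simp add: f1_cls to_quot_ev1 assms)
  have f1_in: "f1 x \<in> quot_dual (uea_rels G)" by (simp add: f1_def U.of_coords(1))
  show ?thesis
    unfolding beta_star_def formula word
  proof (rule the_equality)
    fix \<phi> assume \<phi>: "\<phi> \<in> quot_dual (uea_rels G) \<and> (\<forall>is. to_quot (\<phi> (cls (uea_rels G) (gen (FWord is)))) = P x (FWord is))"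
    have "\<phi> (cls (uea_rels G) (gen w)) = f1 x (cls (uea_rels G) (gen w))" for w
    proof -
      have "to_quot (\<phi> (cls (uea_rels G) (gen w))) = to_quot (f1 x (cls (uea_rels G) (gen w)))"
        unfolding f1 using \<phi> by (metis fword.collapse)
      thus ?thesis by (simp only: to_quot_inject)
    qed
    hence words: "(\<lambda>w. \<phi> (cls (uea_rels G) (gen w))) = (\<lambda>w. f1 x (cls (uea_rels G) (gen w)))" by blast
    from \<phi> have \<phi>_in: "\<phi> \<in> quot_dual (uea_rels G)" ..
    show "\<phi> = f1 x"
    proof (rule quot_dual_eqI[OF \<phi>_in f1_in])
      fix z
      show "\<phi> (cls (uea_rels G) z) = f1 x (cls (uea_rels G) z)"
        unfolding quot_dual_linear[OF \<phi>_in, of z] quot_dual_linear[OF f1_in, of z] words ..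
    qed
  qed (use f1 f1_in in simp)
qed

lemma U_sel:
  "mdl (uea_dual_hopf G) = uea_dual_module G" "sq (uea_dual_hopf G) = uea_dual2_module G"
  "cube (uea_dual_hopf G) = uea_dual3_module G"
  "ten (uea_dual_hopf G) = tensor_functional (uea_rels G) (uea_rels G)"
  "tenl (uea_dual_hopf G) = (\<lambda>p \<phi>. functional (uea_rels3 G) (on_cls (lin_ext (\<lambda>(u, v, w).
     p (cls (uea_rels2 G) (gen (u, v))) * \<phi> (cls (uea_rels G) (gen w))))))"
  "tenr (uea_dual_hopf G) = tensor_functional (uea_rels G) (uea_rels2 G)"
  "mul (uea_dual_hopf G) = (\<lambda>\<psi> \<phi>. functional (uea_rels G)
     (\<lambda>C. tensor_functional (uea_rels G) (uea_rels G) \<psi> \<phi> (uea_comul G C)))"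
  "unt (uea_dual_hopf G) = functional (uea_rels G) (uea_counit G)"
  "comul (uea_dual_hopf G) = (\<lambda>\<phi>. functional (uea_rels2 G) (\<lambda>C. \<phi> (uea_mul G C)))"
  "counit (uea_dual_hopf G) = (\<lambda>\<phi>. \<phi> (cls (uea_rels G) 1))"
  "antipode (uea_dual_hopf G) = (\<lambda>\<phi>. functional (uea_rels G) (\<lambda>C. \<phi> (uea_antipode G C)))"
  by (simp_all add: uea_dual_hopf_def Let_def)

lemma ten_U:
  assumes "x \<in> mod_functions" "y \<in> mod_functions"
  shows "tensor_functional (uea_rels G) (uea_rels G) (f1 x) (f1 y) = f2 (mten x y)"
proof -
  have "(\<lambda>(v, w). f1 x (cls (uea_rels G) (gen v)) * f1 y (cls (uea_rels G) (gen w))) = U2.ev (cf2 (mten x y))"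
    unfolding ev2_mten_fun[OF assms] by (simp add: f1_cls)
  thus ?thesis unfolding tensor_functional_def uea_rels2_def[symmetric] f2_def U2.of_coords_def by (simp only:)
qed

lemma tenr_U:
  assumes "x \<in> mod_functions" "p \<in> mod_functions"
  shows "tensor_functional (uea_rels G) (uea_rels2 G) (f1 x) (f2 p) = f3 (mten x p)"
proof -
  have "cf3 (mten x p) = (\<lambda>(i, jk). cf x i * cf2 p jk)"
    by (rule ext) (auto simp: cf3_tenr[OF assms])
  hence "U3.ev (cf3 (mten x p)) vw = (case vw of (v, w) \<Rightarrow> ev1 x v * U2.ev (cf2 p) w)" for vw
    by (cases vw) (simp only: prod.case ev_tensor[OF dist_basis_uea U2.dist_basis_axioms])
  hence "(\<lambda>(v, w). f1 x (cls (uea_rels G) (gen v)) * f2 p (cls (uea_rels2 G) (gen w))) = U3.ev (cf3 (mten x p))"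
    by (intro ext) (simp only: f1_cls f2_cls lin_ext_single mult_1_left)
  thus ?thesis unfolding tensor_functional_def uea_rels3_def[symmetric] f3_def U3.of_coords_def by (simp only:)
qed

text \<open>Coordinates on the cube are nested to the right, so the triple sum has to be regrouped
  for the left bracketing.\<close>

lemma tenl_U:
  assumes "p \<in> mod_functions" "x \<in> mod_functions"
  shows "functional (uea_rels3 G) (on_cls (lin_ext (\<lambda>(u, v, w).
     f2 p (cls (uea_rels2 G) (gen (u, v))) * f1 x (cls (uea_rels G) (gen w))))) = f3 (mten3 p x)"
proof -
  have "U3.ev (cf3 (mten3 p x)) (u, v, w) = U2.ev (cf2 p) (u, v) * ev1 x w" for u v w
  proof -
    have fin: "finite {j. E2 (v, w) j \<noteq> 0}" by (rule U2.finite_E)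
    have "U3.ev (cf3 (mten3 p x)) (u, v, w) =
        (\<Sum>i | E u i \<noteq> 0. \<Sum>jk | E2 (v, w) jk \<noteq> 0. cf3 (mten3 p x) (i, jk) * (E u i * E2 (v, w) jk))"
      by (rule ev_pair[OF dist_basis_uea U2.dist_basis_axioms])
    also have "\<dots> = (\<Sum>i | E u i \<noteq> 0. \<Sum>jk\<in>{j. E v j \<noteq> 0} \<times> {k. E w k \<noteq> 0}. cf3 (mten3 p x) (i, jk) * (E u i * E2 (v, w) jk))"
      by (intro sum.cong refl sum.mono_neutral_left) (auto simp: finite_E)
    also have "\<dots> = (\<Sum>i | E u i \<noteq> 0. \<Sum>j | E v j \<noteq> 0. \<Sum>k | E w k \<noteq> 0. (cf2 p (i, j) * (E u i * E v j)) * (cf x k * E w k))"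
      unfolding sum.cartesian_product' by (intro sum.cong refl) (simp only: cf3_tenl[OF assms] prod.case, simp only: mult_ac)
    also have "\<dots> = U2.ev (cf2 p) (u, v) * ev1 x w"
      unfolding ev_pair[OF dist_basis_uea dist_basis_uea] U.ev_def sum_distrib_right by (simp only: sum_distrib_left)
    finally show ?thesis .
  qed
  hence "(\<lambda>(u, v, w). f2 p (cls (uea_rels2 G) (gen (u, v))) * f1 x (cls (uea_rels G) (gen w))) = U3.ev (cf3 (mten3 p x))"
    by (auto simp: f1_cls f2_cls fun_eq_iff)
  thus ?thesis by (simp add: f3_def U3.of_coords_def)
qed

lemma iso_beta_star: "filt_iso MF (uea_dual_module G) (beta_star G)"
proof (rule coord_filt_iso'[OF coord_MF coord_U])
  fix x :: "('n, 'a fract) mps" and i assume x: "x \<in> pts MF"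
  hence "beta_star G x = f1 x" by (simp add: beta_star_eq)
  thus "beta_star G x \<in> pts (uea_dual_module G)" "U.coord (beta_star G x) i = cf x i"
    by (simp_all add: f1_def pts_U U.of_coords(1) U.of_coords_dual)
qed

text \<open>Every functional in question comes from a modified function through \<open>f1\<close> or
  \<open>f2\<close>, so the coordinates of its tensor products can be read off on the side of
  functions.\<close>

lemma completed_U:
  "is_completed_tensor (uea_dual_module G) (uea_dual_module G) (uea_dual2_module G) (tensor_functional (uea_rels G) (uea_rels G))"
  "is_completed_tensor (uea_dual_module G) (uea_dual2_module G) (uea_dual3_module G) (tensor_functional (uea_rels G) (uea_rels2 G))"
  "is_completed_tensor (uea_dual2_module G) (uea_dual_module G) (uea_dual3_module G) (tenl (uea_dual_hopf G))"
proof -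
  note b1 = filt_iso_ball[OF iso_f1] and b2 = filt_iso_ball[OF iso_f2]
  have c1: "U.coord (f1 x) i = cf x i" for x i by (simp add: f1_def U.of_coords_dual)
  have c2: "U2.coord (f2 x) i = cf2 x i" for x i by (simp add: f2_def U2.of_coords_dual)
  have c3: "U3.coord (f3 x) i = cf3 x i" for x i by (simp add: f3_def U3.of_coords_dual)
  have p: "f1 x \<in> pts (uea_dual_module G)" "f2 y \<in> pts (uea_dual2_module G)" "f3 z \<in> pts (uea_dual3_module G)" for x y z
    by (simp_all add: f1_def f2_def f3_def pts_U pts_U2 pts_U3 U.of_coords(1) U2.of_coords(1) U3.of_coords(1))
  have s1: "\<exists>x\<in>mod_functions. \<phi> = f1 x" if "\<phi> \<in> pts (uea_dual_module G)" for \<phi>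
    using that filt_iso_img[OF iso_f1, of 0] by auto
  have s2: "\<exists>x\<in>mod_functions. \<phi> = f2 x" if "\<phi> \<in> pts (uea_dual2_module G)" for \<phi>
    using that filt_iso_img[OF iso_f2, of 0] by auto
  interpret t: coord_tensor "uea_dual_module G" mono_deg U.coord "uea_dual_module G" mono_deg U.coord
    "uea_dual2_module G" U2.coord "tensor_functional (uea_rels G) (uea_rels G)"
  proof (intro coord_tensor.intro coord_U coord_U2 coord_tensor_axioms.intro)
    fix \<phi> \<psi> i j assume "\<phi> \<in> pts (uea_dual_module G)" "\<psi> \<in> pts (uea_dual_module G)"
    then obtain x y where "x \<in> mod_functions" "y \<in> mod_functions" "\<phi> = f1 x" "\<psi> = f1 y" using s1 by blast
    thus "tensor_functional (uea_rels G) (uea_rels G) \<phi> \<psi> \<in> pts (uea_dual2_module G)"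
      "U2.coord (tensor_functional (uea_rels G) (uea_rels G) \<phi> \<psi>) (i, j) = U.coord \<phi> i * U.coord \<psi> j"
      by (simp_all only: ten_U p c1 c2 cf2_mten)
  qed
  show "is_completed_tensor (uea_dual_module G) (uea_dual_module G) (uea_dual2_module G) (tensor_functional (uea_rels G) (uea_rels G))"
    by (rule t.completed_tensor)
  interpret tr: coord_tensor "uea_dual_module G" mono_deg U.coord "uea_dual2_module G" d2 U2.coord
    "uea_dual3_module G" U3.coord "tensor_functional (uea_rels G) (uea_rels2 G)"
  proof (intro coord_tensor.intro coord_U coord_U2 coord_U3 coord_tensor_axioms.intro)
    fix \<phi> \<psi> i j assume "\<phi> \<in> pts (uea_dual_module G)" "\<psi> \<in> pts (uea_dual2_module G)"
    then obtain x y where "x \<in> mod_functions" "y \<in> mod_functions" "\<phi> = f1 x" "\<psi> = f2 y" using s1 s2 by blast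
    thus "tensor_functional (uea_rels G) (uea_rels2 G) \<phi> \<psi> \<in> pts (uea_dual3_module G)"
      "U3.coord (tensor_functional (uea_rels G) (uea_rels2 G) \<phi> \<psi>) (i, j) = U.coord \<phi> i * U2.coord \<psi> j"
      by (simp_all only: tenr_U p c1 c2 c3 cf3_tenr)
  qed
  show "is_completed_tensor (uea_dual_module G) (uea_dual2_module G) (uea_dual3_module G) (tensor_functional (uea_rels G) (uea_rels2 G))"
    by (rule tr.completed_tensor)
  have "coord_module (uea_dual3_module G) (\<lambda>(ij, k). d2 ij + mono_deg k) (\<lambda>F ((i, j), k). U3.coord F (i, j, k))"
    using coord_module_reindex[OF coord_U3 bij_assoc] by (simp add: case_prod_unfold add.assoc)
  then interpret tl: coord_tensor "uea_dual2_module G" d2 U2.coord "uea_dual_module G" mono_deg U.coord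
    "uea_dual3_module G" "\<lambda>F ((i, j), k). U3.coord F (i, j, k)" "tenl (uea_dual_hopf G)"
  proof (intro coord_tensor.intro coord_U coord_U2 coord_tensor_axioms.intro)
    fix \<phi> \<psi> and ij :: "'n mono \<times> 'n mono" and k assume "\<phi> \<in> pts (uea_dual2_module G)" "\<psi> \<in> pts (uea_dual_module G)"
    then obtain x y where xy: "x \<in> mod_functions" "y \<in> mod_functions" "\<phi> = f2 x" "\<psi> = f1 y" using s1 s2 by blast
    obtain i j where ij: "ij = (i, j)" by force
    show "tenl (uea_dual_hopf G) \<phi> \<psi> \<in> pts (uea_dual3_module G)"
      using xy by (simp only: U_sel tenl_U p)
    show "(case (ij, k) of (x, k) \<Rightarrow> (case x of (i, j) \<Rightarrow> \<lambda>k. U3.coord (tenl (uea_dual_hopf G) \<phi> \<psi>) (i, j, k)) k) =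
        U2.coord \<phi> ij * U.coord \<psi> k"
      using xy by (simp only: U_sel tenl_U ij prod.case c1 c2 c3 cf3_tenl)
  qed
  show "is_completed_tensor (uea_dual2_module G) (uea_dual_module G) (uea_dual3_module G) (tenl (uea_dual_hopf G))"
    by (rule tl.completed_tensor)
qed

text \<open>The isomorphisms accompanying \<open>beta_star G\<close> on the tensor square and cube
  are \<open>f2\<close> and \<open>f3\<close>. Each structure map is compared by evaluating the
  functionals on cosets of representatives.\<close>

theorem beta_iso: "complete_hopf_iso (mod_functions_hopf G) (uea_dual_hopf G) (beta_star G)"
proof (rule hopf_transport[OF hopf_MF])
  show "complete_module (mdl (uea_dual_hopf G))"
    unfolding U_sel by (rule coord_module.complete[OF coord_U])
  show "is_completed_tensor (mdl (uea_dual_hopf G)) (mdl (uea_dual_hopf G)) (sq (uea_dual_hopf G)) (ten (uea_dual_hopf G))"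
    "is_completed_tensor (mdl (uea_dual_hopf G)) (sq (uea_dual_hopf G)) (cube (uea_dual_hopf G)) (tenr (uea_dual_hopf G))"
    "is_completed_tensor (sq (uea_dual_hopf G)) (mdl (uea_dual_hopf G)) (cube (uea_dual_hopf G)) (tenl (uea_dual_hopf G))"
    using completed_U unfolding U_sel by blast+
  show "filt_iso (mdl (mod_functions_hopf G)) (mdl (uea_dual_hopf G)) (beta_star G)"
    unfolding U_sel MF_sel by (rule iso_beta_star)
  show "filt_iso (sq (mod_functions_hopf G)) (sq (uea_dual_hopf G)) f2"
    unfolding U_sel MF_sel by (rule iso_f2)
  show "filt_iso (cube (mod_functions_hopf G)) (cube (uea_dual_hopf G)) f3"
    unfolding U_sel MF_sel by (rule iso_f3)
  show "unt (uea_dual_hopf G) = beta_star G (unt (mod_functions_hopf G))"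
  proof -
    have "(\<lambda>w. prod_list (map (\<lambda>_. 0) (letters w))) = ev1 1"
      by (simp add: ev1_unit fun_eq_iff)
    thus ?thesis
      unfolding U_sel MF_sel beta_star_eq[OF modfun_1] f1_def U.of_coords_def uea_counit_def by simp
  qed
next
  fix x assume "x \<in> pts (mdl (mod_functions_hopf G))"
  hence x: "x \<in> mod_functions" by (simp add: MF_sel)
  show "comul (uea_dual_hopf G) (beta_star G x) = f2 (comul (mod_functions_hopf G) x)"
    unfolding U_sel MF_sel beta_star_eq[OF x] f2_def
  proof (rule U2.functional_eq_of_coords)
    fix z
    have "(\<lambda>p. lin_ext (ev1 x) (case p of (u, v) \<Rightarrow> gen u * gen v)) = U2.ev (cf2 (mps_subst x GQ))"
      by (rule ext) (auto simp: ev1_mul[OF x] simp del: lin_ext_single)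
    thus "f1 x (uea_mul G (cls (uea_rels2 G) z)) = lin_ext (U2.ev (cf2 (mps_subst x GQ))) z"
      unfolding uea_mul_cls f1_cls lin_ext_alg_ext by simp
  qed
  show "counit (uea_dual_hopf G) (beta_star G x) = counit (mod_functions_hopf G) x"
  proof -
    have "f1 x (cls (uea_rels G) 1) = ev1 x 0"
      unfolding f1_cls by (simp flip: single_one)
    also have "\<dots> = the_inv to_quot (to_quot (ev1 x 0))" by simp
    also have "\<dots> = the_inv to_quot (mcoeff x 0)" by (simp only: ev1_0[OF x])
    finally show ?thesis unfolding U_sel MF_sel beta_star_eq[OF x] .
  qed
  show "antipode (uea_dual_hopf G) (beta_star G x) = beta_star G (antipode (mod_functions_hopf G) x)"
    unfolding U_sel MF_sel beta_star_eq[OF x] beta_star_eq[OF modfun_subst_s[OF x]] f1_def[of "mps_subst x s"]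
  proof (rule U.functional_eq_of_coords)
    fix z
    show "f1 x (uea_antipode G (cls (uea_rels G) z)) = lin_ext (ev1 (mps_subst x s)) z"
      unfolding uea_antipode_cls f1_cls lin_ext_alg_ext ev1_antipode[OF x] ..
  qed
  fix y assume "y \<in> pts (mdl (mod_functions_hopf G))"
  hence y: "y \<in> mod_functions" by (simp add: MF_sel)
  show "ten (uea_dual_hopf G) (beta_star G x) (beta_star G y) = f2 (ten (mod_functions_hopf G) x y)"
    unfolding U_sel MF_sel beta_star_eq[OF x] beta_star_eq[OF y] by (rule ten_U[OF x y])
  show "mul (uea_dual_hopf G) (beta_star G x) (beta_star G y) = beta_star G (mul (mod_functions_hopf G) x y)"
    unfolding U_sel MF_sel beta_star_eq[OF x] beta_star_eq[OF y] beta_star_eq[OF modfun_mult[OF x y]] ten_U[OF x y] f1_def[of "x * y"]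
  proof (rule U.functional_eq_of_coords)
    fix z
    have "U2.ev (cf2 (mten x y)) = (\<lambda>(u, v). ev1 x u * ev1 y v)"
      by (rule ext) (auto simp: ev2_mten[OF x y])
    thus "f2 (mten x y) (uea_comul G (cls (uea_rels G) z)) = lin_ext (ev1 (x * y)) z"
      unfolding uea_comul_cls f2_cls lin_ext_alg_ext by (simp add: ev1_comul[OF x y])
  qed
next
  fix p x assume "p \<in> pts (sq (mod_functions_hopf G))" "x \<in> pts (mdl (mod_functions_hopf G))"
  hence px: "p \<in> mod_functions" "x \<in> mod_functions" by (simp_all add: MF_sel)
  show "tenl (uea_dual_hopf G) (f2 p) (beta_star G x) = f3 (tenl (mod_functions_hopf G) p x)"
    unfolding U_sel MF_sel beta_star_eq[OF px(2)] by (rule tenl_U[OF px])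
next
  fix x p assume "x \<in> pts (mdl (mod_functions_hopf G))" "p \<in> pts (sq (mod_functions_hopf G))"
  hence px: "x \<in> mod_functions" "p \<in> mod_functions" by (simp_all add: MF_sel)
  show "tenr (uea_dual_hopf G) (beta_star G x) (f2 p) = f3 (tenr (mod_functions_hopf G) x p)"
    unfolding U_sel MF_sel beta_star_eq[OF px(1)] by (rule tenr_U[OF px])
qed

end

theorem proposition3p8:
  fixes G :: "('n::{finite,linorder}, 'a::{idom,ring_char_0}) fgl"
  assumes "is_fgl G"
  shows "complete_hopf_iso (mod_functions_hopf G) (uea_dual_hopf G) (beta_star G)"
proof -
  interpret domain_group G by unfold_locales (rule assms)
  show ?thesis by (rule beta_iso)
qed

end
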